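(* Let $W=\langle S|M\rangle$ be a (finite rank) Coxeter system satisfying $m_{i,j}\ne2$ for all $i,j$, and fix $p\in[1,\infty]$. Let $E_0$ be the set of pairs $\{s_i,s_j\}$, $i\ne j$, with $m_{i,j}$ finite and even, and $E_1$ the set of pairs $\{s_i,s_j\}$, $i\neq j$, with $m_{i,j}$ finite and odd. Then the quantum Markov semi-group $(\Phi_t)_{t\ge0}$ on $\mathcal{L}(W)$ associated to the word length $\psi_S$ is gradient-$\mathcal{S}_p$ if and only if $(S,E_1)$ is a forest, and for every connected component $C$ of $(S,E_1)$ there is at most one edge $\{t,r\}\in E_0$ with $t\in C$ and $r\notin C$, and no edge $\{t,t'\}\in E_0$ with $t,t'\in C$.
   Context: A finite rank Coxeter system $W=\langle S|M\rangle$ consists of a finite set $S=\{s_1,\dots,s_n\}$ and a symmetric matrix $M=(m_{i,j})$ with $m_{i,j}\in\mathbb{N}\cup\{\infty\}$, $m_{i,i}=1$, $m_{i,j}\ge2$ for $i\ne j$; $W$ is the group generated by $S$ subject to $(s_is_j)^{m_{i,j}}=e$ whenever $m_{i,j}<\infty$. $\psi_S(\mathbf w)=|\mathbf w|$ is the word length; it is conditionally of negative type, so $\Phi_t(\lambda_{\mathbf w})=e^{-t|\mathbf w|}\lambda_{\mathbf w}$ defines a quantum Markov semi-group on the group von Neumann algebra $\mathcal{L}(W)$. Gradient-$\mathcal{S}_p$: let $\mathbb{C}[W]=\mathrm{span}\{\lambda_{\mathbf w}\}$ and $\Delta(\lambda_{\mathbf w})=|\mathbf w|\lambda_{\mathbf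 w}$. The semi-group is gradient-$\mathcal{S}_p$ if for all $a,b\in\mathbb{C}[W]$ the map $\Psi^{a,b}(x)=\Delta(axb)+a\Delta(x)b-\Delta(ax)b-a\Delta(xb)$ on $\mathbb{C}[W]$ extends (via $x\mapsto x\delta_e$) to a bounded operator on $\ell_2(W)$ in the Schatten class $\mathcal{S}_p$ ($\mathcal{S}_\infty$ = compact operators). *)

theory Defs
  imports
    "HOL-Algebra.Group"
    "HOL-Analysis.Infinite_Sum"
    "HOL-Library.Extended_Nat"
    "HOL-Library.Extended_Real"
begin

section \<open>Groups given by generators and relators\<close>

text \<open>
  A letter \<open>(s, True)\<close> stands for the generator \<open>s\<close> and \<open>(s, False)\<close> for its formal inverse.
  \<open>pres_eq S R u v\<close> says that the words \<open>u\<close> and \<open>v\<close> over \<open>S\<close> represent the same element of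
  the group \<open>\<langle>S | r = e (r \<in> R)\<rangle>\<close>.
\<close>

inductive pres_eq ::
    "'a set \<Rightarrow> ('a \<times> bool) list set \<Rightarrow> ('a \<times> bool) list \<Rightarrow> ('a \<times> bool) list \<Rightarrow> bool"
  for S R where
  refl: "w \<in> lists (S \<times> UNIV) \<Longrightarrow> pres_eq S R w w"
| sym: "pres_eq S R u v \<Longrightarrow> pres_eq S R v u"
| trans: "pres_eq S R u v \<Longrightarrow> pres_eq S R v w \<Longrightarrow> pres_eq S R u w"
| append: "pres_eq S R u u' \<Longrightarrow> pres_eq S R v v' \<Longrightarrow> pres_eq S R (u @ v) (u' @ v')"
| cancel: "s \<in> S \<Longrightarrow> pres_eq S R [(s, b), (s, \<not> b)] []"
| relator: "r \<in> R \<Longrightarrow> r \<in> lists (S \<times> UNIV) \<Longrightarrow> pres_eq S R r []"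

definition pres_class :: "'a set \<Rightarrow> ('a \<times> bool) list set \<Rightarrow> ('a \<times> bool) list \<Rightarrow> ('a \<times> bool) list set"
  where "pres_class S R w = {v. pres_eq S R w v}"

definition presented_group :: "'a set \<Rightarrow> ('a \<times> bool) list set \<Rightarrow> ('a \<times> bool) list set monoid"
  where "presented_group S R =
    \<lparr>carrier = pres_class S R ` lists (S \<times> UNIV),
     monoid.mult = (\<lambda>A B. \<Union>u\<in>A. \<Union>v\<in>B. pres_class S R (u @ v)),
     one = pres_class S R []\<rparr>"

lemma pres_eq_words: "pres_eq S R u v \<Longrightarrow> u \<in> lists (S \<times> UNIV) \<and> v \<in> lists (S \<times> UNIV)"
  by (induction rule: pres_eq.induct) auto

lemma pres_class_eqI: "pres_eq S R u v \<Longrightarrow> pres_class S R u = pres_class S R v"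
  unfolding pres_class_def by (blast intro: pres_eq.sym pres_eq.trans)

lemma pres_class_eq_iff:
  "u \<in> lists (S \<times> UNIV) \<Longrightarrow> pres_class S R u = pres_class S R v \<longleftrightarrow> pres_eq S R u v"
  by (metis pres_class_eqI pres_class_def mem_Collect_eq pres_eq.refl pres_eq.sym)

lemma presented_group_mult:
  assumes "u \<in> lists (S \<times> UNIV)" "v \<in> lists (S \<times> UNIV)"
  shows "pres_class S R u \<otimes>\<^bsub>presented_group S R\<^esub> pres_class S R v = pres_class S R (u @ v)"
proof -
  have *: "pres_class S R (u' @ v') = pres_class S R (u @ v)"
    if "u' \<in> pres_class S R u" "v' \<in> pres_class S R v" for u' v'
    using that unfolding pres_class_def [of S R u] pres_class_def [of S R v]
    by (metis mem_Collect_eq pres_class_eqI pres_eq.append)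
  have "u \<in> pres_class S R u" "v \<in> pres_class S R v"
    using assms by (auto simp: pres_class_def intro: pres_eq.refl)
  then show ?thesis
    by (simp add: presented_group_def) (use * in blast)
qed

lemma group_presented_group: "group (presented_group S R)"
proof (rule groupI)
  let ?G = "presented_group S R"
  let ?L = "lists (S \<times> (UNIV :: bool set))"
  have car: "carrier ?G = pres_class S R ` ?L" and one: "\<one>\<^bsub>?G\<^esub> = pres_class S R []"
    by (simp_all add: presented_group_def)
  show "\<one>\<^bsub>?G\<^esub> \<in> carrier ?G" by (auto simp: car one)
  fix x assume "x \<in> carrier ?G"
  then obtain u where u: "u \<in> ?L" "x = pres_class S R u" by (auto simp: car)
  show "\<one>\<^bsub>?G\<^esub> \<otimes>\<^bsub>?G\<^esub> x = x"
    using presented_group_mult [of "[]" S u R] u by (simp add: one)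
  have "\<exists>v \<in> ?L. pres_eq S R (v @ u) []"
    using u(1)
  proof (induction u)
    case Nil
    then show ?case by (auto intro: pres_eq.refl)
  next
    case (Cons l u)
    then obtain v where v: "v \<in> ?L" "pres_eq S R (v @ u) []" by auto
    obtain s b where l: "l = (s, b)" "s \<in> S" using Cons by (cases l) auto
    have c: "pres_eq S R [(s, \<not> b), l] []"
      using pres_eq.cancel [OF l(2), of R "\<not> b"] l by simp
    have "pres_eq S R (v @ [(s, \<not> b), l] @ u) (v @ [] @ u)"
      using v(1) Cons.hyps c by (intro pres_eq.append pres_eq.refl) auto
    then have "pres_eq S R ((v @ [(s, \<not> b)]) @ l # u) []"
      using v(2) by (auto intro: pres_eq.trans)
    moreover have "v @ [(s, \<not> b)] \<in> ?L" using v l by auto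
    ultimately show ?case by blast
  qed
  then obtain v where "v \<in> ?L" "pres_eq S R (v @ u) []" by blast
  then show "\<exists>y\<in>carrier ?G. y \<otimes>\<^bsub>?G\<^esub> x = \<one>\<^bsub>?G\<^esub>"
    using u by (auto simp: car one presented_group_mult pres_class_eqI intro!: bexI [of _ v])
  fix y assume "y \<in> carrier ?G"
  then obtain v where v: "v \<in> ?L" "y = pres_class S R v" by (auto simp: car)
  show "x \<otimes>\<^bsub>?G\<^esub> y \<in> carrier ?G"
    using u v by (auto simp: car presented_group_mult)
  fix z assume "z \<in> carrier ?G"
  then obtain w where "w \<in> ?L" "z = pres_class S R w" by (auto simp: car)
  then show "x \<otimes>\<^bsub>?G\<^esub> y \<otimes>\<^bsub>?G\<^esub> z = x \<otimes>\<^bsub>?G\<^esub> (y \<otimes>\<^bsub>?G\<^esub> z)"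
    using u v by (simp add: presented_group_mult)
qed


section \<open>Coxeter systems\<close>

definition coxeter_matrix :: "'a set \<Rightarrow> ('a \<Rightarrow> 'a \<Rightarrow> enat) \<Rightarrow> bool"
  where "coxeter_matrix S m \<longleftrightarrow>
    (\<forall>s\<in>S. m s s = 1) \<and> (\<forall>s\<in>S. \<forall>t\<in>S. m s t = m t s) \<and>
    (\<forall>s\<in>S. \<forall>t\<in>S. s \<noteq> t \<longrightarrow> 2 \<le> m s t)"

definition coxeter_relators :: "'a set \<Rightarrow> ('a \<Rightarrow> 'a \<Rightarrow> enat) \<Rightarrow> ('a \<times> bool) list set"
  where "coxeter_relators S m =
    {concat (replicate k [(s, True), (t, True)]) | s t k. s \<in> S \<and> t \<in> S \<and> m s t = enat k}"

definition coxeter_group :: "'a set \<Rightarrow> ('a \<Rightarrow> 'a \<Rightarrow> enat) \<Rightarrow> ('a \<times> bool) list set monoid"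
  where "coxeter_group S m = presented_group S (coxeter_relators S m)"

text \<open>
  The generators are involutions, so the word length is the least length of an expression as a
  product of generators, without inverses.
\<close>

definition coxeter_length :: "'a set \<Rightarrow> ('a \<Rightarrow> 'a \<Rightarrow> enat) \<Rightarrow> ('a \<times> bool) list set \<Rightarrow> nat"
  where "coxeter_length S m w =
    (LEAST n. \<exists>xs \<in> lists S. length xs = n \<and>
       w = pres_class S (coxeter_relators S m) (map (\<lambda>s. (s, True)) xs))"


section \<open>Graphs\<close>

definition even_edges :: "'a set \<Rightarrow> ('a \<Rightarrow> 'a \<Rightarrow> enat) \<Rightarrow> 'a set set"
  where "even_edges S m =
    {{s, t} | s t. s \<in> S \<and> t \<in> S \<and> s \<noteq> t \<and> (\<exists>k. m s t = enat k \<and> even k)}"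

definition odd_edges :: "'a set \<Rightarrow> ('a \<Rightarrow> 'a \<Rightarrow> enat) \<Rightarrow> 'a set set"
  where "odd_edges S m =
    {{s, t} | s t. s \<in> S \<and> t \<in> S \<and> s \<noteq> t \<and> (\<exists>k. m s t = enat k \<and> odd k)}"

text \<open>
  For the next two definitions \<open>(V, E)\<close> is a simple graph: the elements of \<open>E\<close> are two-element
  subsets of \<open>V\<close>.  A cycle visits at least three distinct vertices.
\<close>

definition graph_forest :: "'a set \<Rightarrow> 'a set set \<Rightarrow> bool"
  where "graph_forest V E \<longleftrightarrow>
    \<not> (\<exists>xs. set xs \<subseteq> V \<and> distinct xs \<and> 3 \<le> length xs \<and>
         (\<forall>i < length xs. {xs ! i, xs ! (Suc i mod length xs)} \<in> E))"

definition graph_components :: "'a set \<Rightarrow> 'a set set \<Rightarrow> 'a set set"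
  where "graph_components V E = {{t \<in> V. (s, t) \<in> {(u, v). {u, v} \<in> E}\<^sup>*} | s. s \<in> V}"


section \<open>Operators on the Hilbert space \<open>\<ell>\<^sub>2(X)\<close>\<close>

text \<open>
  Vectors of \<open>\<ell>\<^sub>2(X)\<close> are functions vanishing outside \<open>X\<close>.  An operator is a total function
  on \<open>'g \<Rightarrow> complex\<close> of which only the values on \<open>\<ell>\<^sub>2(X)\<close> matter.
\<close>

definition ell2 :: "'g set \<Rightarrow> ('g \<Rightarrow> complex) set"
  where "ell2 X = {\<xi>. (\<forall>w. w \<notin> X \<longrightarrow> \<xi> w = 0) \<and> (\<lambda>w. (cmod (\<xi> w))\<^sup>2) summable_on X}"

definition ell2_inner :: "('g \<Rightarrow> complex) \<Rightarrow> ('g \<Rightarrow> complex) \<Rightarrow> complex"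
  where "ell2_inner \<xi> \<eta> = (\<Sum>\<^sub>\<infinity>w. \<xi> w * cnj (\<eta> w))"

definition ell2_norm :: "('g \<Rightarrow> complex) \<Rightarrow> real"
  where "ell2_norm \<xi> = sqrt (\<Sum>\<^sub>\<infinity>w. (cmod (\<xi> w))\<^sup>2)"

definition bounded_op :: "'g set \<Rightarrow> (('g \<Rightarrow> complex) \<Rightarrow> 'g \<Rightarrow> complex) \<Rightarrow> bool"
  where "bounded_op X T \<longleftrightarrow>
    (\<forall>\<xi>\<in>ell2 X. T \<xi> \<in> ell2 X) \<and>
    (\<forall>\<xi>\<in>ell2 X. \<forall>\<eta>\<in>ell2 X. T (\<lambda>w. \<xi> w + \<eta> w) = (\<lambda>w. T \<xi> w + T \<eta> w)) \<and>
    (\<forall>c. \<forall>\<xi>\<in>ell2 X. T (\<lambda>w. c * \<xi> w) = (\<lambda>w. c * T \<xi> w)) \<and>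
    (\<exists>K. \<forall>\<xi>\<in>ell2 X. ell2_norm (T \<xi>) \<le> K * ell2_norm \<xi>)"

definition compact_op :: "'g set \<Rightarrow> (('g \<Rightarrow> complex) \<Rightarrow> 'g \<Rightarrow> complex) \<Rightarrow> bool"
  where "compact_op X T \<longleftrightarrow> bounded_op X T \<and>
    (\<forall>\<xi> :: nat \<Rightarrow> 'g \<Rightarrow> complex. (\<forall>n. \<xi> n \<in> ell2 X \<and> ell2_norm (\<xi> n) \<le> 1) \<longrightarrow>
       (\<exists>r \<eta>. strict_mono r \<and> \<eta> \<in> ell2 X \<and>
          (\<lambda>n. ell2_norm (\<lambda>w. T (\<xi> (r n)) w - \<eta> w)) \<longlonglongrightarrow> 0))"

text \<open>
  \<open>P = |T| = (T\<^sup>* T)\<^sup>1\<^sup>/\<^sup>2\<close>, the unique positive \<open>P\<close> with \<open>P\<^sup>2 = T\<^sup>* T\<close>; this equation is stated by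
  means of the inner product, \<open>\<langle>P (P \<xi>), \<eta>\<rangle> = \<langle>T \<xi>, T \<eta>\<rangle>\<close>, to avoid introducing the adjoint.
\<close>

definition is_abs_op ::
    "'g set \<Rightarrow> (('g \<Rightarrow> complex) \<Rightarrow> 'g \<Rightarrow> complex) \<Rightarrow> (('g \<Rightarrow> complex) \<Rightarrow> 'g \<Rightarrow> complex) \<Rightarrow> bool"
  where "is_abs_op X T P \<longleftrightarrow> bounded_op X P \<and>
    (\<forall>\<xi>\<in>ell2 X. ell2_inner (P \<xi>) \<xi> \<in> \<real> \<and> 0 \<le> Re (ell2_inner (P \<xi>) \<xi>)) \<and>
    (\<forall>\<xi>\<in>ell2 X. \<forall>\<eta>\<in>ell2 X. ell2_inner (P (P \<xi>)) \<eta> = ell2_inner (T \<xi>) (T \<eta>))"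

definition orthonormal_basis :: "'g set \<Rightarrow> ('g \<Rightarrow> complex) set \<Rightarrow> bool"
  where "orthonormal_basis X B \<longleftrightarrow> B \<subseteq> ell2 X \<and>
    (\<forall>b\<in>B. \<forall>c\<in>B. ell2_inner b c = (if b = c then 1 else 0)) \<and>
    (\<forall>\<xi>\<in>ell2 X. (\<forall>b\<in>B. ell2_inner \<xi> b = 0) \<longrightarrow> \<xi> = (\<lambda>w. 0))"

text \<open>
  For \<open>p < \<infinity>\<close>, \<open>T \<in> S\<^sub>p\<close> means \<open>Tr (|T|\<^sup>p) < \<infinity>\<close>.  This forces \<open>|T|\<close> to be compact, hence diagonal
  in some orthonormal basis \<open>B\<close>; its eigenvalues \<open>\<sigma> b\<close>, listed with multiplicity, are the
  singular values of \<open>T\<close>, and \<open>Tr (|T|\<^sup>p) = (\<Sum>b\<in>B. \<sigma> b\<^sup>p)\<close>.  \<open>S\<^sub>\<infinity>\<close> is the class of compact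
  operators.
\<close>

definition schatten_class ::
    "'g set \<Rightarrow> ereal \<Rightarrow> (('g \<Rightarrow> complex) \<Rightarrow> 'g \<Rightarrow> complex) set"
  where "schatten_class X p =
    (if p = \<infinity> then {T. compact_op X T}
     else {T. bounded_op X T \<and>
            (\<exists>P B \<sigma>. is_abs_op X T P \<and> orthonormal_basis X B \<and>
               (\<forall>b\<in>B. 0 \<le> \<sigma> b \<and> P b = (\<lambda>w. complex_of_real (\<sigma> b) * b w)) \<and>
               (\<lambda>b. \<sigma> b powr real_of_ereal p) summable_on B)})"


section \<open>The gradient-\<open>S\<^sub>p\<close> property\<close>

text \<open>
  An element \<open>\<Sum>\<^sub>w a(w) \<lambda>\<^sub>w\<close> of the group algebra \<open>\<complex>[G]\<close> is represented by its coefficient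
  function \<open>a\<close>.  Since \<open>\<lambda>\<^sub>w \<delta>\<^sub>e = \<delta>\<^sub>w\<close>, the embedding \<open>x \<mapsto> x \<delta>\<^sub>e\<close> of \<open>\<complex>[G]\<close> into \<open>\<ell>\<^sub>2(G)\<close> is then
  the inclusion of the finitely supported functions.
\<close>

definition group_algebra :: "('g, 'b) monoid_scheme \<Rightarrow> ('g \<Rightarrow> complex) set"
  where "group_algebra G = {a. finite {w. a w \<noteq> 0} \<and> {w. a w \<noteq> 0} \<subseteq> carrier G}"

definition convolution ::
    "('g, 'b) monoid_scheme \<Rightarrow> ('g \<Rightarrow> complex) \<Rightarrow> ('g \<Rightarrow> complex) \<Rightarrow> 'g \<Rightarrow> complex"
  where "convolution G a b w =
    (\<Sum>(u, v) \<in> {(u, v). a u \<noteq> 0 \<and> b v \<noteq> 0 \<and> u \<otimes>\<^bsub>G\<^esub> v = w}. a u * b v)"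

text \<open>
  The generator of the semi-group \<open>\<Phi>\<^sub>t(\<lambda>\<^sub>w) = exp (- t \<psi>(w)) \<lambda>\<^sub>w\<close>, normalised so that
  \<open>\<Phi>\<^sub>t = exp (- t \<Delta>)\<close>.
\<close>

definition generator :: "('g \<Rightarrow> nat) \<Rightarrow> ('g \<Rightarrow> complex) \<Rightarrow> 'g \<Rightarrow> complex"
  where "generator \<psi> x = (\<lambda>w. of_nat (\<psi> w) * x w)"

definition gradient_form ::
    "('g, 'b) monoid_scheme \<Rightarrow> ('g \<Rightarrow> nat) \<Rightarrow>
     ('g \<Rightarrow> complex) \<Rightarrow> ('g \<Rightarrow> complex) \<Rightarrow> ('g \<Rightarrow> complex) \<Rightarrow> 'g \<Rightarrow> complex"
  where "gradient_form G \<psi> a b x =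
    (let \<Delta> = generator \<psi>; mul = convolution G in
     (\<lambda>w. \<Delta> (mul (mul a x) b) w + mul (mul a (\<Delta> x)) b w
        - mul (\<Delta> (mul a x)) b w - mul a (\<Delta> (mul x b)) w))"

text \<open>
  The gradient-\<open>S\<^sub>p\<close> property of the semi-group \<open>\<Phi>\<^sub>t(\<lambda>\<^sub>w) = exp (- t \<psi>(w)) \<lambda>\<^sub>w\<close> on the von Neumann
  algebra of \<open>G\<close>.
\<close>

definition gradient_schatten :: "('g, 'b) monoid_scheme \<Rightarrow> ('g \<Rightarrow> nat) \<Rightarrow> ereal \<Rightarrow> bool"
  where "gradient_schatten G \<psi> p \<longleftrightarrow>
    (\<forall>a \<in> group_algebra G. \<forall>b \<in> group_algebra G.
       \<exists>T \<in> schatten_class (carrier G) p.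
         \<forall>x \<in> group_algebra G. T x = gradient_form G \<psi> a b x)"

end

theory Submission
  imports Defs "HOL-Analysis.Analysis"
begin

text \<open>
  On generators \<open>s\<close>, \<open>t\<close> the map \<open>\<Psi>\<close> acts as \<open>\<lambda>\<^sub>w \<mapsto> \<gamma>(w) \<lambda>\<^sub>s\<^sub>w\<^sub>t\<close>, where
  \<open>\<gamma>(w) = |swt| + |w| - |sw| - |wt|\<close> vanishes unless \<open>sw = wt\<close> and equals \<open>\<plusminus> 2\<close> if
  \<open>sw = wt\<close>.  As \<open>\<gamma>\<close> is a cocycle in both group arguments, the semi-group is gradient-\<open>S\<^sub>p\<close>,
  for any \<open>p\<close>, iff all sets \<open>{w. sw = wt}\<close> are finite: in that case every \<open>\<Psi>\<^sup>a\<^sup>,\<^sup>b\<close> has finite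
  rank, and otherwise some \<open>\<Psi>\<^sup>s\<^sup>,\<^sup>s\<close> has infinitely many eigenvalues \<open>\<plusminus> 2\<close>.

  If \<open>sw = wt\<close> with \<open>|sw| > |w|\<close> and \<open>w \<noteq> e\<close> starts with \<open>r\<close>, then \<open>sw\<close> has the two left
  descents \<open>s\<close> and \<open>r\<close>.  Hence \<open>k = m s r\<close> is finite and \<open>w = rsr\<cdots> w'\<close> with \<open>k - 1\<close>
  alternating letters in front, where \<open>zw' = w't\<close> for \<open>z = s\<close> if \<open>k\<close> is even and \<open>z = r\<close> if
  \<open>k\<close> is odd.  So \<open>w\<close> is spelled by a walk on \<open>S\<close> that follows odd edges, uses even edges as
  loops and never uses the same edge twice in a row.  Conversely, as no \<open>m s t\<close> is \<open>2\<close>, no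
  relation applies to the word of such a walk, which is therefore reduced.  Thus the sets are
  finite iff these walks do not run into a cycle, and this is the graph condition.
\<close>


section \<open>Words and length in a Coxeter group\<close>

text \<open>Only the presentation of the group is given, so three standard facts are built up from
  actions that respect the relators: the exchange condition from an action on signed group elements,
  the exact order \<open>m s t\<close> of a product of two generators from the contragredient
  geometric representation, and from both the alternating prefix of an element with two left
  descents.

  The forbidden edge of a walk has a group-theoretic source: once \<open>rsr...\<close> is split
  off, the rest \<open>w'\<close> is shortest in its coset of the dihedral group of \<open>s\<close>
  and \<open>r\<close>, so its next letter is neither of the two. As for the graph condition, a walk
  that has used a loop could use it again only after returning to the same vertex without
  backtracking, which a forest forbids; with two loops in one component it can shuttle between them
  for ever. An even edge inside a component counts as two loops, one at each end, whence the
  separate clause.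

  On the analytic side the Schatten classes are defined through an explicit root \<open>P\<close>
  and an eigenbasis, so that even for finite rank a singular value decomposition has to be
  produced.\<close>

lemma adjacent_if_parity_neq:
  "even a \<noteq> even b \<Longrightarrow> a \<le> Suc b \<Longrightarrow> b \<le> Suc a \<Longrightarrow> a = Suc b \<or> b = Suc a"
  for a b :: nat
  by presburger

text \<open>The universal property of the presentation, stated for actions: \<open>fst\<close> drops
  the exponent of a letter, so that a formal inverse acts like its generator and the case
  \<open>cancel\<close> becomes involutivity.\<close>

lemma pres_eq_fold:
  assumes "pres_eq S R u v"
    and closed: "\<And>s x. s \<in> S \<Longrightarrow> x \<in> X \<Longrightarrow> f s x \<in> X"
    and invol: "\<And>s x. s \<in> S \<Longrightarrow> x \<in> X \<Longrightarrow> f s (f s x) = x"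
    and rel: "\<And>r x. r \<in> R \<Longrightarrow> r \<in> lists (S \<times> UNIV) \<Longrightarrow> x \<in> X \<Longrightarrow> fold (f \<circ> fst) r x = x"
    and "x \<in> X"
  shows "fold (f \<circ> fst) u x = fold (f \<circ> fst) v x"
  using assms(1) \<open>x \<in> X\<close>
proof (induction arbitrary: x rule: pres_eq.induct)
  case (append u u' v v')
  have "w \<in> lists (S \<times> UNIV) \<Longrightarrow> y \<in> X \<Longrightarrow> fold (f \<circ> fst) w y \<in> X" for w y
    by (induction w arbitrary: y) (auto simp: closed)
  with append pres_eq_words show ?case by (metis comp_apply fold_append)
qed (auto simp: invol rel)

locale coxeter =
  fixes S :: "'a set" and m :: "'a \<Rightarrow> 'a \<Rightarrow> enat"
  assumes mat: "coxeter_matrix S m"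
begin

abbreviation W :: "('a \<times> bool) list set monoid"
  where "W \<equiv> coxeter_group S m"

definition ev :: "'a list \<Rightarrow> ('a \<times> bool) list set"
  where "ev xs = pres_class S (coxeter_relators S m) (map (\<lambda>s. (s, True)) xs)"

definition gen :: "'a \<Rightarrow> ('a \<times> bool) list set"
  where "gen s = ev [s]"

abbreviation len :: "('a \<times> bool) list set \<Rightarrow> nat"
  where "len \<equiv> coxeter_length S m"

sublocale group W
  unfolding coxeter_group_def by (rule group_presented_group)

lemma m_diag: "s \<in> S \<Longrightarrow> m s s = enat 1"
  and m_sym: "s \<in> S \<Longrightarrow> t \<in> S \<Longrightarrow> m s t = m t s"
  and m_ge2: "s \<in> S \<Longrightarrow> t \<in> S \<Longrightarrow> s \<noteq> t \<Longrightarrow> 2 \<le> m s t"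
  using mat by (auto simp: coxeter_matrix_def one_enat_def)

lemma m_ge2_nat: "s \<in> S \<Longrightarrow> t \<in> S \<Longrightarrow> s \<noteq> t \<Longrightarrow> m s t = enat M \<Longrightarrow> 2 \<le> M"
  using m_ge2 [of s t] by (simp add: numeral_eq_enat)

lemma word_letters: "xs \<in> lists S \<Longrightarrow> map (\<lambda>s. (s, True)) xs \<in> lists (S \<times> UNIV)"
  by auto

lemma ev_eq_iff:
  "xs \<in> lists S \<Longrightarrow>
    ev xs = ev ys \<longleftrightarrow> pres_eq S (coxeter_relators S m) (map (\<lambda>s. (s, True)) xs) (map (\<lambda>s. (s, True)) ys)"
  unfolding ev_def by (rule pres_class_eq_iff) (rule word_letters)

lemma ev_Nil [simp]: "ev [] = \<one>\<^bsub>W\<^esub>"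
  by (simp add: ev_def coxeter_group_def presented_group_def)

lemma ev_append:
  "xs \<in> lists S \<Longrightarrow> ys \<in> lists S \<Longrightarrow> ev (xs @ ys) = ev xs \<otimes>\<^bsub>W\<^esub> ev ys"
  unfolding ev_def coxeter_group_def using presented_group_mult [OF word_letters word_letters]
  by fastforce

lemma ev_closed [simp, intro]: "xs \<in> lists S \<Longrightarrow> ev xs \<in> carrier W"
  using word_letters [of xs] by (simp add: ev_def coxeter_group_def presented_group_def)

lemma ev_single [simp]: "ev [s] = gen s"
  by (simp add: gen_def)

lemma gen_closed [simp, intro]: "s \<in> S \<Longrightarrow> gen s \<in> carrier W"
  using ev_closed [of "[s]"] by (simp del: ev_closed)

lemma ev_Cons: "s \<in> S \<Longrightarrow> xs \<in> lists S \<Longrightarrow> ev (s # xs) = gen s \<otimes>\<^bsub>W\<^esub> ev xs"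
  using ev_append [of "[s]" xs] by simp

lemma ev_relation:
  assumes "s \<in> S" "t \<in> S" "m s t = enat k"
  shows "ev (concat (replicate k [s, t])) = \<one>\<^bsub>W\<^esub>"
proof -
  have *: "map (\<lambda>s. (s, True)) (concat (replicate k [s, t])) = concat (replicate k [(s, True), (t, True)])" for k
    by (induction k) auto
  have "concat (replicate k [(s, True), (t, True)]) \<in> coxeter_relators S m"
    using assms by (auto simp: coxeter_relators_def)
  moreover have "concat (replicate k [(s, True), (t, True)]) \<in> lists (S \<times> UNIV)"
    using assms by (induction k) (auto simp: in_lists_conv_set)
  ultimately show ?thesis
    unfolding ev_Nil [symmetric] ev_def * by (metis list.map(1) pres_class_eqI pres_eq.relator)
qed

lemma gen_sq [simp]: "s \<in> S \<Longrightarrow> gen s \<otimes>\<^bsub>W\<^esub> gen s = \<one>\<^bsub>W\<^esub>"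
  using ev_relation [of s s 1] m_diag [of s] ev_append [of "[s]" "[s]"] by simp

lemma gen_gen [simp]: "s \<in> S \<Longrightarrow> g \<in> carrier W \<Longrightarrow> gen s \<otimes>\<^bsub>W\<^esub> (gen s \<otimes>\<^bsub>W\<^esub> g) = g"
  by (metis gen_closed gen_sq l_one m_assoc)

lemma gen_gen_right [simp]: "s \<in> S \<Longrightarrow> g \<in> carrier W \<Longrightarrow> g \<otimes>\<^bsub>W\<^esub> gen s \<otimes>\<^bsub>W\<^esub> gen s = g"
  by (simp add: m_assoc)

text \<open>Generators are involutions, so the letters \<open>(s, False)\<close> contribute no new
  elements.\<close>

lemma ev_surj:
  assumes "g \<in> carrier W"
  obtains xs where "xs \<in> lists S" "g = ev xs"
proof -
  have "\<exists>xs \<in> lists S. pres_class S (coxeter_relators S m) w = ev xs" if "w \<in> lists (S \<times> UNIV)" for w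
    using that
  proof (induction w)
    case Nil
    show ?case by (rule bexI [of _ "[]"]) (simp_all add: ev_def del: ev_Nil)
  next
    case (Cons l w)
    obtain s b where l: "l = (s, b)" "s \<in> S" using Cons by (cases l) auto
    obtain xs where xs: "xs \<in> lists S" "pres_class S (coxeter_relators S m) w = ev xs"
      using Cons by auto
    let ?P = "presented_group S (coxeter_relators S m)"
    let ?c = "pres_class S (coxeter_relators S m)"
    have c: "?c [(s, False)] \<in> carrier W"
      using l unfolding coxeter_group_def presented_group_def by auto
    have g: "gen s = ?c [(s, True)]"
      by (simp add: gen_def ev_def)
    have "?c [(s, False)] = gen s"
    proof -
      have "?c [(s, False)] \<otimes>\<^bsub>W\<^esub> gen s = ?c ([(s, False)] @ [(s, True)])"
        using presented_group_mult [of "[(s, False)]" S "[(s, True)]"] l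
        by (simp add: coxeter_group_def g)
      also have "\<dots> = \<one>\<^bsub>W\<^esub>"
        using pres_eq.cancel [OF l(2), of "coxeter_relators S m" False]
        by (simp add: pres_class_eqI coxeter_group_def presented_group_def)
      also have "\<dots> = gen s \<otimes>\<^bsub>W\<^esub> gen s" using l by simp
      finally show ?thesis
        using l c by (subst (asm) right_cancel) auto
    qed
    then have "?c [l] = gen s" using l g by (cases b) auto
    then have "?c (l # w) = ev (s # xs)"
      using presented_group_mult [of "[l]" S w "coxeter_relators S m"] Cons.hyps l xs ev_Cons [of s xs]
      by (simp add: coxeter_group_def)
    then show ?case using xs l by (intro bexI [of _ "s # xs"]) auto
  qed
  then show ?thesis
    using assms that by (auto simp: coxeter_group_def presented_group_def)
qed

text \<open>The source of all invariants below: the parity of the length, the sign in the exchange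
  condition and the order of a product of two generators. In \<open>rel\<close> the map
  \<open>f s\<close> stands on the right because \<open>fold\<close> lets the first letter act
  first; the instance \<open>s = t\<close>, \<open>k = 1\<close> makes every \<open>f s\<close> an
  involution.\<close>

lemma action_eq:
  assumes "\<And>s x. s \<in> S \<Longrightarrow> x \<in> X \<Longrightarrow> f s x \<in> X"
    and rel: "\<And>s t k x. s \<in> S \<Longrightarrow> t \<in> S \<Longrightarrow> m s t = enat k \<Longrightarrow> x \<in> X \<Longrightarrow> ((f t \<circ> f s) ^^ k) x = x"
    and "ev xs = ev ys" "xs \<in> lists S" "x \<in> X"
  shows "fold f xs x = fold f ys x"
proof -
  have "fold (f \<circ> fst) (concat (replicate k [(s, True), (t, True)])) x = ((f t \<circ> f s) ^^ k) x" for s t k x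
    by (induction k arbitrary: x) (auto simp: funpow_swap1)
  then have r: "fold (f \<circ> fst) r x = x" if "r \<in> coxeter_relators S m" "x \<in> X" for r x
    using that rel by (auto simp: coxeter_relators_def)
  have "f s (f s x) = x" if "s \<in> S" "x \<in> X" for s x
    using rel [of s s 1 x] that m_diag by simp
  then have "fold (f \<circ> fst) (map (\<lambda>s. (s, True)) xs) x = fold (f \<circ> fst) (map (\<lambda>s. (s, True)) ys) x"
    using assms(1,3-5) r
    by (intro pres_eq_fold [where R = "coxeter_relators S m" and X = X]) (simp_all add: ev_eq_iff)
  then show ?thesis by (simp add: fold_map comp_def)
qed

text \<open>The sign character: every letter negates a Boolean, and relators have even
  length.\<close>

lemma parity_eq:
  assumes "ev xs = ev ys" "xs \<in> lists S" "ys \<in> lists S"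
  shows "even (length xs) \<longleftrightarrow> even (length ys)"
proof -
  have "fold (\<lambda>s. Not) xs True = fold (\<lambda>s. Not) ys True"
  proof (rule action_eq [of UNIV])
    show "((Not \<circ> Not) ^^ k) x = x" for k x by (induction k) auto
  qed (use assms in auto)
  moreover have "fold (\<lambda>s. Not) zs b = (b = even (length zs))" for zs :: "'a list" and b
    by (induction zs arbitrary: b) auto
  ultimately show ?thesis by simp
qed

lemma len_le: "xs \<in> lists S \<Longrightarrow> len (ev xs) \<le> length xs"
  unfolding coxeter_length_def by (rule Least_le) (auto simp: ev_def)

lemma len_word:
  assumes "g \<in> carrier W"
  obtains xs where "xs \<in> lists S" "g = ev xs" "length xs = len g"
proof -
  obtain xs where "xs \<in> lists S" "g = ev xs" using ev_surj assms by blast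
  then have "\<exists>n. \<exists>xs\<in>lists S. length xs = n \<and> g = ev xs" by blast
  then have "\<exists>xs\<in>lists S. length xs = len g \<and> g = ev xs"
    unfolding coxeter_length_def ev_def by (rule LeastI_ex)
  then show ?thesis using that by blast
qed

lemma len_parity: "xs \<in> lists S \<Longrightarrow> even (len (ev xs)) \<longleftrightarrow> even (length xs)"
  by (metis ev_closed len_word parity_eq)

text \<open>Parity excludes equal lengths; the upper bound, applied to \<open>g\<close> and to
  \<open>gen s\<close> times \<open>g\<close>, excludes a change by more than one.\<close>

lemma len_gen_mult:
  assumes "s \<in> S" "g \<in> carrier W"
  shows "len (gen s \<otimes>\<^bsub>W\<^esub> g) = Suc (len g) \<or> len g = Suc (len (gen s \<otimes>\<^bsub>W\<^esub> g))"
proof -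
  have *: "len (gen s \<otimes>\<^bsub>W\<^esub> h) \<le> Suc (len h)" if h: "h \<in> carrier W" for h
  proof -
    obtain xs where "xs \<in> lists S" "h = ev xs" "length xs = len h" using len_word h by blast
    then show ?thesis using len_le [of "s # xs"] assms by (simp add: ev_Cons)
  qed
  obtain xs where xs: "xs \<in> lists S" "g = ev xs" using ev_surj assms by blast
  then have "even (len (gen s \<otimes>\<^bsub>W\<^esub> g)) \<noteq> even (len g)"
    using len_parity [of xs] len_parity [of "s # xs"] assms by (simp add: ev_Cons)
  moreover have "len (gen s \<otimes>\<^bsub>W\<^esub> g) \<le> Suc (len g)" "len g \<le> Suc (len (gen s \<otimes>\<^bsub>W\<^esub> g))"
    using *[of g] *[of "gen s \<otimes>\<^bsub>W\<^esub> g"] assms by simp_all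
  ultimately show ?thesis by (rule adjacent_if_parity_neq)
qed

lemma len_mult_gen:
  assumes "s \<in> S" "g \<in> carrier W"
  shows "len (g \<otimes>\<^bsub>W\<^esub> gen s) = Suc (len g) \<or> len g = Suc (len (g \<otimes>\<^bsub>W\<^esub> gen s))"
proof -
  have *: "len (h \<otimes>\<^bsub>W\<^esub> gen s) \<le> Suc (len h)" if h: "h \<in> carrier W" for h
  proof -
    obtain xs where "xs \<in> lists S" "h = ev xs" "length xs = len h" using len_word h by blast
    then show ?thesis using len_le [of "xs @ [s]"] assms by (simp add: ev_append)
  qed
  obtain xs where xs: "xs \<in> lists S" "g = ev xs" using ev_surj assms by blast
  then have "even (len (g \<otimes>\<^bsub>W\<^esub> gen s)) \<noteq> even (len g)"
    using len_parity [of xs] len_parity [of "xs @ [s]"] assms by (simp add: ev_append)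
  moreover have "len (g \<otimes>\<^bsub>W\<^esub> gen s) \<le> Suc (len g)" "len g \<le> Suc (len (g \<otimes>\<^bsub>W\<^esub> gen s))"
    using *[of g] *[of "g \<otimes>\<^bsub>W\<^esub> gen s"] assms by simp_all
  ultimately show ?thesis by (rule adjacent_if_parity_neq)
qed

lemma len_append_le:
  assumes "xs \<in> lists S" "g \<in> carrier W"
  shows "len (ev xs \<otimes>\<^bsub>W\<^esub> g) \<le> length xs + len g"
proof -
  obtain ys where "ys \<in> lists S" "g = ev ys" "length ys = len g" using len_word assms by blast
  then show ?thesis using len_le [of "xs @ ys"] assms by (simp add: ev_append)
qed

end


section \<open>The exchange condition\<close>

lemma card_less_Suc_filter:
  "card {i. i < Suc n \<and> P i} = card {i. i < n \<and> P i} + of_bool (P n)"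
proof -
  have "{i. i < Suc n \<and> P i} = {i. i < n \<and> P i} \<union> (if P n then {n} else {})"
    by (auto simp: less_Suc_eq)
  then show ?thesis by (simp add: card_insert_if)
qed

text \<open>Over two periods every hit is counted twice. This evenness is what makes a relator
  preserve the sign in \<open>reflect_relation\<close>.\<close>

lemma card_periodic:
  fixes k :: nat
  assumes "\<And>i. P (i + k) = P i"
  shows "card {i. i < 2 * k \<and> P i} = 2 * card {i. i < k \<and> P i}"
proof -
  have eq: "{i. i < 2 * k \<and> P i} = {i. i < k \<and> P i} \<union> (\<lambda>i. i + k) ` {i. i < k \<and> P i}"
  proof (intro equalityI subsetI)
    fix i assume i: "i \<in> {i. i < 2 * k \<and> P i}"
    show "i \<in> {i. i < k \<and> P i} \<union> (\<lambda>i. i + k) ` {i. i < k \<and> P i}"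
    proof (cases "i < k")
      case False
      then show ?thesis using i assms [of "i - k"] by (intro UnI2 image_eqI [of _ _ "i - k"]) auto
    qed (use i in auto)
  qed (use assms in auto)
  show ?thesis unfolding eq
    by (subst card_Un_disjoint) (auto simp: card_image)
qed

context coxeter
begin

lemma gen_swap_pow:
  assumes "s \<in> S" "t \<in> S"
  shows "gen s \<otimes>\<^bsub>W\<^esub> (gen t \<otimes>\<^bsub>W\<^esub> gen s) [^]\<^bsub>W\<^esub> (j::nat) = (gen s \<otimes>\<^bsub>W\<^esub> gen t) [^]\<^bsub>W\<^esub> j \<otimes>\<^bsub>W\<^esub> gen s"
proof (induction j)
  case (Suc j)
  then show ?case using assms
    by (simp add: m_assoc [symmetric])
qed (use assms in simp)

lemma gen_pow_inverse:
  assumes "s \<in> S" "t \<in> S"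
  shows "(gen t \<otimes>\<^bsub>W\<^esub> gen s) [^]\<^bsub>W\<^esub> (j::nat) = inv\<^bsub>W\<^esub> ((gen s \<otimes>\<^bsub>W\<^esub> gen t) [^]\<^bsub>W\<^esub> j)"
proof -
  have "gen t \<otimes>\<^bsub>W\<^esub> gen s \<otimes>\<^bsub>W\<^esub> (gen s \<otimes>\<^bsub>W\<^esub> gen t) = \<one>\<^bsub>W\<^esub>"
    using assms by (simp add: m_assoc)
  then have "gen t \<otimes>\<^bsub>W\<^esub> gen s = inv\<^bsub>W\<^esub> (gen s \<otimes>\<^bsub>W\<^esub> gen t)"
    using assms by (simp add: inv_equality)
  then show ?thesis using assms by (simp add: nat_pow_inv)
qed

lemma ev_replicate:
  assumes "s \<in> S" "t \<in> S"
  shows "ev (concat (replicate k [s, t])) = (gen s \<otimes>\<^bsub>W\<^esub> gen t) [^]\<^bsub>W\<^esub> k"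
proof (induction k)
  case (Suc k)
  have "concat (replicate k [s, t]) \<in> lists S" using assms by (induction k) auto
  with Suc show ?case using assms nat_pow_mult [of "gen s \<otimes>\<^bsub>W\<^esub> gen t" 1 k]
    by (simp add: ev_Cons m_assoc)
qed simp

text \<open>
  Acting with a word \<open>xs\<close> flips the sign of \<open>g\<close> once for each factorisation
  \<open>xs = p @ c # q\<close> with \<open>g = p c p\<^sup>-\<^sup>1\<close>; since the sign depends only on \<open>ev xs\<close>, so does
  the parity of the number of these factorisations.
\<close>

definition reflect :: "'a \<Rightarrow> ('a \<times> bool) list set \<times> bool \<Rightarrow> ('a \<times> bool) list set \<times> bool"
  where "reflect s = (\<lambda>(g, b). (gen s \<otimes>\<^bsub>W\<^esub> g \<otimes>\<^bsub>W\<^esub> gen s, b \<noteq> (g = gen s)))"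

text \<open>At letter number \<open>i\<close> the word \<open>stst...\<close> compares
  \<open>g\<close> with the reflection \<open>d^i s\<close> of the dihedral group, so the sign
  counts the \<open>i < 2 * j\<close> at which they agree.\<close>

lemma reflect_pow:
  fixes j :: nat
  assumes st: "s \<in> S" "t \<in> S" and g: "g \<in> carrier W"
  defines "d \<equiv> gen s \<otimes>\<^bsub>W\<^esub> gen t" and "e \<equiv> gen t \<otimes>\<^bsub>W\<^esub> gen s"
  shows "((reflect t \<circ> reflect s) ^^ j) (g, b) =
    (e [^]\<^bsub>W\<^esub> j \<otimes>\<^bsub>W\<^esub> g \<otimes>\<^bsub>W\<^esub> d [^]\<^bsub>W\<^esub> j,
     b \<noteq> odd (card {i. i < 2 * j \<and> g = d [^]\<^bsub>W\<^esub> i \<otimes>\<^bsub>W\<^esub> gen s}))"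
proof (induction j)
  case 0
  then show ?case using g by simp
next
  case (Suc j)
  have [simp]: "d \<in> carrier W" "e \<in> carrier W" using st by (auto simp: d_def e_def)
  have inv: "e [^]\<^bsub>W\<^esub> j = inv\<^bsub>W\<^esub> (d [^]\<^bsub>W\<^esub> j)"
    unfolding d_def e_def by (rule gen_pow_inverse [OF st])
  have conj: "e [^]\<^bsub>W\<^esub> j \<otimes>\<^bsub>W\<^esub> g \<otimes>\<^bsub>W\<^esub> d [^]\<^bsub>W\<^esub> j = x \<longleftrightarrow> g = d [^]\<^bsub>W\<^esub> j \<otimes>\<^bsub>W\<^esub> x \<otimes>\<^bsub>W\<^esub> e [^]\<^bsub>W\<^esub> j"
    if "x \<in> carrier W" for x
    unfolding inv using that g
    by (auto simp: m_assoc inv_solve_left inv_solve_right)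
       (auto simp: m_assoc [symmetric])
  have swap: "gen s \<otimes>\<^bsub>W\<^esub> e [^]\<^bsub>W\<^esub> j = d [^]\<^bsub>W\<^esub> j \<otimes>\<^bsub>W\<^esub> gen s"
    unfolding d_def e_def by (rule gen_swap_pow [OF st])
  let ?h = "e [^]\<^bsub>W\<^esub> j \<otimes>\<^bsub>W\<^esub> g \<otimes>\<^bsub>W\<^esub> d [^]\<^bsub>W\<^esub> j"
  have h: "?h \<in> carrier W" using g by simp
  \<comment> \<open>In round \<open>j\<close> the letter \<open>s\<close> tests the exponent
    \<open>2 * j\<close> and the letter \<open>t\<close> the exponent
    \<open>2 * j + 1\<close>.\<close>
  have 1: "?h = gen s \<longleftrightarrow> g = d [^]\<^bsub>W\<^esub> (2 * j) \<otimes>\<^bsub>W\<^esub> gen s"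
    using conj [of "gen s"] st swap by (simp add: m_assoc) (simp add: m_assoc [symmetric] nat_pow_mult mult_2)
  have "gen s \<otimes>\<^bsub>W\<^esub> ?h \<otimes>\<^bsub>W\<^esub> gen s = gen t \<longleftrightarrow> ?h = gen s \<otimes>\<^bsub>W\<^esub> gen t \<otimes>\<^bsub>W\<^esub> gen s"
    using st h by (metis gen_gen gen_gen_right gen_closed m_assoc m_closed)
  also have "\<dots> \<longleftrightarrow> g = d [^]\<^bsub>W\<^esub> j \<otimes>\<^bsub>W\<^esub> (d \<otimes>\<^bsub>W\<^esub> gen s) \<otimes>\<^bsub>W\<^esub> e [^]\<^bsub>W\<^esub> j"
    using conj [of "d \<otimes>\<^bsub>W\<^esub> gen s"] st by (simp add: d_def)
  also have "\<dots> \<longleftrightarrow> g = d [^]\<^bsub>W\<^esub> Suc (2 * j) \<otimes>\<^bsub>W\<^esub> gen s"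
    using st swap nat_pow_Suc2 [of d j] nat_pow_mult [of d j "Suc j"]
    by (simp add: m_assoc mult_2 del: nat_pow_Suc) (simp add: m_assoc [symmetric] del: nat_pow_Suc)
  finally have 2: "gen s \<otimes>\<^bsub>W\<^esub> ?h \<otimes>\<^bsub>W\<^esub> gen s = gen t \<longleftrightarrow> g = d [^]\<^bsub>W\<^esub> Suc (2 * j) \<otimes>\<^bsub>W\<^esub> gen s" .
  have 3: "gen t \<otimes>\<^bsub>W\<^esub> (gen s \<otimes>\<^bsub>W\<^esub> ?h \<otimes>\<^bsub>W\<^esub> gen s) \<otimes>\<^bsub>W\<^esub> gen t = e [^]\<^bsub>W\<^esub> Suc j \<otimes>\<^bsub>W\<^esub> g \<otimes>\<^bsub>W\<^esub> d [^]\<^bsub>W\<^esub> Suc j"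
  proof -
    have "e [^]\<^bsub>W\<^esub> Suc j = e \<otimes>\<^bsub>W\<^esub> e [^]\<^bsub>W\<^esub> j" by (rule nat_pow_Suc2) simp
    moreover have "d [^]\<^bsub>W\<^esub> Suc j = d [^]\<^bsub>W\<^esub> j \<otimes>\<^bsub>W\<^esub> d" by simp
    ultimately show ?thesis
      using st g by (simp add: m_assoc del: nat_pow_Suc) (simp add: d_def e_def m_assoc)
  qed
  have n: "2 * Suc j = Suc (Suc (2 * j))" by simp
  have "((reflect t \<circ> reflect s) ^^ Suc j) (g, b) = reflect t (reflect s (((reflect t \<circ> reflect s) ^^ j) (g, b)))"
    by simp
  also have "\<dots> = (gen t \<otimes>\<^bsub>W\<^esub> (gen s \<otimes>\<^bsub>W\<^esub> ?h \<otimes>\<^bsub>W\<^esub> gen s) \<otimes>\<^bsub>W\<^esub> gen t,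
      ((b \<noteq> odd (card {i. i < 2 * j \<and> g = d [^]\<^bsub>W\<^esub> i \<otimes>\<^bsub>W\<^esub> gen s})) \<noteq> (?h = gen s)) \<noteq>
        (gen s \<otimes>\<^bsub>W\<^esub> ?h \<otimes>\<^bsub>W\<^esub> gen s = gen t))"
    unfolding Suc.IH by (simp add: reflect_def)
  finally have *: "((reflect t \<circ> reflect s) ^^ Suc j) (g, b) = \<dots>" .
  have parity: "((b \<noteq> odd c) \<noteq> P) \<noteq> Q \<longleftrightarrow> b \<noteq> odd (c + of_bool P + of_bool Q)" for P Q and c :: nat
    by auto
  show ?case unfolding * 1 2 3 n card_less_Suc_filter parity by (rule HOL.refl)
qed

text \<open>From \<open>d^k = 1\<close> the reflections \<open>d^i s\<close> with
  \<open>i < 2 * k\<close> run twice through the same values, so the number of flips is even. This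
  works before \<open>k\<close> is known to be the exact order of \<open>d\<close>.\<close>

lemma reflect_relation:
  assumes st: "s \<in> S" "t \<in> S" and k: "m s t = enat k" and g: "g \<in> carrier W"
  shows "((reflect t \<circ> reflect s) ^^ k) (g, b) = (g, b)"
proof -
  let ?d = "gen s \<otimes>\<^bsub>W\<^esub> gen t"
  have d: "?d [^]\<^bsub>W\<^esub> k = \<one>\<^bsub>W\<^esub>"
    using ev_relation [OF st k] ev_replicate [OF st, of k] by simp
  have e: "(gen t \<otimes>\<^bsub>W\<^esub> gen s) [^]\<^bsub>W\<^esub> k = \<one>\<^bsub>W\<^esub>"
    using gen_pow_inverse [OF st, of k] d by simp
  have "?d [^]\<^bsub>W\<^esub> (i + k) = ?d [^]\<^bsub>W\<^esub> i" for i
    using st d nat_pow_mult [of ?d i k] by simp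
  then have "even (card {i. i < 2 * k \<and> g = ?d [^]\<^bsub>W\<^esub> i \<otimes>\<^bsub>W\<^esub> gen s})"
    by (subst card_periodic) auto
  then show ?thesis unfolding reflect_pow [OF st g] d e using g by simp
qed

text \<open>A changed sign has been flipped at some letter \<open>c\<close>; the equation for
  \<open>p\<close> and \<open>c\<close> is \<open>g = p c p^-1\<close> written without
  inverses.\<close>

lemma reflect_flip:
  assumes "xs \<in> lists S" "g \<in> carrier W" "snd (fold reflect xs (g, b)) \<noteq> b"
  shows "\<exists>p c q. xs = p @ c # q \<and> g \<otimes>\<^bsub>W\<^esub> ev p = ev (p @ [c])"
  using assms
proof (induction xs arbitrary: g b)
  case (Cons s xs)
  show ?case
  proof (cases "g = gen s")
    case True
    then have "s # xs = [] @ s # xs \<and> g \<otimes>\<^bsub>W\<^esub> ev [] = ev ([] @ [s])"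
      using Cons.hyps by simp
    then show ?thesis by blast
  next
    case False
    let ?g = "gen s \<otimes>\<^bsub>W\<^esub> g \<otimes>\<^bsub>W\<^esub> gen s"
    have s: "s \<in> S" "xs \<in> lists S" using Cons.hyps by simp_all
    have "reflect s (g, b) = (?g, b)" using False by (simp add: reflect_def)
    then have "snd (fold reflect xs (?g, b)) \<noteq> b"
      using Cons.prems by simp
    then obtain p c q where pcq: "xs = p @ c # q" "?g \<otimes>\<^bsub>W\<^esub> ev p = ev (p @ [c])"
      using Cons.IH [of ?g b] Cons.prems s by auto
    have p: "p \<in> lists S" "c \<in> S" using pcq s by auto
    have "g \<otimes>\<^bsub>W\<^esub> ev (s # p) = gen s \<otimes>\<^bsub>W\<^esub> (?g \<otimes>\<^bsub>W\<^esub> ev p)"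
      using s p Cons.prems by (simp add: ev_Cons m_assoc)
    also have "\<dots> = ev ((s # p) @ [c])"
      unfolding pcq(2) using s p by (simp add: ev_Cons)
    finally show ?thesis using pcq by (metis append_Cons)
  qed
qed simp

text \<open>Let \<open>ys\<close> be a reduced word for \<open>gen s\<close> times
  \<open>ev xs\<close>. Then \<open>xs\<close> and \<open>s # ys\<close> have the same value, hence
  the same effect on the sign of \<open>gen s\<close>. The letter \<open>s\<close> flips it, and
  \<open>ys\<close> does not flip it back, so \<open>xs\<close> flips it somewhere, and there a
  letter can be deleted.\<close>

lemma exchange:
  assumes s: "s \<in> S" and xs: "xs \<in> lists S" and less: "len (gen s \<otimes>\<^bsub>W\<^esub> ev xs) < len (ev xs)"
  obtains p c q where "xs = p @ c # q" "gen s \<otimes>\<^bsub>W\<^esub> ev p = ev (p @ [c])"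
    "gen s \<otimes>\<^bsub>W\<^esub> ev xs = ev (p @ q)"
proof -
  have del: "gen s \<otimes>\<^bsub>W\<^esub> ev (p @ c # q) = ev (p @ q)"
    if "gen s \<otimes>\<^bsub>W\<^esub> ev p = ev (p @ [c])" "p @ c # q \<in> lists S" for p c q
  proof -
    have pcq: "p \<in> lists S" "c \<in> S" "q \<in> lists S" using that(2) by auto
    then have "gen s \<otimes>\<^bsub>W\<^esub> ev (p @ c # q) = (gen s \<otimes>\<^bsub>W\<^esub> ev p) \<otimes>\<^bsub>W\<^esub> (gen c \<otimes>\<^bsub>W\<^esub> ev q)"
      using s by (simp add: ev_append ev_Cons m_assoc)
    also have "\<dots> = ev (p @ q)"
      unfolding that(1) using pcq by (simp add: ev_append m_assoc)
    finally show ?thesis .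
  qed
  obtain ys where ys: "ys \<in> lists S" "gen s \<otimes>\<^bsub>W\<^esub> ev xs = ev ys" "length ys = len (gen s \<otimes>\<^bsub>W\<^esub> ev xs)"
    using len_word [of "gen s \<otimes>\<^bsub>W\<^esub> ev xs"] s xs by (metis ev_closed gen_closed m_closed)
  have eq: "ev xs = ev (s # ys)" 
    using ys(1) s xs by (simp add: ev_Cons flip: ys(2))
  have "fold reflect xs (gen s, False) = fold reflect (s # ys) (gen s, False)"
  proof (rule action_eq [where X = "carrier W \<times> UNIV"])
    show "((reflect t \<circ> reflect s) ^^ k) x = x"
      if "s \<in> S" "t \<in> S" "m s t = enat k" "x \<in> carrier W \<times> UNIV" for s t k x
      using that reflect_relation by auto
  qed (use s xs eq in \<open>auto simp: reflect_def\<close>)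
  also have "\<dots> = fold reflect ys (gen s, True)"
    using s by (simp add: reflect_def)
  finally have fold: "fold reflect xs (gen s, False) = fold reflect ys (gen s, True)" .
  \<comment> \<open>A second flip would allow a deletion inside \<open>ys\<close> and give
    \<open>ev xs\<close> a word shorter than \<open>ys\<close>, although \<open>ys\<close> is
    shorter than \<open>len (ev xs)\<close>.\<close>
  have "snd (fold reflect ys (gen s, True))"
  proof (rule ccontr)
    assume "\<not> ?thesis"
    then obtain p c q where pcq: "ys = p @ c # q" "gen s \<otimes>\<^bsub>W\<^esub> ev p = ev (p @ [c])"
      using reflect_flip [of ys "gen s" True] ys s by auto
    then have "ev xs = ev (p @ q)"
      using del [of p c q] ys s xs eq by (simp add: ev_Cons)
    then have "len (ev xs) < length ys"
      using len_le [of "p @ q"] pcq ys by simp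
    then show False using ys less by simp
  qed
  then obtain p c q where "xs = p @ c # q" "gen s \<otimes>\<^bsub>W\<^esub> ev p = ev (p @ [c])"
    using reflect_flip [of xs "gen s" False] fold s xs by auto
  with del [of p c q] xs that show ?thesis by simp
qed

end


section \<open>The order of a product of two generators\<close>

text \<open>The Chebyshev recursion with free initial values; \<open>a = 0\<close>,
  \<open>b = 1\<close> yields the polynomials of the second kind with index shifted by one.\<close>

fun chebyshev :: "real \<Rightarrow> real \<Rightarrow> real \<Rightarrow> nat \<Rightarrow> real" where
  "chebyshev c a b 0 = a"
| "chebyshev c a b (Suc 0) = b"
| "chebyshev c a b (Suc (Suc n)) = 2 * c * chebyshev c a b (Suc n) - chebyshev c a b n"

lemma chebyshev_cos:
  "sin \<theta> * chebyshev (cos \<theta>) a b n = b * sin (real n * \<theta>) - a * sin ((real n - 1) * \<theta>)"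
proof (induction n rule: induct_nat_012)
  case (ge2 n)
  have *: "sin (x + \<theta>) + sin (x - \<theta>) = 2 * cos \<theta> * sin x" for x
    by (simp add: sin_add sin_diff)
  have "sin \<theta> * chebyshev (cos \<theta>) a b (Suc (Suc n)) =
      2 * cos \<theta> * (sin \<theta> * chebyshev (cos \<theta>) a b (Suc n)) - sin \<theta> * chebyshev (cos \<theta>) a b n"
    by (simp add: algebra_simps)
  also have "\<dots> = b * (2 * cos \<theta> * sin (real (Suc n) * \<theta>) - sin (real n * \<theta>))
      - a * (2 * cos \<theta> * sin (real n * \<theta>) - sin ((real n - 1) * \<theta>))"
    unfolding ge2 by (simp add: algebra_simps)
  also have "\<dots> = b * sin (real (Suc (Suc n)) * \<theta>) - a * sin ((real (Suc (Suc n)) - 1) * \<theta>)"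
    unfolding * [symmetric] by (simp add: algebra_simps)
  finally show ?case .
qed (auto simp: algebra_simps)

text \<open>For \<open>m s t = \<infinity>\<close>, where \<open>c = 1\<close>: linear growth rules
  out a period.\<close>

lemma chebyshev_one: "chebyshev 1 0 1 n = real n"
  by (induction n rule: induct_nat_012) auto

lemma chebyshev_periodic:
  fixes k :: nat
  assumes "2 \<le> k" and \<theta>: "\<theta> = pi / real k"
  shows "chebyshev (cos \<theta>) a b (2 * k) = a" "chebyshev (cos \<theta>) a b (Suc (2 * k)) = b"
proof -
  have k: "real k * \<theta> = pi" using assms by simp
  have "0 < \<theta>" "\<theta> < pi" using assms by (auto simp: divide_less_eq)
  then have sin: "sin \<theta> \<noteq> 0" using sin_gt_zero by force
  have *: "sin (x + real k * \<theta> + real k * \<theta>) = sin x" for x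
    unfolding k using sin_periodic [of x] by (simp add: add.assoc)
  have "sin \<theta> * chebyshev (cos \<theta>) a b (2 * k) = sin \<theta> * a"
    unfolding chebyshev_cos using * [of 0] * [of "- \<theta>"] by (simp add: algebra_simps)
  then show "chebyshev (cos \<theta>) a b (2 * k) = a" using sin by simp
  have "sin \<theta> * chebyshev (cos \<theta>) a b (Suc (2 * k)) = sin \<theta> * b"
    unfolding chebyshev_cos using * [of 0] * [of \<theta>] by (simp add: algebra_simps)
  then show "chebyshev (cos \<theta>) a b (Suc (2 * k)) = b" using sin by simp
qed

text \<open>Summing the recursion over a full period gives \<open>E = c * O1\<close> and
  \<open>O1 = c * E\<close> for the sums over the even and the odd indices, and
  \<open>c\<^sup>2 \<noteq> 1\<close> leaves only zero.\<close>

lemma chebyshev_period_sum: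
  fixes k :: nat
  assumes "chebyshev c a b (2 * k) = a" "chebyshev c a b (Suc (2 * k)) = b" and c: "c\<^sup>2 \<noteq> 1"
  shows "(\<Sum>i<k. chebyshev c a b (2 * i + 1)) = 0" "(\<Sum>i<k. chebyshev c a b (2 * i + 2)) = 0"
proof -
  let ?x = "chebyshev c a b"
  define O1 E where "O1 = (\<Sum>i<k. ?x (2 * i + 1))" and "E = (\<Sum>i<k. ?x (2 * i + 2))"
  have 1: "(\<Sum>i<n. ?x (2 * i + 2)) + (\<Sum>i<n. ?x (2 * i + 2)) - ?x (2 * n) + a
      = 2 * c * (\<Sum>i<n. ?x (2 * i + 1))" for n
    by (induction n) (auto simp: algebra_simps)
  have 2: "(\<Sum>i<n. ?x (2 * i + 1)) + (\<Sum>i<n. ?x (2 * i + 1)) + ?x (Suc (2 * n)) - b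
      = 2 * c * (\<Sum>i<n. ?x (2 * i + 2))" for n
    by (induction n) (auto simp: algebra_simps)
  have E: "E = c * O1" and O1: "O1 = c * E"
    using 1 [of k] 2 [of k] assms by (simp_all add: O1_def E_def)
  have "(c\<^sup>2 - 1) * O1 = 0" "(c\<^sup>2 - 1) * E = 0"
    using arg_cong [OF E, of "\<lambda>y. c * y"] arg_cong [OF O1, of "\<lambda>y. c * y"] E O1
    unfolding power2_eq_square left_diff_distrib mult.assoc by linarith+
  then show "(\<Sum>i<k. ?x (2 * i + 1)) = 0" "(\<Sum>i<k. ?x (2 * i + 2)) = 0"
    using c by (simp_all add: O1_def E_def)
qed

context coxeter
begin

text \<open>The canonical symmetric form on the simple roots. The diagonal needs no case of its own,
  since \<open>m s s = 1\<close> gives \<open>- cos pi = 1\<close>.\<close>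

definition bform :: "'a \<Rightarrow> 'a \<Rightarrow> real"
  where "bform x y = (case m x y of enat k \<Rightarrow> - cos (pi / real k) | \<infinity> \<Rightarrow> - 1)"

text \<open>
  The contragredient of the geometric representation: \<open>\<phi> x\<close> is the value of a linear form at
  the simple root of \<open>x\<close>, so that no finiteness of \<open>S\<close> is needed.
\<close>

definition dual_refl :: "'a \<Rightarrow> ('a \<Rightarrow> real) \<Rightarrow> 'a \<Rightarrow> real"
  where "dual_refl s \<phi> = (\<lambda>x. \<phi> x - 2 * bform x s * \<phi> s)"

lemma bform_diag: "s \<in> S \<Longrightarrow> bform s s = 1"
  by (simp add: bform_def m_diag)

lemma bform_sym: "s \<in> S \<Longrightarrow> t \<in> S \<Longrightarrow> bform s t = bform t s"
  by (simp add: bform_def m_sym)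

text \<open>
  The Chebyshev recursion interleaves, up to sign, the values at \<open>t\<close> and at \<open>s\<close> of the iterates.
\<close>

lemma dual_refl_pow:
  assumes st: "s \<in> S" "t \<in> S"
  defines "X \<equiv> \<lambda>\<phi>. chebyshev (- bform s t) (- \<phi> t) (\<phi> s)"
  shows "((dual_refl t \<circ> dual_refl s) ^^ j) \<phi> =
      (\<lambda>x. \<phi> x - 2 * (bform x s * (\<Sum>i<j. X \<phi> (2 * i + 1)) + bform x t * (\<Sum>i<j. X \<phi> (2 * i + 2)))) \<and>
    ((dual_refl t \<circ> dual_refl s) ^^ j) \<phi> s = X \<phi> (2 * j + 1) \<and>
    ((dual_refl t \<circ> dual_refl s) ^^ j) \<phi> t = - X \<phi> (2 * j)"
proof (induction j)
  case 0
  then show ?case by (simp add: X_def)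
next
  case (Suc j)
  define \<psi> where "\<psi> = ((dual_refl t \<circ> dual_refl s) ^^ j) \<phi>"
  have X3: "X \<phi> (Suc (Suc n)) = - 2 * bform s t * X \<phi> (Suc n) - X \<phi> n" for n
    by (simp add: X_def)
  have ts: "bform t s = bform s t" "bform s s = 1" "bform t t = 1"
    using st bform_sym bform_diag by auto
  have \<psi>: "\<psi> = (\<lambda>x. \<phi> x - 2 * (bform x s * (\<Sum>i<j. X \<phi> (2 * i + 1)) + bform x t * (\<Sum>i<j. X \<phi> (2 * i + 2))))"
    "\<psi> s = X \<phi> (Suc (2 * j))" "\<psi> t = - X \<phi> (2 * j)"
    using Suc.IH [folded \<psi>_def] unfolding Suc_eq_plus1 by (blast+)
  have step: "dual_refl t (dual_refl s \<psi>) = (\<lambda>x. \<psi> x - 2 * bform x s * X \<phi> (Suc (2 * j)) - 2 * bform x t * X \<phi> (Suc (Suc (2 * j))))"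
    unfolding dual_refl_def X3 by (rule ext) (simp add: \<psi>(2,3) ts algebra_simps)
  have F: "((dual_refl t \<circ> dual_refl s) ^^ Suc j) \<phi> = dual_refl t (dual_refl s \<psi>)"
    by (simp add: \<psi>_def)
  have "dual_refl t (dual_refl s \<psi>) s = X \<phi> (Suc (Suc (Suc (2 * j))))"
    "dual_refl t (dual_refl s \<psi>) t = - X \<phi> (Suc (Suc (2 * j)))"
    unfolding step X3 [of "Suc (2 * j)"] by (simp_all add: \<psi>(2,3) ts) (simp add: X3)
  moreover have "dual_refl t (dual_refl s \<psi>) =
     (\<lambda>x. \<phi> x - 2 * (bform x s * (\<Sum>i<Suc j. X \<phi> (2 * i + 1)) + bform x t * (\<Sum>i<Suc j. X \<phi> (2 * i + 2))))"
    unfolding step by (rule ext, subst \<psi>(1)) (simp add: algebra_simps)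
  ultimately show ?case unfolding F by simp
qed

text \<open>After \<open>2 * k\<close> steps the Chebyshev sequence is back at its start and the two
  sums that displace the other coordinates vanish. The case \<open>s = t\<close> is apart because
  there \<open>c\<^sup>2 = 1\<close>; it says that a reflection is an involution.\<close>

lemma dual_refl_relation:
  assumes st: "s \<in> S" "t \<in> S" and k: "m s t = enat k"
  shows "((dual_refl t \<circ> dual_refl s) ^^ k) \<phi> = \<phi>"
proof (cases "s = t")
  case True
  then have "k = 1" using k m_diag st by auto
  then show ?thesis using True st by (simp add: dual_refl_def bform_diag)
next
  case False
  have k2: "2 \<le> k" using m_ge2_nat st False k by blast
  let ?\<theta> = "pi / real k"
  have c: "- bform s t = cos ?\<theta>" by (simp add: bform_def k)
  have "0 < ?\<theta>" "?\<theta> < pi" using k2 by (auto simp: divide_less_eq)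
  then have "sin ?\<theta> \<noteq> 0" using sin_gt_zero by force
  then have "(cos ?\<theta>)\<^sup>2 \<noteq> 1" using sin_squared_eq [of ?\<theta>] by auto
  from chebyshev_period_sum [OF chebyshev_periodic [OF k2 HOL.refl] this]
  show ?thesis using dual_refl_pow [OF st, of k \<phi>] unfolding c by simp
qed

text \<open>The converse of the relation: if \<open>(st)^k = 1\<close> with \<open>0 < k\<close>,
  the Chebyshev sequence belonging to \<open>s\<close> and \<open>t\<close> has period
  \<open>2 * k\<close>, which is impossible below \<open>2 * m s t\<close>.\<close>

lemma order_gen_gen:
  assumes st: "s \<in> S" "t \<in> S" "s \<noteq> t" and k: "0 < k" "ev (concat (replicate k [s, t])) = \<one>\<^bsub>W\<^esub>"
  shows "m s t \<le> enat k"
proof (rule ccontr)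
  assume less: "\<not> ?thesis"
  \<comment> \<open>Chosen for the initial values \<open>- \<phi> t = 0\<close> and
    \<open>\<phi> s = 1\<close>, for which the sequence is
    \<open>sin (n * \<theta>) / sin \<theta>\<close>, or \<open>n\<close> if
    \<open>m s t = \<infinity>\<close>.\<close>
  define \<phi> where "\<phi> = (\<lambda>x. if x = s then 1 else (0::real))"
  have "concat (replicate k [s, t]) \<in> lists S" using st by (induction k) auto
  then have "fold dual_refl (concat (replicate k [s, t])) \<phi> = fold dual_refl [] \<phi>"
    using k dual_refl_relation by (intro action_eq [where X = UNIV]) auto
  moreover have "fold dual_refl (concat (replicate k [s, t])) \<phi> = ((dual_refl t \<circ> dual_refl s) ^^ k) \<phi>" for \<phi>
    by (induction k arbitrary: \<phi>) (auto simp: funpow_swap1)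
  ultimately have "((dual_refl t \<circ> dual_refl s) ^^ k) \<phi> = \<phi>" by simp
  then have X: "chebyshev (- bform s t) 0 1 (2 * k + 1) = 1" "chebyshev (- bform s t) 0 1 (2 * k) = 0"
    using dual_refl_pow [OF st(1,2), of k \<phi>] st by (auto simp: \<phi>_def)
  show False
  proof (cases "m s t")
    case infinity
    then have "- bform s t = 1" by (simp add: bform_def)
    then show False using X k chebyshev_one [of "2 * k"] by simp
  next
    case (enat M)
    then have kM: "k < M" using less by simp
    let ?\<theta> = "pi / real M"
    have c: "- bform s t = cos ?\<theta>" by (simp add: bform_def enat)
    have "2 \<le> M" using m_ge2_nat st enat by blast
    then have \<theta>: "0 < ?\<theta>" "?\<theta> < pi" by (auto simp: divide_less_eq)
    then have sin: "sin ?\<theta> > 0" using sin_gt_zero by force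
    have s0: "sin (real (2 * k) * ?\<theta>) = 0"
      using chebyshev_cos [of ?\<theta> 0 1 "2 * k"] X(2) c by simp
    have "sin (real (2 * k + 1) * ?\<theta>) = sin ?\<theta>"
      using chebyshev_cos [of ?\<theta> 0 1 "2 * k + 1"] X(1) c by simp
    moreover have "real (2 * k + 1) * ?\<theta> = real (2 * k) * ?\<theta> + ?\<theta>"
      by (simp add: algebra_simps add_divide_distrib)
    ultimately have c1: "cos (real (2 * k) * ?\<theta>) = 1"
      using s0 sin by (simp add: sin_add)
    \<comment> \<open>The double angle is a multiple of the full turn, but the angle itself lies
      strictly between 0 and \<open>pi\<close>.\<close>
    have "sin (real k * ?\<theta>) = 0"
    proof -
      have "cos (2 * (real k * ?\<theta>)) = 1" using c1 by (simp add: mult.assoc)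
      then show ?thesis unfolding cos_double_sin by simp
    qed
    moreover have "0 < real k * ?\<theta>" "real k * ?\<theta> < pi" 
      using kM k \<theta> by (auto simp: field_simps)
    ultimately show False using sin_gt_zero by force
  qed
qed

end


section \<open>Elements with two left descents\<close>

fun alt :: "'a \<Rightarrow> 'a \<Rightarrow> nat \<Rightarrow> 'a list" where
  "alt x y 0 = []"
| "alt x y (Suc n) = x # alt y x n"

lemma length_alt [simp]: "length (alt x y n) = n"
  by (induction n arbitrary: x y) auto

lemma alt_in_lists [simp]: "x \<in> A \<Longrightarrow> y \<in> A \<Longrightarrow> alt x y n \<in> lists A"
  by (induction n arbitrary: x y) auto

lemma nth_alt: "i < n \<Longrightarrow> alt x y n ! i = (if even i then x else y)"
  by (induction n arbitrary: x y i) (auto simp: nth_Cons' )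

lemma take_alt: "take i (alt x y n) = alt x y (min i n)"
proof (induction n arbitrary: x y i)
  case (Suc n)
  then show ?case by (cases i) auto
qed simp

lemma rev_in_lists [simp]: "rev xs \<in> lists A \<longleftrightarrow> xs \<in> lists A"
  by (simp add: in_lists_conv_set)

lemma alt_double: "alt x y (2 * n) = concat (replicate n [x, y])"
  by (induction n) auto

lemma alt_snoc: "alt x y (Suc n) = alt x y n @ [if even n then x else y]"
  by (induction n arbitrary: x y) auto

text \<open>The first letter of the reversed word lands at position \<open>k + 2 * n - 1\<close>,
  hence the choice by the parity of \<open>k\<close>. The braid relation needs \<open>k = 0\<close>,
  the argument on two descents \<open>k = 2\<close>.\<close>

lemma alt_rev_alt: "alt x y (k + n) @ rev (alt (if even k then y else x) (if even k then x else y) n) = alt x y (k + 2 * n)"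
proof (induction n arbitrary: k)
  case (Suc n)
  have "alt x y (k + 2 * Suc n) = alt x y (Suc k + 2 * n) @ [if even (Suc k + 2 * n) then x else y]"
    using alt_snoc [of x y "Suc k + 2 * n"] by (simp del: alt.simps)
  also have "\<dots> = alt x y (Suc k + n) @ rev (alt (if even (Suc k) then y else x) (if even (Suc k) then x else y) n) @ [if even k then y else x]"
    by (subst Suc.IH [symmetric]) auto
  also have "\<dots> = alt x y (k + Suc n) @ rev (alt (if even k then y else x) (if even k then x else y) (Suc n))"
    by (cases "even k") (simp_all del: alt.simps(2), simp_all)
  finally show ?case by (rule HOL.sym)
qed simp

context coxeter
begin

lemma ev_rev: "xs \<in> lists S \<Longrightarrow> ev xs \<otimes>\<^bsub>W\<^esub> ev (rev xs) = \<one>\<^bsub>W\<^esub>"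
proof (induction xs)
  case (Cons s xs)
  then have S: "s \<in> S" "xs \<in> lists S" by auto
  have "gen s \<otimes>\<^bsub>W\<^esub> ev xs \<otimes>\<^bsub>W\<^esub> (ev (rev xs) \<otimes>\<^bsub>W\<^esub> gen s) = gen s \<otimes>\<^bsub>W\<^esub> (ev xs \<otimes>\<^bsub>W\<^esub> ev (rev xs)) \<otimes>\<^bsub>W\<^esub> gen s"
    using S by (simp add: m_assoc)
  also have "\<dots> = \<one>\<^bsub>W\<^esub>" using Cons by simp
  finally show ?case using Cons by (simp add: ev_Cons ev_append)
qed simp

text \<open>The reverse of \<open>alt t s M\<close> represents its inverse, and
  \<open>alt s t M\<close> followed by this reverse is the relator \<open>(st)^M\<close>.\<close>

lemma braid:
  assumes "s \<in> S" "t \<in> S" "m s t = enat M"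
  shows "ev (alt s t M) = ev (alt t s M)"
proof -
  have "ev (alt s t M) \<otimes>\<^bsub>W\<^esub> ev (rev (alt t s M)) = \<one>\<^bsub>W\<^esub>"
    using alt_rev_alt [of s t 0 M] ev_append [of "alt s t M" "rev (alt t s M)"] assms ev_relation
    by (simp add: alt_double)
  also have "\<dots> = ev (alt t s M) \<otimes>\<^bsub>W\<^esub> ev (rev (alt t s M))"
    using assms by (simp add: ev_rev)
  finally show ?thesis using assms by (subst (asm) right_cancel) auto
qed

text \<open>The prefix grows by one letter per step while \<open>s\<close> and \<open>t\<close>
  change roles: exchange puts \<open>s\<close> in front of \<open>alt t s k @ ys\<close> and deletes
  a letter. If that letter lies in \<open>ys\<close>, the prefix has become longer; it cannot lie in
  the prefix, for this would make the order of \<open>st\<close> smaller than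
  \<open>m s t\<close>.\<close>

lemma descents_alt_aux:
  assumes "g \<in> carrier W" "s \<in> S" "t \<in> S" "s \<noteq> t"
    and "len (gen s \<otimes>\<^bsub>W\<^esub> g) < len g" "len (gen t \<otimes>\<^bsub>W\<^esub> g) < len g"
    and "enat k \<le> m s t"
  shows "\<exists>ys \<in> lists S. g = ev (alt s t k @ ys) \<and> k + length ys = len g"
  using assms(2-)
proof (induction k arbitrary: s t)
  case 0
  then show ?case using len_word [OF assms(1)] by (metis add_0 alt.simps(1) append_Nil)
next
  case (Suc k)
  have "enat k \<le> m t s" using Suc.prems m_sym Suc_ile_eq order.strict_implies_order by metis
  then obtain ys where ys: "ys \<in> lists S" "g = ev (alt t s k @ ys)" "k + length ys = len g"
    using Suc.IH [of t s] Suc.prems by auto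
  have w: "alt t s k @ ys \<in> lists S" using ys Suc.prems by simp
  obtain p c q where pcq: "alt t s k @ ys = p @ c # q" "gen s \<otimes>\<^bsub>W\<^esub> ev p = ev (p @ [c])"
    "gen s \<otimes>\<^bsub>W\<^esub> g = ev (p @ q)"
    using exchange [of s "alt t s k @ ys"] w Suc.prems ys(2) by metis
  have p: "p \<in> lists S" "c \<in> S" "q \<in> lists S" using w unfolding pcq(1) by auto
  show ?case
  proof (cases "k \<le> length p")
    case True
    have "alt t s k = take k p" "ys = drop k p @ c # q"
      using arg_cong [OF pcq(1), of "take k"] arg_cong [OF pcq(1), of "drop k"] True by simp_all
    then have p': "p = alt t s k @ drop k p" "ys = drop k p @ c # q"
      by simp_all
    have "g = gen s \<otimes>\<^bsub>W\<^esub> (gen s \<otimes>\<^bsub>W\<^esub> g)" using Suc.prems assms(1) by simp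
    also have "\<dots> = ev (s # p @ q)" unfolding pcq(3) using p Suc.prems by (simp add: ev_Cons)
    also have "s # p @ q = alt s t (Suc k) @ drop k p @ q" by (subst p'(1)) simp
    finally have "g = ev (alt s t (Suc k) @ drop k p @ q)" .
    moreover have "Suc k + length (drop k p @ q) = len g" using ys(3) p'(2) by simp
    moreover have "drop k p @ q \<in> lists S" using p ys(1) p'(2) by (metis append_in_lists_conv lists.Cons Cons_in_lists_iff)
    ultimately show ?thesis by blast
  next
    case False
    define n where "n = length p"
    have n: "n < k" using False by (simp add: n_def)
    have "p @ [c] = take (Suc n) (alt t s k @ ys)" unfolding pcq(1) by (simp add: n_def)
    also have "\<dots> = alt t s (Suc n)" using n by (simp add: take_alt del: alt.simps)
    finally have pc: "p @ [c] = alt t s (Suc n)" .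
    have "p = take n (alt t s k @ ys)" unfolding pcq(1) by (simp add: n_def)
    also have "\<dots> = alt t s n" using n by (simp add: take_alt del: alt.simps)
    finally have pn: "p = alt t s n" .
    \<comment> \<open>A deletion inside the prefix means \<open>s p = p c\<close> with
      \<open>p\<close> and \<open>p @ [c]\<close> alternating, and the word
      \<open>s p c p^-1\<close> is then \<open>(st)^(n + 1)\<close>.\<close>
    have "concat (replicate (Suc n) [s, t]) = alt s t (2 + 2 * n)"
      using alt_double [of s t "Suc n"] by simp
    also have "\<dots> = s # (p @ [c]) @ rev p"
      using alt_rev_alt [of s t 2 n] unfolding pc by (simp add: pn)
    finally have "ev (concat (replicate (Suc n) [s, t])) = (gen s \<otimes>\<^bsub>W\<^esub> ev p) \<otimes>\<^bsub>W\<^esub> (gen c \<otimes>\<^bsub>W\<^esub> ev (rev p))"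
      using p Suc.prems by (simp add: ev_Cons ev_append m_assoc)
    also have "\<dots> = \<one>\<^bsub>W\<^esub>"
      unfolding pcq(2) using p by (simp add: ev_append m_assoc ev_rev)
    finally have "m s t \<le> enat (Suc n)"
      using Suc.prems by (intro order_gen_gen) auto
    then have "enat (Suc k) \<le> enat (Suc n)" using Suc.prems order_trans by blast
    then show ?thesis using n by simp
  qed
qed

lemma descents_alt:
  assumes "g \<in> carrier W" "s \<in> S" "t \<in> S" "s \<noteq> t"
    and "len (gen s \<otimes>\<^bsub>W\<^esub> g) < len g" "len (gen t \<otimes>\<^bsub>W\<^esub> g) < len g"
  obtains M ys where "m s t = enat M" "ys \<in> lists S" "g = ev (alt s t M @ ys)" "M + length ys = len g"
proof (cases "m s t")
  case (enat M)
  then show ?thesis using descents_alt_aux [OF assms, of M] that by auto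
next
  case infinity
  \<comment> \<open>For \<open>m s t = \<infinity>\<close> the prefix could be chosen longer than
    \<open>len g\<close>.\<close>
  then show ?thesis using descents_alt_aux [OF assms, of "Suc (len g)"] by auto
qed

text \<open>The braid relation read as a conjugation: \<open>rsr...\<close> with
  \<open>m s r - 1\<close> letters carries \<open>s\<close> to \<open>s\<close> if
  \<open>m s r\<close> is even and to \<open>r\<close> if it is odd. These are the loops and the
  passages of a walk.\<close>

lemma gen_alt:
  assumes "s \<in> S" "r \<in> S" "m s r = enat (Suc n)"
  shows "gen s \<otimes>\<^bsub>W\<^esub> ev (alt r s n) = ev (alt r s n) \<otimes>\<^bsub>W\<^esub> gen (if odd n then s else r)"
proof -
  have "gen s \<otimes>\<^bsub>W\<^esub> ev (alt r s n) = ev (alt r s (Suc n))"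
    using braid [OF assms] assms by (simp add: ev_Cons)
  also have "\<dots> = ev (alt r s n) \<otimes>\<^bsub>W\<^esub> gen (if odd n then s else r)"
    unfolding alt_snoc using assms by (auto simp: ev_append)
  finally show ?thesis .
qed

end


section \<open>Rigid words and reduced walks\<close>

text \<open>
  A rigid word has no two equal adjacent letters, and no factor that alternates between \<open>s\<close> and
  \<open>t\<close> has length \<open>m s t\<close>: neither a cancellation nor a braid relation applies to it.
\<close>

definition rigid :: "('a \<Rightarrow> 'a \<Rightarrow> enat) \<Rightarrow> 'a list \<Rightarrow> bool"
  where "rigid m xs \<longleftrightarrow>
    (\<forall>i. Suc i < length xs \<longrightarrow> xs ! i \<noteq> xs ! Suc i) \<and>
    (\<forall>i k. Suc i < length xs \<longrightarrow> m (xs ! i) (xs ! Suc i) = enat k \<longrightarrow> i + k \<le> length xs \<longrightarrow>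
      (\<exists>j. i \<le> j \<and> j + 2 < i + k \<and> xs ! j \<noteq> xs ! (j + 2)))"

lemma rigid_Cons: "rigid m (x # xs) \<Longrightarrow> rigid m xs"
proof -
  assume r: "rigid m (x # xs)"
  have "\<forall>i. Suc i < length (x # xs) \<longrightarrow> (x # xs) ! i \<noteq> (x # xs) ! Suc i"
    using r unfolding rigid_def by blast
  from spec [OF this, of "Suc i" for i]
  have "xs ! i \<noteq> xs ! Suc i" if "Suc i < length xs" for i
    using that by simp
  moreover have "\<exists>j. i \<le> j \<and> j + 2 < i + k \<and> xs ! j \<noteq> xs ! (j + 2)"
    if i: "Suc i < length xs" "m (xs ! i) (xs ! Suc i) = enat k" "i + k \<le> length xs" for i k
  proof -
    have "Suc (Suc i) < length (x # xs)" "m ((x # xs) ! Suc i) ((x # xs) ! Suc (Suc i)) = enat k"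
      "Suc i + k \<le> length (x # xs)"
      using i by simp_all
    then obtain j where j: "Suc i \<le> j" "j + 2 < Suc i + k" "(x # xs) ! j \<noteq> (x # xs) ! (j + 2)"
      using r unfolding rigid_def by blast
    then obtain j' where "j = Suc j'" by (cases j) auto
    with j show ?thesis by (intro exI [of _ j']) auto
  qed
  ultimately show ?thesis unfolding rigid_def by blast
qed

lemma not_rigid_alt:
  assumes "m x y = enat k" "2 \<le> k"
  shows "\<not> rigid m (alt x y k @ zs)"
proof
  let ?w = "alt x y k @ zs"
  assume r: "rigid m ?w"
  have "Suc 0 < length ?w" "m (?w ! 0) (?w ! Suc 0) = enat k" "0 + k \<le> length ?w"
    using assms by (auto simp: nth_append nth_alt)
  then obtain j where "j + 2 < 0 + k" "?w ! j \<noteq> ?w ! (j + 2)"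
    using r unfolding rigid_def by blast
  then show False by (simp add: nth_append nth_alt split: if_splits)
qed

context coxeter
begin

text \<open>The word problem where no rewriting is possible. By induction the tail
  \<open>xs'\<close> is its only reduced word. If \<open>x\<close> shortened it, \<open>xs'\<close>
  would begin with \<open>x\<close>, against rigidity. If another word of minimal length begins with
  \<open>y \<noteq> x\<close>, then \<open>x\<close> and \<open>y\<close> are both descents, so some
  reduced word begins with \<open>alt x y M\<close>, \<open>M = m x y\<close>; its tail equals
  \<open>xs'\<close>, so \<open>xs\<close> is this word and not rigid.\<close>

lemma rigid_unique:
  assumes "rigid m xs" "xs \<in> lists S" "ys \<in> lists S" "ev ys = ev xs" "length ys \<le> length xs"
  shows "ys = xs"
  using assms
proof (induction "length xs" arbitrary: xs ys)
  case 0
  then show ?case by simp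
next
  case (Suc n)
  then obtain x xs' where xs: "xs = x # xs'" by (cases xs) auto
  have S: "x \<in> S" "xs' \<in> lists S" and r: "rigid m xs'"
    using Suc.prems rigid_Cons xs by auto
  have IH: "zs = xs'" if "zs \<in> lists S" "ev zs = ev xs'" "length zs \<le> length xs'" for zs
    using Suc.hyps(1) [of xs' zs] Suc.hyps(2) xs S r that by simp
  have len': "len (ev xs') = length xs'"
  proof -
    obtain zs where "zs \<in> lists S" "ev xs' = ev zs" "length zs = len (ev xs')"
      using len_word [of "ev xs'"] S by blast
    then show ?thesis using IH len_le [OF S(2)] by metis
  qed
  have "len (gen x \<otimes>\<^bsub>W\<^esub> ev xs') = Suc (length xs')"
  proof (rule ccontr)
    assume "\<not> ?thesis"
    then have l: "Suc (len (gen x \<otimes>\<^bsub>W\<^esub> ev xs')) = length xs'"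
      using len_gen_mult [of x "ev xs'"] S len' by auto
    obtain zs where zs: "zs \<in> lists S" "gen x \<otimes>\<^bsub>W\<^esub> ev xs' = ev zs" "length zs = len (gen x \<otimes>\<^bsub>W\<^esub> ev xs')"
      using len_word [of "gen x \<otimes>\<^bsub>W\<^esub> ev xs'"] S by (metis ev_closed gen_closed m_closed)
    have "ev (x # zs) = ev xs'"
      using zs(1) S by (simp add: ev_Cons flip: zs(2))
    then have "x # zs = xs'" using IH [of "x # zs"] zs l S by simp
    then have "xs = x # x # zs" using xs by simp
    then show False using Suc.prems(1) unfolding rigid_def by force
  qed
  then have len: "len (ev xs) = length xs"
    unfolding xs using S by (simp add: ev_Cons)
  then have len_ys: "length ys = length xs"
    using Suc.prems len_le [of ys] by simp
  then obtain y ys' where ys: "ys = y # ys'" using xs by (cases ys) auto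
  have Sy: "y \<in> S" "ys' \<in> lists S" using Suc.prems ys by auto
  show ?case
  proof (cases "y = x")
    case True
    then have "ev ys' = ev xs'"
      using Suc.prems(4) S Sy unfolding xs ys by (simp add: ev_Cons)
    then show ?thesis using IH [of ys'] Sy len_ys True unfolding xs ys by simp
  next
    case False
    let ?g = "ev xs"
    have gx: "gen x \<otimes>\<^bsub>W\<^esub> ?g = ev xs'" unfolding xs using S by (simp add: ev_Cons)
    have gy: "gen y \<otimes>\<^bsub>W\<^esub> ?g = ev ys'"
      unfolding Suc.prems(4) [symmetric] unfolding ys using Sy by (simp add: ev_Cons)
    have "len (gen x \<otimes>\<^bsub>W\<^esub> ?g) < len ?g"
      unfolding gx len using len_le [OF S(2)] xs by simp
    moreover have "len (gen y \<otimes>\<^bsub>W\<^esub> ?g) < len ?g"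
      unfolding gy len using len_le [OF Sy(2)] len_ys ys by simp
    ultimately obtain M zs where M: "m x y = enat M" "zs \<in> lists S" "?g = ev (alt x y M @ zs)"
      "M + length zs = len ?g"
      using descents_alt [of ?g x y] S Sy False Suc.prems(2) by (metis ev_closed)
    have "2 \<le> M" using m_ge2_nat [OF S(1) Sy(1)] False M by simp
    then obtain n where n: "M = Suc n" by (cases M) auto
    let ?zs = "alt y x n @ zs"
    have 1: "alt x y M @ zs = x # ?zs" using n by simp
    have "ev ?zs = ev xs'"
      using M(3) M(2) S Sy unfolding 1 xs by (simp add: ev_Cons)
    then have "?zs = xs'"
      using IH [of ?zs] M S Sy len n xs by simp
    then have "xs = alt x y M @ zs" using 1 xs by simp
    then show ?thesis using not_rigid_alt [of m x y M zs] M(1) \<open>2 \<le> M\<close> Suc.prems(1) by simp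
  qed
qed

lemma rigid_len:
  assumes "rigid m xs" "xs \<in> lists S"
  shows "len (ev xs) = length xs"
proof -
  obtain zs where zs: "zs \<in> lists S" "ev xs = ev zs" "length zs = len (ev xs)"
    using len_word [of "ev xs"] assms by blast
  then have "zs = xs"
    using len_le [OF assms(2)] by (intro rigid_unique [OF assms]) auto
  then show ?thesis using zs by simp
qed

text \<open>
  In a state \<open>(v, f)\<close> the walk is at the vertex \<open>v\<close>, and \<open>f\<close> is the other end of the edge used
  last; \<open>f = v\<close> means that no edge is forbidden.
\<close>

definition move :: "(('a \<times> 'a) \<times> ('a \<times> 'a)) set"
  where "move = {((v, f), if even k then (v, u) else (u, v)) | v f u k.
    v \<in> S \<and> f \<in> S \<and> u \<in> S \<and> u \<noteq> v \<and> u \<noteq> f \<and> m v u = enat k}"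

text \<open>The moves together with the word that they spell: leaving \<open>v\<close> along an edge
  with label \<open>Suc n\<close> writes the \<open>n\<close> letters \<open>uvu...\<close>, and the
  new vertex is the generator to which these letters carry \<open>v\<close> by
  \<open>gen_alt\<close>.\<close>

inductive walk :: "'a \<times> 'a \<Rightarrow> 'a list \<Rightarrow> 'a \<times> 'a \<Rightarrow> bool" where
  walk_Nil: "walk x [] x"
| walk_step: "v \<in> S \<Longrightarrow> f \<in> S \<Longrightarrow> u \<in> S \<Longrightarrow> u \<noteq> v \<Longrightarrow> u \<noteq> f \<Longrightarrow> m v u = enat (Suc n) \<Longrightarrow>
    walk (if odd n then (v, u) else (u, v)) w y \<Longrightarrow> walk (v, f) (alt u v n @ w) y"

lemma walk_append: "walk x w y \<Longrightarrow> walk y w' z \<Longrightarrow> walk x (w @ w') z"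
proof (induction rule: walk.induct)
  case (walk_step v f u n w y)
  then show ?case unfolding append_assoc by (intro walk.walk_step) simp_all
qed simp

lemma walk_end_in_S: "walk x w y \<Longrightarrow> fst x \<in> S \<Longrightarrow> fst y \<in> S"
  by (induction rule: walk.induct) (simp_all split: if_splits)

lemma walk_in_lists: "walk x w y \<Longrightarrow> w \<in> lists S"
  by (induction rule: walk.induct) auto

lemma walk_conj: "walk x w y \<Longrightarrow> fst x \<in> S \<Longrightarrow> gen (fst x) \<otimes>\<^bsub>W\<^esub> ev w = ev w \<otimes>\<^bsub>W\<^esub> gen (fst y)"
proof (induction rule: walk.induct)
  case (walk_step v f u n w y)
  let ?z = "if odd n then v else u"
  have fst: "fst (if odd n then (v, u) else (u, v)) = ?z" by simp
  have z: "?z \<in> S" using walk_step by auto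
  have w: "w \<in> lists S" using walk_step walk_in_lists by blast
  have "fst y \<in> S" using walk_step.hyps(7) walk_end_in_S z fst by metis
  have "gen v \<otimes>\<^bsub>W\<^esub> ev (alt u v n @ w) = gen v \<otimes>\<^bsub>W\<^esub> ev (alt u v n) \<otimes>\<^bsub>W\<^esub> ev w"
    using walk_step.hyps(1,3) w by (simp add: ev_append m_assoc)
  also have "\<dots> = ev (alt u v n) \<otimes>\<^bsub>W\<^esub> (gen ?z \<otimes>\<^bsub>W\<^esub> ev w)"
    using walk_step.hyps(1,3) w z by (subst gen_alt [OF _ _ walk_step.hyps(6)]) (auto simp: m_assoc)
  also have "gen ?z \<otimes>\<^bsub>W\<^esub> ev w = ev w \<otimes>\<^bsub>W\<^esub> gen (fst y)"
    using walk_step.IH z unfolding fst by simp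
  also have "ev (alt u v n) \<otimes>\<^bsub>W\<^esub> (ev w \<otimes>\<^bsub>W\<^esub> gen (fst y)) = ev (alt u v n @ w) \<otimes>\<^bsub>W\<^esub> gen (fst y)"
    using walk_step.hyps(1,3) w \<open>fst y \<in> S\<close> by (simp add: ev_append m_assoc)
  finally show ?case by simp
qed auto

text \<open>A block has \<open>n\<close> letters, one less than its braid relation needs. Where
  blocks meet, the first one ends in \<open>z\<close>, \<open>f'\<close> and the next begins with a
  letter different from both, followed by \<open>z\<close>. So the letters at \<open>n - 2\<close>
  and \<open>n\<close> differ, and so do those at \<open>n - 1\<close> and \<open>n + 1\<close>; a
  factor of length at least 3 across the boundary contains one of these pairs. The clause on the
  first two letters carries this information through the induction, and \<open>m \<noteq> 2\<close>
  gives the lengths 2 of blocks and 3 of factors.\<close>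

lemma walk_rigid:
  assumes "walk x w y" and m2: "\<forall>s\<in>S. \<forall>t\<in>S. m s t \<noteq> 2"
  shows "rigid m w \<and> (w \<noteq> [] \<longrightarrow> 2 \<le> length w \<and> w ! 0 \<noteq> snd x \<and> w ! 0 \<noteq> fst x \<and> w ! 1 = fst x)"
  using assms(1)
proof (induction rule: walk.induct)
  case (walk_Nil x)
  then show ?case by (simp add: rigid_def)
next
  case (walk_step v f u n w y)
  note S = walk_step.hyps(1,3)
  have m3: "3 \<le> k" if "s \<in> S" "t \<in> S" "s \<noteq> t" "m s t = enat k" for s t k
    using m_ge2_nat [OF that] m2 that by (force simp: numeral_eq_enat)
  have n: "2 \<le> n" using m3 [of v u "Suc n"] walk_step by simp
  let ?x = "alt u v n @ w"
  define z f' where "z = (if odd n then v else u)" and "f' = (if odd n then u else v)"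
  have zf: "(if odd n then (v, u) else (u, v)) = (z, f')" "z \<noteq> f'"
    using walk_step by (auto simp: z_def f'_def)
  have w: "w \<in> lists S" using walk_step walk_in_lists by blast
  have xS: "?x ! i \<in> S" if "i < length ?x" for i
    using w S alt_in_lists [of u S v n] that nth_mem [of i ?x] by (auto simp: in_lists_conv_set)
  have IH: "rigid m w" "w \<noteq> [] \<Longrightarrow> 2 \<le> length w \<and> w ! 0 \<noteq> f' \<and> w ! 0 \<noteq> z \<and> w ! 1 = z"
    using walk_step.IH unfolding zf by auto
  have last: "?x ! (n - 1) = f'" "?x ! (n - 2) = z"
    using n by (auto simp: nth_append nth_alt z_def f'_def)
  have adj: "?x ! i \<noteq> ?x ! Suc i" if "Suc i < length ?x" for i
  proof -
    consider "Suc i < n" | "Suc i = n" | "n \<le> i" by linarith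
    then show ?thesis
    proof cases
      case 1
      then show ?thesis using walk_step.hyps(4) by (auto simp: nth_append nth_alt)
    next
      case 2
      then have "w \<noteq> []" using that by auto
      with IH(2) last(1) 2 show ?thesis by (auto simp: nth_append)
    next
      case 3
      then have "Suc (i - n) < length w" using that by auto
      then have "w ! (i - n) \<noteq> w ! Suc (i - n)" using IH(1) unfolding rigid_def by blast
      then show ?thesis using 3 by (simp add: nth_append Suc_diff_le)
    qed
  qed
  have "\<exists>j. i \<le> j \<and> j + 2 < i + k \<and> ?x ! j \<noteq> ?x ! (j + 2)"
    if i: "Suc i < length ?x" "m (?x ! i) (?x ! Suc i) = enat k" "i + k \<le> length ?x" for i k
  proof -
    have k: "3 \<le> k" using m3 [of "?x ! i" "?x ! Suc i" k] xS [of i] xS [of "Suc i"] adj i by auto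
    consider "n \<le> i" | "i + k \<le> n" | "i < n" "n < i + k" by linarith
    then show ?thesis
    proof cases
      case 1
      have "Suc (i - n) < length w" "m (w ! (i - n)) (w ! Suc (i - n)) = enat k" "(i - n) + k \<le> length w"
        using 1 i by (auto simp: nth_append Suc_diff_le)
      then obtain j where "i - n \<le> j" "j + 2 < i - n + k" "w ! j \<noteq> w ! (j + 2)"
        using IH(1) unfolding rigid_def by blast
      then show ?thesis using 1 by (intro exI [of _ "n + j"]) (auto simp: nth_append)
    next
      case 2
      then have "m v u = enat k"
        using i k S by (auto simp: nth_append nth_alt m_sym split: if_splits)
      then show ?thesis using 2 walk_step.hyps(6) by simp
    next
      case 3
      then have "w \<noteq> []" using i by auto
      note w = IH(2) [OF this]
      show ?thesis
      proof (cases "Suc i = n")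
        case True
        have "?x ! (i + 2) = z" using w True by (auto simp: nth_append)
        then show ?thesis using last zf(2) True k by (intro exI [of _ i]) auto
      next
        case False
        have "?x ! (n - 2) \<noteq> ?x ! (n - 2 + 2)" using w last n by (auto simp: nth_append)
        then show ?thesis using 3 False n by (intro exI [of _ "n - 2"]) auto
      qed
    qed
  qed
  then have "rigid m ?x" using adj unfolding rigid_def by blast
  moreover have "?x ! 0 = u" "?x ! 1 = v" using n by (auto simp: nth_append nth_alt)
  ultimately show ?case using walk_step n by simp
qed

lemma moveE:
  assumes "(x, y) \<in> move"
  obtains v f u n where "x = (v, f)" "y = (if odd n then (v, u) else (u, v))" "v \<in> S" "f \<in> S" "u \<in> S"
    "u \<noteq> v" "u \<noteq> f" "m v u = enat (Suc n)" "n \<noteq> 0"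
proof -
  obtain v f u k where e: "x = (v, f)" "y = (if even k then (v, u) else (u, v))"
    "v \<in> S" "f \<in> S" "u \<in> S" "u \<noteq> v" "u \<noteq> f" "m v u = enat k"
    using assms unfolding move_def by blast
  have "2 \<le> k" using m_ge2_nat [OF e(3,5) e(6) [symmetric] e(8)] .
  then obtain n where "k = Suc n" "n \<noteq> 0" by (cases k) auto
  with e show ?thesis by (intro that [of v f n u]) auto
qed

lemma move_walk: "(x, y) \<in> move \<Longrightarrow> \<exists>w. w \<noteq> [] \<and> walk x w y"
proof (erule moveE)
  fix v f u n
  assume e: "x = (v, f)" "y = (if odd n then (v, u) else (u, v))" "v \<in> S" "f \<in> S" "u \<in> S"
    "u \<noteq> v" "u \<noteq> f" "m v u = enat (Suc n)" "n \<noteq> 0"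
  have "walk (v, f) (alt u v n @ []) y"
    unfolding e(2) by (rule walk_step [OF e(3-8) walk_Nil])
  moreover have "alt u v n @ [] \<noteq> []"
    using e(9) length_alt [of u v n] by (metis append_Nil2 length_0_conv)
  ultimately show ?thesis using e(1) by blast
qed

lemma trancl_move_walk: "(x, y) \<in> move\<^sup>+ \<Longrightarrow> \<exists>w. w \<noteq> [] \<and> walk x w y"
proof (induction rule: trancl.induct)
  case (trancl_into_trancl x y z)
  then show ?case using move_walk [of y z] walk_append by (meson append_is_Nil_conv)
qed (rule move_walk)

text \<open>The word of a closed walk can be repeated at will; all its powers are rigid, hence
  reduced, and so distinguished by their lengths.\<close>

lemma infinite_centralizer:
  assumes "(x, x) \<in> move\<^sup>+" and m2: "\<forall>s\<in>S. \<forall>t\<in>S. m s t \<noteq> 2"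
  shows "\<exists>s\<in>S. infinite {w \<in> carrier W. gen s \<otimes>\<^bsub>W\<^esub> w = w \<otimes>\<^bsub>W\<^esub> gen s}"
proof (intro bexI)
  let ?Z = "{w \<in> carrier W. gen (fst x) \<otimes>\<^bsub>W\<^esub> w = w \<otimes>\<^bsub>W\<^esub> gen (fst x)}"
  obtain w where w: "w \<noteq> []" "walk x w x" using trancl_move_walk assms(1) by blast
  show s: "fst x \<in> S"
    using tranclD [OF assms(1)] by (auto simp: move_def)
  let ?w = "\<lambda>k. concat (replicate k w)"
  have walk: "walk x (?w k) x" for k
    by (induction k) (use w in \<open>auto intro: walk_append walk_Nil\<close>)
  have len: "len (ev (?w k)) = k * length w" for k
    using rigid_len walk_rigid [OF walk m2] walk_in_lists [OF walk]
    by (simp add: length_concat sum_list_replicate)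
  have "inj (\<lambda>k. ev (?w k))"
    by (rule injI) (metis len length_0_conv mult_right_cancel w(1))
  moreover have "range (\<lambda>k. ev (?w k)) \<subseteq> ?Z"
    using walk_conj [OF walk s] walk_in_lists [OF walk] by blast
  ultimately show "infinite ?Z"
    using finite_subset range_inj_infinite by blast
qed


section \<open>Conjugators between generators\<close>

text \<open>The last two conclusions are the ban on repeating an edge: since the lengths in
  \<open>w = alt r s n w'\<close> add up, neither \<open>s\<close> nor \<open>r\<close> can shorten
  \<open>w'\<close>. That \<open>r\<close> shortens \<open>w\<close> is recorded to compare
  \<open>r\<close> with the previously forbidden letter.\<close>

lemma centralizer_step:
  assumes w: "w \<in> carrier W" "w \<noteq> \<one>\<^bsub>W\<^esub>" and s: "s \<in> S" "t \<in> S"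
    and conj: "gen s \<otimes>\<^bsub>W\<^esub> w = w \<otimes>\<^bsub>W\<^esub> gen t" and up: "len w < len (gen s \<otimes>\<^bsub>W\<^esub> w)"
  obtains r n w' where "r \<in> S" "r \<noteq> s" "len (gen r \<otimes>\<^bsub>W\<^esub> w) < len w" "m s r = enat (Suc n)"
    "w' \<in> carrier W" "w = ev (alt r s n) \<otimes>\<^bsub>W\<^esub> w'"
    "gen (if odd n then s else r) \<otimes>\<^bsub>W\<^esub> w' = w' \<otimes>\<^bsub>W\<^esub> gen t"
    "len w' < len (gen s \<otimes>\<^bsub>W\<^esub> w')" "len w' < len (gen r \<otimes>\<^bsub>W\<^esub> w')"
proof -
  obtain xs where xs: "xs \<in> lists S" "w = ev xs" "length xs = len w" using len_word w by blast
  then obtain r xs' where r: "xs = r # xs'" using w by (cases xs) auto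
  have rS: "r \<in> S" "xs' \<in> lists S" using r xs by auto
  have "gen r \<otimes>\<^bsub>W\<^esub> w = ev xs'" using rS by (simp add: xs(2) r ev_Cons)
  then have rw: "len (gen r \<otimes>\<^bsub>W\<^esub> w) < len w"
    using len_le [OF rS(2)] xs(3) r by simp
  then have rs: "r \<noteq> s" using up by auto
  let ?g = "gen s \<otimes>\<^bsub>W\<^esub> w"
  have g: "?g \<in> carrier W" using w s by simp
  \<comment> \<open>Why \<open>r\<close> is still a descent of \<open>sw\<close>: as
    \<open>sw = wt\<close>, the element \<open>rsw\<close> is \<open>(rw)t\<close>, at most one
    longer than \<open>rw\<close>, while \<open>sw\<close> is two longer than
    \<open>rw\<close>.\<close>
  have "gen r \<otimes>\<^bsub>W\<^esub> ?g = (gen r \<otimes>\<^bsub>W\<^esub> w) \<otimes>\<^bsub>W\<^esub> gen t"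
    using w s rS conj by (simp add: m_assoc)
  then have "len (gen r \<otimes>\<^bsub>W\<^esub> ?g) \<le> Suc (len (gen r \<otimes>\<^bsub>W\<^esub> w))"
    using len_mult_gen [of t "gen r \<otimes>\<^bsub>W\<^esub> w"] s w rS by auto
  then have "len (gen r \<otimes>\<^bsub>W\<^esub> ?g) < len ?g" using rw up by simp
  moreover have "len (gen s \<otimes>\<^bsub>W\<^esub> ?g) < len ?g" using s w up by simp
  ultimately obtain M ys where M: "m s r = enat M" "ys \<in> lists S" "?g = ev (alt s r M @ ys)"
    "M + length ys = len ?g"
    using descents_alt [OF g s(1) rS(1) rs [symmetric]] by metis
  have "2 \<le> M" using m_ge2_nat s rS rs M by metis
  then obtain n where n: "M = Suc n" "n \<noteq> 0" by (cases M) auto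
  define w' where "w' = ev ys"
  have w': "w' \<in> carrier W" using M(2) by (simp add: w'_def)
  have "gen s \<otimes>\<^bsub>W\<^esub> w = gen s \<otimes>\<^bsub>W\<^esub> (ev (alt r s n) \<otimes>\<^bsub>W\<^esub> w')"
    using M(2) s rS unfolding M(3) n(1) by (simp add: ev_Cons ev_append w'_def)
  then have w_eq: "w = ev (alt r s n) \<otimes>\<^bsub>W\<^esub> w'"
    using w w' s rS by (subst (asm) Units_l_cancel) auto
  have len_g: "len ?g = Suc (len w)" using len_gen_mult [OF s(1) w(1)] up by auto
  have len_w: "len w = n + length ys" using M(4) len_g n by simp
  have len_w': "len w' = length ys"
    using len_append_le [of "alt r s n" w'] w' rS s w_eq len_w len_le [OF M(2)]
    by (simp add: w'_def)
  let ?z = "if odd n then s else r" and ?f = "if odd n then r else s"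
  have z: "?z \<in> S" "?f \<in> S" using s rS by auto
  have alt: "alt r s n \<in> lists S" using s rS by simp
  have sw: "gen s \<otimes>\<^bsub>W\<^esub> w = ev (alt r s n) \<otimes>\<^bsub>W\<^esub> (gen ?z \<otimes>\<^bsub>W\<^esub> w')"
  proof -
    have "gen s \<otimes>\<^bsub>W\<^esub> w = gen s \<otimes>\<^bsub>W\<^esub> ev (alt r s n) \<otimes>\<^bsub>W\<^esub> w'"
      using w_eq w' alt s by (simp add: m_assoc)
    also have "\<dots> = ev (alt r s n) \<otimes>\<^bsub>W\<^esub> gen ?z \<otimes>\<^bsub>W\<^esub> w'"
      using gen_alt [OF s(1) rS(1), of n] M(1) n(1) by simp
    finally show ?thesis using w' alt z by (simp add: m_assoc)
  qed
  have "ev (alt r s n) \<otimes>\<^bsub>W\<^esub> (gen ?z \<otimes>\<^bsub>W\<^esub> w') = ev (alt r s n) \<otimes>\<^bsub>W\<^esub> (w' \<otimes>\<^bsub>W\<^esub> gen t)"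
    using sw conj w_eq w' alt s by (simp add: m_assoc)
  then have conj': "gen ?z \<otimes>\<^bsub>W\<^esub> w' = w' \<otimes>\<^bsub>W\<^esub> gen t"
    using w' alt s z by (subst (asm) Units_l_cancel) auto
  have up_z: "len w' < len (gen ?z \<otimes>\<^bsub>W\<^esub> w')"
  proof (rule ccontr)
    assume "\<not> ?thesis"
    then have "len (gen s \<otimes>\<^bsub>W\<^esub> w) \<le> n + len w'"
      using len_append_le [OF alt, of "gen ?z \<otimes>\<^bsub>W\<^esub> w'"] z w' sw by auto
    then show False using len_g len_w len_w' by simp
  qed
  have up_f: "len w' < len (gen ?f \<otimes>\<^bsub>W\<^esub> w')"
  proof (rule ccontr)
    assume "\<not> ?thesis"
    then have l: "Suc (len (gen ?f \<otimes>\<^bsub>W\<^esub> w')) = len w'"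
      using len_gen_mult [of ?f w'] z w' by auto
    obtain k where k: "n = Suc k" using n by (cases n) auto
    have altk: "alt r s k \<in> lists S" using s rS by simp
    \<comment> \<open>The alternating word ends in \<open>?f\<close>; if \<open>?f\<close> shortened
      \<open>w'\<close>, absorbing this letter would shorten \<open>w\<close>.\<close>
    have "alt r s n = alt r s k @ [?f]" unfolding k alt_snoc by simp
    then have "w = ev (alt r s k) \<otimes>\<^bsub>W\<^esub> (gen ?f \<otimes>\<^bsub>W\<^esub> w')"
      using w_eq w' z altk ev_append [of "alt r s k" "[?f]"] by (simp add: m_assoc)
    then have "len w \<le> k + len (gen ?f \<otimes>\<^bsub>W\<^esub> w')"
      using len_append_le [OF altk, of "gen ?f \<otimes>\<^bsub>W\<^esub> w'"] z w' by auto
    then show False using l len_w len_w' k by simp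
  qed
  have "len w' < len (gen s \<otimes>\<^bsub>W\<^esub> w')" "len w' < len (gen r \<otimes>\<^bsub>W\<^esub> w')"
    using up_z up_f by (cases "odd n"; simp)+
  then show ?thesis
    using that [OF rS(1) rs rw _ w' w_eq conj'] M(1) n by simp
qed

text \<open>A state \<open>(s, f)\<close> stands for the conjugators that neither \<open>s\<close>
  nor \<open>f\<close> shortens. Apart from the identity they come from finitely many successor
  states, and acyclicity of \<open>move\<close> on a finite set makes the recursion
  well-founded.\<close>

lemma finite_minimal_conjugators:
  assumes wf: "wf (move\<inverse>)" and fin: "finite S" and t: "t \<in> S" and x: "x \<in> S \<times> S"
  shows "finite {w \<in> carrier W. len w < len (gen (fst x) \<otimes>\<^bsub>W\<^esub> w) \<and> len w < len (gen (snd x) \<otimes>\<^bsub>W\<^esub> w) \<and>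
    gen (fst x) \<otimes>\<^bsub>W\<^esub> w = w \<otimes>\<^bsub>W\<^esub> gen t}" (is "finite (?X x)")
  using wf x
proof (induction x rule: wf_induct_rule)
  case (less x)
  obtain s f where x: "x = (s, f)" "s \<in> S" "f \<in> S" using less.prems by (cases x) auto
  \<comment> \<open>One less than the label of the edge. For an infinite label the value is
    arbitrary, and the equation in \<open>A\<close> discards such \<open>r\<close>.\<close>
  define N where "N r = (THE n. m s r = enat (Suc n))" for r
  define nx where "nx r = (if odd (N r) then (s, r) else (r, s))" for r
  define A where "A = {r \<in> S. r \<noteq> s \<and> r \<noteq> f \<and> m s r = enat (Suc (N r))}"
  have "?X x \<subseteq> {\<one>\<^bsub>W\<^esub>} \<union> (\<Union>r\<in>A. (\<lambda>w'. ev (alt r s (N r)) \<otimes>\<^bsub>W\<^esub> w') ` ?X (nx r))"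
  proof
    fix w assume "w \<in> ?X x"
    then have w: "w \<in> carrier W" "len w < len (gen s \<otimes>\<^bsub>W\<^esub> w)" "len w < len (gen f \<otimes>\<^bsub>W\<^esub> w)"
      "gen s \<otimes>\<^bsub>W\<^esub> w = w \<otimes>\<^bsub>W\<^esub> gen t" by (auto simp: x)
    show "w \<in> {\<one>\<^bsub>W\<^esub>} \<union> (\<Union>r\<in>A. (\<lambda>w'. ev (alt r s (N r)) \<otimes>\<^bsub>W\<^esub> w') ` ?X (nx r))"
    proof (cases "w = \<one>\<^bsub>W\<^esub>")
      case False
      obtain r n w' where r: "r \<in> S" "r \<noteq> s" "len (gen r \<otimes>\<^bsub>W\<^esub> w) < len w" "m s r = enat (Suc n)"
        "w' \<in> carrier W" "w = ev (alt r s n) \<otimes>\<^bsub>W\<^esub> w'"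
        "gen (if odd n then s else r) \<otimes>\<^bsub>W\<^esub> w' = w' \<otimes>\<^bsub>W\<^esub> gen t"
        "len w' < len (gen s \<otimes>\<^bsub>W\<^esub> w')" "len w' < len (gen r \<otimes>\<^bsub>W\<^esub> w')"
        using centralizer_step [OF w(1) False x(2) t w(4,2)] by metis
      have n: "N r = n" using r(4) by (simp add: N_def)
      have "r \<noteq> f" using r(3) w(3) by auto
      then have "r \<in> A" using r n by (simp add: A_def)
      moreover have "w' \<in> ?X (nx r)" using r(5,7-9) by (cases "odd n") (simp_all add: nx_def n)
      ultimately show ?thesis using r(6) n by blast
    qed simp
  qed
  moreover have "finite (?X (nx r))" if "r \<in> A" for r
  proof (rule less.IH)
    show "(nx r, x) \<in> move\<inverse>"
    proof -
      have "(x, if even (Suc (N r)) then (s, r) else (r, s)) \<in> move"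
        using that x unfolding move_def A_def by blast
      then show ?thesis by (simp add: nx_def)
    qed
    show "nx r \<in> S \<times> S" using that x by (auto simp: nx_def A_def)
  qed
  moreover have "finite A" using fin by (simp add: A_def)
  ultimately show ?case
    by (elim finite_subset) auto
qed

text \<open>Left multiplication by \<open>gen s\<close> preserves the equation and exchanges the
  solutions with and without the left descent \<open>s\<close>. Those without it belong to the state
  \<open>(s, s)\<close>, which forbids no edge.\<close>

lemma finite_conjugators:
  assumes fin: "finite S" and ac: "acyclic move" and st: "s \<in> S" "t \<in> S"
  shows "finite {w \<in> carrier W. gen s \<otimes>\<^bsub>W\<^esub> w = w \<otimes>\<^bsub>W\<^esub> gen t}"
proof -
  have "move \<subseteq> (S \<times> S) \<times> (S \<times> S)" by (auto simp: move_def)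
  then have "finite move" using fin by (simp add: finite_subset)
  then have wf: "wf (move\<inverse>)" using ac finite_acyclic_wf_converse by blast
  let ?X = "{w \<in> carrier W. len w < len (gen s \<otimes>\<^bsub>W\<^esub> w) \<and> gen s \<otimes>\<^bsub>W\<^esub> w = w \<otimes>\<^bsub>W\<^esub> gen t}"
  have X: "finite ?X"
    using finite_minimal_conjugators [OF wf fin st(2), of "(s, s)"] st by simp
  have "{w \<in> carrier W. gen s \<otimes>\<^bsub>W\<^esub> w = w \<otimes>\<^bsub>W\<^esub> gen t} \<subseteq> ?X \<union> (\<lambda>w. gen s \<otimes>\<^bsub>W\<^esub> w) ` ?X"
  proof
    fix w assume "w \<in> {w \<in> carrier W. gen s \<otimes>\<^bsub>W\<^esub> w = w \<otimes>\<^bsub>W\<^esub> gen t}"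
    then have w: "w \<in> carrier W" "gen s \<otimes>\<^bsub>W\<^esub> w = w \<otimes>\<^bsub>W\<^esub> gen t" by auto
    show "w \<in> ?X \<union> (\<lambda>w. gen s \<otimes>\<^bsub>W\<^esub> w) ` ?X"
    proof (cases "len w < len (gen s \<otimes>\<^bsub>W\<^esub> w)")
      case False
      then have less: "len (gen s \<otimes>\<^bsub>W\<^esub> w) < len w" using len_gen_mult [OF st(1) w(1)] by auto
      have "gen s \<otimes>\<^bsub>W\<^esub> (gen s \<otimes>\<^bsub>W\<^esub> w) = gen s \<otimes>\<^bsub>W\<^esub> w \<otimes>\<^bsub>W\<^esub> gen t"
        using st w(1) by (subst w(2)) (simp add: m_assoc)
      then have "gen s \<otimes>\<^bsub>W\<^esub> w \<in> ?X" using less st w(1) by simp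
      then show ?thesis using st w(1) by (intro UnI2 image_eqI [of _ _ "gen s \<otimes>\<^bsub>W\<^esub> w"]) auto
    qed (use w in auto)
  qed
  then show ?thesis using X finite_subset by blast
qed

section \<open>Support of the coefficients of the gradient form\<close>

text \<open>Exchange applied to the word \<open>xs @ [t]\<close> must delete the final
  \<open>t\<close>: any other deletion would also shorten \<open>xs\<close> under \<open>s\<close>,
  against the assumption that \<open>s\<close> lengthens \<open>w\<close>.\<close>

lemma folding:
  assumes st: "s \<in> S" "t \<in> S" and w: "w \<in> carrier W"
    and up: "len w < len (gen s \<otimes>\<^bsub>W\<^esub> w)" "len w < len (w \<otimes>\<^bsub>W\<^esub> gen t)"
    and down: "len (gen s \<otimes>\<^bsub>W\<^esub> (w \<otimes>\<^bsub>W\<^esub> gen t)) < len (w \<otimes>\<^bsub>W\<^esub> gen t)"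
  shows "gen s \<otimes>\<^bsub>W\<^esub> w = w \<otimes>\<^bsub>W\<^esub> gen t"
proof -
  obtain xs where xs: "xs \<in> lists S" "w = ev xs" "length xs = len w" using len_word w by blast
  have wt: "w \<otimes>\<^bsub>W\<^esub> gen t = ev (xs @ [t])" using xs st by (simp add: ev_append)
  have xt: "xs @ [t] \<in> lists S" using xs st by simp
  have down': "len (gen s \<otimes>\<^bsub>W\<^esub> ev (xs @ [t])) < len (ev (xs @ [t]))" using down unfolding wt .
  obtain p c q where pcq: "xs @ [t] = p @ c # q" "gen s \<otimes>\<^bsub>W\<^esub> ev p = ev (p @ [c])"
    by (rule exchange [OF st(1) xt down'])
  show ?thesis
  proof (cases q rule: rev_cases)
    case Nil
    then show ?thesis using pcq xs wt by simp
  next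
    case (snoc q' t')
    then have xs': "xs = p @ c # q'" using pcq by simp
    then have S: "p \<in> lists S" "c \<in> S" "q' \<in> lists S" using xs by auto
    have "gen s \<otimes>\<^bsub>W\<^esub> w = gen s \<otimes>\<^bsub>W\<^esub> ev p \<otimes>\<^bsub>W\<^esub> (gen c \<otimes>\<^bsub>W\<^esub> ev q')"
      unfolding xs(2) xs' using S st by (simp add: ev_append ev_Cons m_assoc)
    also have "\<dots> = ev (p @ q')"
      unfolding pcq(2) using S by (simp add: ev_append m_assoc)
    finally have "len (gen s \<otimes>\<^bsub>W\<^esub> w) < length xs"
      using len_le [of "p @ q'"] S xs' by simp
    then show ?thesis using up xs by simp
  qed
qed

definition gamma :: "('a \<times> bool) list set \<Rightarrow> ('a \<times> bool) list set \<Rightarrow> ('a \<times> bool) list set \<Rightarrow> int"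
  where "gamma u v w = int (len (u \<otimes>\<^bsub>W\<^esub> w \<otimes>\<^bsub>W\<^esub> v)) + int (len w) - int (len (u \<otimes>\<^bsub>W\<^esub> w)) - int (len (w \<otimes>\<^bsub>W\<^esub> v))"

text \<open>Along the square \<open>w\<close>, \<open>sw\<close>, \<open>swt\<close>,
  \<open>wt\<close> neighbouring lengths differ by one. A nonzero alternating sum forces
  \<open>w\<close> and \<open>swt\<close> to be both below or both above the other two corners; the
  first case is \<open>folding\<close> for \<open>w\<close>, the second \<open>folding\<close> for
  \<open>sw\<close>.\<close>

lemma gamma_gen_nonzero:
  assumes st: "s \<in> S" "t \<in> S" and w: "w \<in> carrier W" and nz: "gamma (gen s) (gen t) w \<noteq> 0"
  shows "gen s \<otimes>\<^bsub>W\<^esub> w = w \<otimes>\<^bsub>W\<^esub> gen t"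
proof -
  let ?sw = "gen s \<otimes>\<^bsub>W\<^esub> w" and ?wt = "w \<otimes>\<^bsub>W\<^esub> gen t"
  have a: "gen s \<otimes>\<^bsub>W\<^esub> w \<otimes>\<^bsub>W\<^esub> gen t = gen s \<otimes>\<^bsub>W\<^esub> ?wt" using st w by (simp add: m_assoc)
  have l: "len ?sw = Suc (len w) \<or> len w = Suc (len ?sw)" "len ?wt = Suc (len w) \<or> len w = Suc (len ?wt)"
    "len (gen s \<otimes>\<^bsub>W\<^esub> ?wt) = Suc (len ?wt) \<or> len ?wt = Suc (len (gen s \<otimes>\<^bsub>W\<^esub> ?wt))"
    "len (gen s \<otimes>\<^bsub>W\<^esub> ?wt) = Suc (len ?sw) \<or> len ?sw = Suc (len (gen s \<otimes>\<^bsub>W\<^esub> ?wt))"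
    using len_gen_mult [OF st(1) w] len_mult_gen [OF st(2) w] len_gen_mult [of s ?wt] len_mult_gen [of t ?sw]
      st w a by auto
  have g: "int (len (gen s \<otimes>\<^bsub>W\<^esub> ?wt)) + int (len w) \<noteq> int (len ?sw) + int (len ?wt)"
    using nz by (simp add: gamma_def a)
  consider "len w < len ?sw" "len w < len ?wt" "len (gen s \<otimes>\<^bsub>W\<^esub> ?wt) < len ?wt"
    | "len ?sw < len w" "len ?wt < len w" "len ?sw < len (gen s \<otimes>\<^bsub>W\<^esub> ?wt)"
    using l g by linarith
  then show ?thesis
  proof cases
    case 1
    then show ?thesis using folding st w by blast
  next
    case 2
    have wt: "?sw \<otimes>\<^bsub>W\<^esub> gen t = gen s \<otimes>\<^bsub>W\<^esub> ?wt" using a by simp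
    have ss: "gen s \<otimes>\<^bsub>W\<^esub> (?sw \<otimes>\<^bsub>W\<^esub> gen t) = ?wt" using st w by (simp add: m_assoc)
    have "gen s \<otimes>\<^bsub>W\<^esub> ?sw = ?sw \<otimes>\<^bsub>W\<^esub> gen t"
    proof (rule folding [OF st])
      show "len (gen s \<otimes>\<^bsub>W\<^esub> (?sw \<otimes>\<^bsub>W\<^esub> gen t)) < len (?sw \<otimes>\<^bsub>W\<^esub> gen t)"
        unfolding ss unfolding wt using l 2 by linarith
    qed (use 2 st w wt in auto)
    then have "gen s \<otimes>\<^bsub>W\<^esub> (gen s \<otimes>\<^bsub>W\<^esub> ?sw) = ?wt" unfolding ss [symmetric] by simp
    then show ?thesis using st w by simp
  qed
qed

lemma gamma_conj:
  assumes "s \<in> S" "w \<in> carrier W" "gen s \<otimes>\<^bsub>W\<^esub> w = w \<otimes>\<^bsub>W\<^esub> gen s"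
  shows "\<bar>gamma (gen s) (gen s) w\<bar> = 2"
proof -
  have *: "gen s \<otimes>\<^bsub>W\<^esub> w \<otimes>\<^bsub>W\<^esub> gen s = w" unfolding assms(3) using assms(1,2) by simp
  show ?thesis
    using len_gen_mult [OF assms(1,2)] unfolding gamma_def * assms(3) [symmetric] by auto
qed

lemma gamma_mult_left:
  assumes "u \<in> carrier W" "u' \<in> carrier W" "v \<in> carrier W" "w \<in> carrier W"
  shows "gamma (u \<otimes>\<^bsub>W\<^esub> u') v w = gamma u v (u' \<otimes>\<^bsub>W\<^esub> w) + gamma u' v w"
  using assms by (simp add: gamma_def m_assoc)

lemma gamma_mult_right:
  assumes "u \<in> carrier W" "v \<in> carrier W" "v' \<in> carrier W" "w \<in> carrier W"
  shows "gamma u (v \<otimes>\<^bsub>W\<^esub> v') w = gamma u v' (w \<otimes>\<^bsub>W\<^esub> v) + gamma u v w"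
  using assms by (simp add: gamma_def m_assoc)

text \<open>By the cocycle identities the support for a product lies in the union of the support for
  one factor and a translate of the support for the other. The left argument is built up first, so
  that the induction on the right one may keep an arbitrary \<open>xs\<close>.\<close>

lemma finite_gamma_support:
  assumes fin: "\<And>s t. s \<in> S \<Longrightarrow> t \<in> S \<Longrightarrow> finite {w \<in> carrier W. gen s \<otimes>\<^bsub>W\<^esub> w = w \<otimes>\<^bsub>W\<^esub> gen t}"
    and uv: "u \<in> carrier W" "v \<in> carrier W"
  shows "finite {w \<in> carrier W. gamma u v w \<noteq> 0}"
proof -
  have gen: "finite {w \<in> carrier W. gamma (gen s) (gen t) w \<noteq> 0}" if "s \<in> S" "t \<in> S" for s t
    by (rule finite_subset [OF _ fin [OF that]]) (use gamma_gen_nonzero that in auto)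
  have left_gen: "finite {w \<in> carrier W. gamma (ev xs) (gen t) w \<noteq> 0}" if "xs \<in> lists S" "t \<in> S" for xs t
    using that(1)
  proof (induction xs)
    case (Cons s xs)
    then have S: "s \<in> S" "xs \<in> lists S" by auto
    let ?A = "{w \<in> carrier W. gamma (gen s) (gen t) w \<noteq> 0}"
    have "{w \<in> carrier W. gamma (ev (s # xs)) (gen t) w \<noteq> 0} \<subseteq>
        (\<lambda>w. inv\<^bsub>W\<^esub> ev xs \<otimes>\<^bsub>W\<^esub> w) ` ?A \<union> {w \<in> carrier W. gamma (ev xs) (gen t) w \<noteq> 0}"
    proof
      fix w assume w: "w \<in> {w \<in> carrier W. gamma (ev (s # xs)) (gen t) w \<noteq> 0}"
      then have "gamma (gen s) (gen t) (ev xs \<otimes>\<^bsub>W\<^esub> w) \<noteq> 0 \<or> gamma (ev xs) (gen t) w \<noteq> 0"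
        using gamma_mult_left [of "gen s" "ev xs" "gen t" w] S that by (auto simp: ev_Cons)
      moreover have "w = inv\<^bsub>W\<^esub> ev xs \<otimes>\<^bsub>W\<^esub> (ev xs \<otimes>\<^bsub>W\<^esub> w)"
        using w S by (simp add: m_assoc [symmetric])
      moreover have "ev xs \<otimes>\<^bsub>W\<^esub> w \<in> carrier W" using w S by simp
      ultimately show "w \<in> (\<lambda>w. inv\<^bsub>W\<^esub> ev xs \<otimes>\<^bsub>W\<^esub> w) ` ?A \<union> {w \<in> carrier W. gamma (ev xs) (gen t) w \<noteq> 0}"
        using w by blast
    qed
    then show ?case using gen [OF S(1) that(2)] Cons.IH by (auto elim: finite_subset)
  qed (simp add: gamma_def cong: conj_cong)
  have "finite {w \<in> carrier W. gamma (ev xs) (ev ys) w \<noteq> 0}" if "xs \<in> lists S" "ys \<in> lists S" for xs ys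
    using that(2)
  proof (induction ys)
    case (Cons t ys)
    then have S: "t \<in> S" "ys \<in> lists S" by auto
    let ?A = "{w \<in> carrier W. gamma (ev xs) (ev ys) w \<noteq> 0}"
    have "{w \<in> carrier W. gamma (ev xs) (ev (t # ys)) w \<noteq> 0} \<subseteq>
        (\<lambda>w. w \<otimes>\<^bsub>W\<^esub> gen t) ` ?A \<union> {w \<in> carrier W. gamma (ev xs) (gen t) w \<noteq> 0}"
    proof
      fix w assume w: "w \<in> {w \<in> carrier W. gamma (ev xs) (ev (t # ys)) w \<noteq> 0}"
      then have "gamma (ev xs) (ev ys) (w \<otimes>\<^bsub>W\<^esub> gen t) \<noteq> 0 \<or> gamma (ev xs) (gen t) w \<noteq> 0"
        using gamma_mult_right [of "ev xs" "gen t" "ev ys" w] S that by (auto simp: ev_Cons)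
      moreover have "w = w \<otimes>\<^bsub>W\<^esub> gen t \<otimes>\<^bsub>W\<^esub> gen t"
        using w S by simp
      moreover have "w \<otimes>\<^bsub>W\<^esub> gen t \<in> carrier W" using w S by simp
      ultimately show "w \<in> (\<lambda>w. w \<otimes>\<^bsub>W\<^esub> gen t) ` ?A \<union> {w \<in> carrier W. gamma (ev xs) (gen t) w \<noteq> 0}"
        using w by blast
    qed
    then show ?case using left_gen [OF that(1) S(1)] Cons.IH by (auto elim: finite_subset)
  qed (use that in \<open>simp add: gamma_def cong: conj_cong\<close>)
  moreover obtain xs ys where "xs \<in> lists S" "u = ev xs" "ys \<in> lists S" "v = ev ys"
    using ev_surj uv by metis
  ultimately show ?thesis by blast
qed


section \<open>Cycles of moves and the graph condition\<close>

lemma odd_edges_iff: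
  "{s, t} \<in> odd_edges S m \<longleftrightarrow> s \<in> S \<and> t \<in> S \<and> s \<noteq> t \<and> (\<exists>k. m s t = enat k \<and> odd k)"
  unfolding odd_edges_def by (auto simp: doubleton_eq_iff m_sym)

lemma even_edges_iff:
  "{s, t} \<in> even_edges S m \<longleftrightarrow> s \<in> S \<and> t \<in> S \<and> s \<noteq> t \<and> (\<exists>k. m s t = enat k \<and> even k)"
  unfolding even_edges_def by (auto simp: doubleton_eq_iff m_sym)

lemma not_odd_and_even: "{s, t} \<in> odd_edges S m \<Longrightarrow> {s, t} \<notin> even_edges S m"
  by (auto simp: odd_edges_iff even_edges_iff)

abbreviation odd_rel :: "('a \<times> 'a) set"
  where "odd_rel \<equiv> {(u, v). {u, v} \<in> odd_edges S m}"

text \<open>On odd edges the forbidden end is the vertex just left, so these moves form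
  non-backtracking walks in \<open>(S, odd_edges S m)\<close>.\<close>

definition odd_move :: "(('a \<times> 'a) \<times> ('a \<times> 'a)) set"
  where "odd_move = {((v, f), (u, v)) | v f u. f \<in> S \<and> {v, u} \<in> odd_edges S m \<and> u \<noteq> f}"

lemma odd_move_subset: "odd_move \<subseteq> move"
proof
  fix x assume "x \<in> odd_move"
  then obtain v f u where x: "x = ((v, f), (u, v))" "f \<in> S" "{v, u} \<in> odd_edges S m" "u \<noteq> f"
    unfolding odd_move_def by blast
  then obtain k where "v \<in> S" "u \<in> S" "v \<noteq> u" "m v u = enat k" "odd k"
    unfolding odd_edges_iff by blast
  then show "x \<in> move" unfolding move_def x(1) using x by force
qed

lemma even_moveI: "f \<in> S \<Longrightarrow> {v, u} \<in> even_edges S m \<Longrightarrow> u \<noteq> f \<Longrightarrow> ((v, f), (v, u)) \<in> move"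
  unfolding even_edges_iff move_def by force

lemma move_cases:
  assumes "(x, y) \<in> move"
  obtains "(x, y) \<in> odd_move"
    | v f u where "x = (v, f)" "y = (v, u)" "{v, u} \<in> even_edges S m" "u \<noteq> f"
proof -
  obtain v f u n where e: "x = (v, f)" "y = (if odd n then (v, u) else (u, v))" "v \<in> S" "f \<in> S" "u \<in> S"
    "u \<noteq> v" "u \<noteq> f" "m v u = enat (Suc n)"
    using moveE [OF assms] by metis
  show ?thesis
  proof (cases "odd n")
    case True
    then have "{v, u} \<in> even_edges S m" using e unfolding even_edges_iff by auto
    then show ?thesis using that(2) e True by auto
  next
    case False
    then have "{v, u} \<in> odd_edges S m" using e unfolding odd_edges_iff by auto
    then show ?thesis using that(1) e False by (auto simp: odd_move_def)
  qed
qed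

lemma odd_rel_rtrancl_sym: "(s, t) \<in> odd_rel\<^sup>* \<Longrightarrow> (t, s) \<in> odd_rel\<^sup>*"
  by (rule symD [OF sym_rtrancl]) (auto simp: sym_def insert_commute)

lemma odd_move_rtrancl_fst: "(x, y) \<in> odd_move\<^sup>* \<Longrightarrow> (fst x, fst y) \<in> odd_rel\<^sup>*"
proof (induction rule: rtrancl_induct)
  case (step y z)
  then have "(fst y, fst z) \<in> odd_rel" by (auto simp: odd_move_def)
  with step.IH show ?case by (rule rtrancl_into_rtrancl)
qed simp

text \<open>A shortest closed stretch of a non-backtracking walk is a cycle: its vertices are
  distinct, its length is not 1 because edges join different vertices, and not 2 because nothing
  backtracks.\<close>

lemma forest_no_return:
  assumes forest: "graph_forest S (odd_edges S m)" and "(x, y) \<in> odd_move\<^sup>+" "fst x = fst y"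
  shows False
proof -
  obtain n h where n: "n > 0" and h: "h 0 = x" "h n = y" "\<And>i. i < n \<Longrightarrow> (h i, h (Suc i)) \<in> odd_move"
    using assms(2) unfolding trancl_power relpow_fun_conv by blast
  define a where "a i = fst (h i)" for i :: nat
  have edge: "{a i, a (Suc i)} \<in> odd_edges S m" if "i < n" for i
    using h(3) [OF that] by (auto simp: a_def odd_move_def)
  have nonback: "a (Suc (Suc i)) \<noteq> a i" if "Suc i < n" for i
    using h(3) [of i] h(3) [of "Suc i"] that by (auto simp: a_def odd_move_def)
  define P where "P d \<longleftrightarrow> 0 < d \<and> (\<exists>i. i + d \<le> n \<and> a i = a (i + d))" for d
  have "P n" using n assms(3) h by (auto simp: P_def a_def)
  define d where "d = (LEAST d. P d)"
  have "P d" unfolding d_def using \<open>P n\<close> by (rule LeastI)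
  then obtain i where d: "0 < d" "i + d \<le> n" "a i = a (i + d)" by (auto simp: P_def)
  have min: "\<not> P d'" if "d' < d" for d' using that not_less_Least unfolding d_def by blast
  have "d \<noteq> 1" using edge [of i] d by (auto simp: odd_edges_iff)
  moreover have "d \<noteq> 2" using nonback [of i] d by (auto simp: numeral_2_eq_2)
  ultimately have d3: "3 \<le> d" using d by simp
  let ?xs = "map a [i..<i + d]"
  have "distinct ?xs"
    unfolding distinct_map
  proof (intro conjI inj_onI)
    fix j k assume jk: "j \<in> set [i..<i + d]" "k \<in> set [i..<i + d]" "a j = a k"
    have *: "\<not> (j < k \<and> a j = a k)" if "j \<in> {i..<i + d}" "k \<in> {i..<i + d}" for j k
    proof
      assume "j < k \<and> a j = a k"
      then have "P (k - j)" unfolding P_def using that d by (auto intro!: exI [of _ j])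
      moreover have "k - j < d" using that unfolding atLeastLessThan_iff by arith
      ultimately show False using min by blast
    qed
    show "j = k" using *[of j k] *[of k j] jk by (metis atLeastLessThan_upt linorder_neqE_nat)
  qed simp
  moreover have "{?xs ! j, ?xs ! (Suc j mod length ?xs)} \<in> odd_edges S m" if "j < length ?xs" for j
  proof (cases "Suc j = d")
    case True
    then have "i + d = Suc (i + j)" by simp
    then show ?thesis using edge [of "i + j"] d True that by auto
  next
    case False
    then show ?thesis using edge [of "i + j"] d that by auto
  qed
  moreover have "set ?xs \<subseteq> S"
    using edge d by (auto simp: odd_edges_iff)
  ultimately show False using forest d3 unfolding graph_forest_def
    by (metis (no_types, lifting) length_map length_upt add_diff_cancel_left')
qed

text \<open>Running round a cycle of at least three distinct vertices never backtracks, so one full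
  turn is a cycle of states.\<close>

lemma cycle_if_not_forest:
  assumes "\<not> graph_forest S (odd_edges S m)"
  shows "\<not> acyclic move"
proof -
  obtain xs where xs: "set xs \<subseteq> S" "distinct xs" "3 \<le> length xs"
    "\<And>i. i < length xs \<Longrightarrow> {xs ! i, xs ! (Suc i mod length xs)} \<in> odd_edges S m"
    using assms unfolding graph_forest_def by blast
  let ?n = "length xs"
  define c where "c j = xs ! (j mod ?n)" for j
  have n0: "0 < ?n" using xs(3) by linarith
  have c: "{c j, c (Suc j)} \<in> odd_edges S m" for j
    using xs(4) [of "j mod ?n"] n0 by (simp add: c_def mod_Suc_eq)
  have neq: "c (Suc (Suc j)) \<noteq> c j" for j
  proof -
    have "Suc (Suc j) mod ?n \<noteq> j mod ?n"
    proof
      assume "Suc (Suc j) mod ?n = j mod ?n"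
      then have "?n dvd Suc (Suc j) - j" by (metis le_add2 mod_eq_dvd_iff_nat plus_1_eq_Suc Suc_leD le_SucI order_refl)
      then have "?n dvd 2" by simp
      then show False using xs(3) dvd_imp_le [of ?n 2] by simp
    qed
    then show ?thesis unfolding c_def using xs(2) n0 by (simp add: nth_eq_iff_index_eq)
  qed
  have "((c (Suc j), c j), (c (Suc (Suc j)), c (Suc j))) \<in> move" for j
    using c [of j] c [of "Suc j"] neq [of j] odd_move_subset unfolding odd_move_def odd_edges_iff by blast
  then have "((c (Suc 0), c 0), (c (Suc ?n), c ?n)) \<in> move ^^ ?n"
    unfolding relpow_fun_conv by (intro exI [of _ "\<lambda>j. (c (Suc j), c j)"]) simp
  moreover have "c (Suc ?n) = c (Suc 0)" "c ?n = c 0"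
    using xs(3) by (simp_all add: c_def mod_Suc)
  ultimately have "((c (Suc 0), c 0), (c (Suc 0), c 0)) \<in> move\<^sup>+"
    using n0 unfolding trancl_power by auto
  then show ?thesis by (auto simp: acyclic_def)
qed

text \<open>A path is turned into moves by cancelling each step that would go back. The edge
  \<open>{t, f}\<close> is not odd, so at the start no odd step is forbidden. The last clause says
  which edge was used last; it permits the cancellation and later shows that a loop is allowed at
  the end.\<close>

lemma reduced_path:
  assumes "(t, v) \<in> odd_rel\<^sup>*" "f \<in> S" "{t, f} \<notin> odd_edges S m"
  shows "\<exists>g \<in> S. ((t, f), (v, g)) \<in> odd_move\<^sup>* \<and> ((v, g) = (t, f) \<or> {g, v} \<in> odd_edges S m)"
  using assms(1)
proof (induction rule: rtrancl_induct)
  case base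
  then show ?case using assms(2) by blast
next
  case (step v v')
  have vv': "{v, v'} \<in> odd_edges S m" using step.hyps by simp
  obtain g where g: "g \<in> S" "((t, f), (v, g)) \<in> odd_move\<^sup>*" "(v, g) = (t, f) \<or> {g, v} \<in> odd_edges S m"
    using step.IH by blast
  show ?case
  proof (cases "v' = g")
    case False
    then have "((v, g), (v', v)) \<in> odd_move" using g vv' by (auto simp: odd_move_def)
    then have "((t, f), (v', v)) \<in> odd_move\<^sup>*" using g(2) by (rule rtrancl_into_rtrancl [rotated])
    then show ?thesis using vv' by (intro bexI [of _ v]) (auto simp: odd_edges_iff)
  next
    \<comment> \<open>The step returns to \<open>g\<close>: the last move is undone instead.\<close>
    case True
    then have "(v, g) \<noteq> (t, f)" using vv' assms(3) by auto
    then obtain y where y: "((t, f), y) \<in> odd_move\<^sup>*" "(y, (v, g)) \<in> odd_move"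
      using g(2) by (metis rtranclE)
    then obtain h where h: "y = (g, h)" "h \<in> S" by (auto simp: odd_move_def)
    have "y = (t, f) \<or> {h, g} \<in> odd_edges S m"
      using y(1) unfolding h(1) by (cases rule: rtranclE) (auto simp: odd_move_def)
    then show ?thesis using y(1) h True by blast
  qed
qed

lemma loops_connected:
  assumes "{t, r} \<in> even_edges S m" "{t', r'} \<in> even_edges S m" "(t, t') \<in> odd_rel\<^sup>*" "(t, r) \<noteq> (t', r')"
  shows "((t, r), (t', r')) \<in> move\<^sup>+"
proof -
  have "r \<in> S" "{t, r} \<notin> odd_edges S m"
    using assms(1) not_odd_and_even by (auto simp: even_edges_iff)
  then obtain g where g: "g \<in> S" "((t, r), (t', g)) \<in> odd_move\<^sup>*" "(t', g) = (t, r) \<or> {g, t'} \<in> odd_edges S m"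
    using reduced_path assms(3) by blast
  have "r' \<noteq> g"
    using g(3) assms(2,4) not_odd_and_even by (auto simp: insert_commute)
  then have "((t', g), (t', r')) \<in> move" using even_moveI g assms by blast
  moreover have "((t, r), (t', g)) \<in> move\<^sup>*" using g(2) odd_move_subset rtrancl_mono by blast
  ultimately show ?thesis by (rule rtrancl_into_trancl1 [rotated])
qed

text \<open>From one loop to the other and back again. A loop is a pair of its vertex and the other
  end of the even edge, so \<open>(t, t')\<close> and \<open>(t', t)\<close> are different loops on
  one edge.\<close>

lemma not_acyclic_if_loops:
  assumes "{t, r} \<in> even_edges S m" "{t', r'} \<in> even_edges S m" "(t, t') \<in> odd_rel\<^sup>*" "(t, r) \<noteq> (t', r')"
  shows "\<not> acyclic move"
proof -
  have "((t, r), (t, r)) \<in> move\<^sup>+"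
    using loops_connected [OF assms] loops_connected [OF assms(2,1) odd_rel_rtrancl_sym [OF assms(3)]] assms(4)
    by (metis trancl_trans)
  then show ?thesis by (auto simp: acyclic_def)
qed

text \<open>A cycle of moves is thus either entirely odd or can be started just after an even
  move.\<close>

lemma last_even_move:
  assumes "(x, y) \<in> move\<^sup>+"
  shows "(x, y) \<in> odd_move\<^sup>+ \<or>
    (\<exists>v u. {v, u} \<in> even_edges S m \<and> (x, (v, u)) \<in> move\<^sup>+ \<and> ((v, u), y) \<in> move\<^sup>*)"
  using assms
proof (induction rule: trancl_induct)
  case (base y)
  then show ?case
  proof (cases rule: move_cases)
    case (2 v f u)
    with base show ?thesis by blast
  qed blast
next
  case (step y z)
  from step.hyps(2) show ?case
  proof (cases rule: move_cases)
    case 1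
    then show ?thesis using step.IH step.hyps(2)
      by (meson rtrancl.rtrancl_into_rtrancl trancl.trancl_into_trancl)
  next
    case (2 v f u)
    then show ?thesis using step.hyps by (meson rtrancl.rtrancl_refl trancl.trancl_into_trancl)
  qed
qed

lemma acyclic_move_iff:
  "acyclic move \<longleftrightarrow> graph_forest S (odd_edges S m) \<and>
    (\<forall>C \<in> graph_components S (odd_edges S m).
       (\<exists>\<^sub>\<le>\<^sub>1 e. e \<in> even_edges S m \<and> (\<exists>t r. e = {t, r} \<and> t \<in> C \<and> r \<notin> C)) \<and>
       \<not> (\<exists>t t'. {t, t'} \<in> even_edges S m \<and> t \<in> C \<and> t' \<in> C))" (is "_ \<longleftrightarrow> ?F \<and> (\<forall>C \<in> ?G. ?U C \<and> ?I C)")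
proof (intro iffI conjI ballI)
  assume ac: "acyclic move"
  then show ?F using cycle_if_not_forest by blast
  fix C assume "C \<in> ?G"
  then have C: "(t, t') \<in> odd_rel\<^sup>*" if "t \<in> C" "t' \<in> C" for t t'
    using that odd_rel_rtrancl_sym unfolding graph_components_def by (auto intro: rtrancl_trans)
  show "?U C"
  proof (rule Uniq_I)
    fix e e'
    assume "e \<in> even_edges S m \<and> (\<exists>t r. e = {t, r} \<and> t \<in> C \<and> r \<notin> C)"
      and "e' \<in> even_edges S m \<and> (\<exists>t r. e' = {t, r} \<and> t \<in> C \<and> r \<notin> C)"
    then obtain t r t' r' where e: "e = {t, r}" "t \<in> C" "{t, r} \<in> even_edges S m"
        "e' = {t', r'}" "t' \<in> C" "{t', r'} \<in> even_edges S m" by blast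
    then have "(t, r) = (t', r')" using not_acyclic_if_loops [of t r t' r'] ac C by blast
    then show "e = e'" using e by simp
  qed
  show "?I C"
  proof
    assume "\<exists>t t'. {t, t'} \<in> even_edges S m \<and> t \<in> C \<and> t' \<in> C"
    then obtain t t' where t: "{t, t'} \<in> even_edges S m" "t \<in> C" "t' \<in> C" by blast
    then have "t \<noteq> t'" by (auto simp: even_edges_iff)
    then show False using not_acyclic_if_loops [of t t' t' t] t C ac by (auto simp: insert_commute)
  qed
next
  assume cond: "?F \<and> (\<forall>C \<in> ?G. ?U C \<and> ?I C)"
  note no_return = forest_no_return [OF conjunct1 [OF cond]]
  have loop: False if vu: "{v, u} \<in> even_edges S m" and "((v, u), (v, u)) \<in> move\<^sup>+" for v u
  proof -
    define C where "C = {t \<in> S. (v, t) \<in> odd_rel\<^sup>*}"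
    have v: "v \<in> S" "u \<in> S" using vu by (auto simp: even_edges_iff)
    then have "C \<in> ?G" by (auto simp: C_def graph_components_def)
    then have U: "?U C" and I: "?I C" using cond by blast+
    have vC: "v \<in> C" using v by (simp add: C_def)
    have uC: "u \<notin> C" using I vu vC by blast
    \<comment> \<open>After the loop \<open>{v, u}\<close> no further even move is possible: by the
      uniqueness clause it would use \<open>{v, u}\<close> at \<open>v\<close> again, and as
      \<open>u\<close> is forbidden in the state \<open>(v, u)\<close>, the walk must have returned
      to \<open>v\<close> by odd moves, against the forest.\<close>
    have odd: "(x, y) \<in> odd_move" if x: "((v, u), x) \<in> odd_move\<^sup>*" and xy: "(x, y) \<in> move" for x y
      using xy
    proof (cases rule: move_cases)
      case (2 v' f u')
      have "v' \<in> C"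
        using odd_move_rtrancl_fst [OF x] 2 by (auto simp: C_def even_edges_iff)
      moreover from this have "u' \<notin> C" using I 2 by blast
      ultimately have "{v', u'} = {v, u}"
        using U vC uC vu 2(3) unfolding Uniq_def by blast
      then have eq: "v' = v" "u' = u" using \<open>v' \<in> C\<close> uC vC \<open>u' \<notin> C\<close> by (auto simp: doubleton_eq_iff)
      then have "(v, u) \<noteq> x" using 2 by auto
      then have "((v, u), x) \<in> odd_move\<^sup>+" using x by (metis rtranclD)
      then show ?thesis using no_return 2 eq by fastforce
    qed
    have "((v, u), y) \<in> odd_move\<^sup>+" if "((v, u), y) \<in> move\<^sup>+" for y
      using that
      by (induction rule: trancl_induct) (auto intro: odd trancl_into_rtrancl trancl.trancl_into_trancl)
    then show False using no_return that(2) by blast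
  qed
  show "acyclic move"
    unfolding acyclic_def
  proof (intro allI notI)
    fix x assume "(x, x) \<in> move\<^sup>+"
    then consider "(x, x) \<in> odd_move\<^sup>+"
      | v u where "{v, u} \<in> even_edges S m" "(x, (v, u)) \<in> move\<^sup>+" "((v, u), x) \<in> move\<^sup>*"
      using last_even_move by blast
    then show False
    proof cases
      case 1
      then show ?thesis using no_return by blast
    next
      case (2 v u)
      from rtrancl_trancl_trancl [OF 2(3,2)] 2(1) show ?thesis using loop by blast
    qed
  qed
qed

end


section \<open>Operators with infinitely many eigenvectors\<close>

definition ket :: "'g \<Rightarrow> 'g \<Rightarrow> complex"
  where "ket w = (\<lambda>v. if v = w then 1 else 0)"

lemma ket_simps [simp]: "ket w w = 1" "v \<noteq> w \<Longrightarrow> ket w v = 0"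
  by (auto simp: ket_def)

lemma finite_support_in_ell2:
  assumes "finite Y" "Y \<subseteq> X" "\<And>w. w \<notin> Y \<Longrightarrow> \<xi> w = 0"
  shows "\<xi> \<in> ell2 X"
proof -
  have "finite {w \<in> X. (cmod (\<xi> w))\<^sup>2 \<noteq> 0}"
    by (rule finite_subset [OF _ assms(1)]) (use assms in auto)
  then show ?thesis
    unfolding ell2_def using assms by (auto intro: finite_nonzero_values_imp_summable_on)
qed

lemma ket_in_ell2 [simp]: "w \<in> X \<Longrightarrow> ket w \<in> ell2 X"
  by (rule finite_support_in_ell2 [of "{w}"]) auto

lemma scaled_ket_in_ell2: "w \<in> X \<Longrightarrow> (\<lambda>v. c * ket w v) \<in> ell2 X"
  by (rule finite_support_in_ell2 [of "{w}"]) auto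

lemma ell2_summable:
  assumes "\<xi> \<in> ell2 X"
  shows "(\<lambda>w. (cmod (\<xi> w))\<^sup>2) summable_on UNIV"
proof -
  have "(\<lambda>w. (cmod (\<xi> w))\<^sup>2) summable_on X" using assms by (simp add: ell2_def)
  then show ?thesis
    by (rule summable_on_cong_neutral [THEN iffD1, rotated -1]) (use assms in \<open>auto simp: ell2_def\<close>)
qed

lemma ell2_diff:
  assumes "\<xi> \<in> ell2 X" "\<eta> \<in> ell2 X"
  shows "(\<lambda>w. \<xi> w - \<eta> w) \<in> ell2 X"
proof -
  have "(\<lambda>w. 2 * (cmod (\<xi> w))\<^sup>2 + 2 * (cmod (\<eta> w))\<^sup>2) summable_on X"
    using assms by (intro summable_on_add summable_on_cmult_right) (auto simp: ell2_def)
  moreover have "(cmod (\<xi> w - \<eta> w))\<^sup>2 \<le> 2 * (cmod (\<xi> w))\<^sup>2 + 2 * (cmod (\<eta> w))\<^sup>2" for w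
  proof -
    have "(cmod (\<xi> w - \<eta> w))\<^sup>2 \<le> (cmod (\<xi> w) + cmod (\<eta> w))\<^sup>2"
      by (intro power_mono norm_triangle_ineq4) simp
    also have "\<dots> \<le> 2 * (cmod (\<xi> w))\<^sup>2 + 2 * (cmod (\<eta> w))\<^sup>2"
      using sum_squares_bound [of "cmod (\<xi> w)" "cmod (\<eta> w)"] by (simp add: power2_sum)
    finally show ?thesis .
  qed
  ultimately have "(\<lambda>w. (cmod (\<xi> w - \<eta> w))\<^sup>2) summable_on X"
    by (rule summable_on_comparison_test) auto
  then show ?thesis using assms by (auto simp: ell2_def)
qed

lemma cmod_le_ell2_norm:
  assumes "\<xi> \<in> ell2 X"
  shows "cmod (\<xi> v) \<le> ell2_norm \<xi>"
proof -
  have "(\<Sum>w\<in>{v}. (cmod (\<xi> w))\<^sup>2) \<le> (\<Sum>\<^sub>\<infinity>w. (cmod (\<xi> w))\<^sup>2)"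
    by (rule finite_sum_le_infsum [OF ell2_summable [OF assms]]) auto
  then show ?thesis unfolding ell2_norm_def by (auto intro: real_le_rsqrt)
qed

lemma ell2_norm_finite:
  assumes "finite Y" "\<And>w. w \<notin> Y \<Longrightarrow> \<xi> w = 0"
  shows "ell2_norm \<xi> = sqrt (\<Sum>w\<in>Y. (cmod (\<xi> w))\<^sup>2)"
proof -
  have "(\<Sum>\<^sub>\<infinity>w. (cmod (\<xi> w))\<^sup>2) = (\<Sum>\<^sub>\<infinity>w\<in>Y. (cmod (\<xi> w))\<^sup>2)"
    using assms by (intro infsum_cong_neutral) auto
  then show ?thesis using assms(1) by (simp add: ell2_norm_def)
qed

lemma ell2_inner_finite:
  assumes "finite Y" "\<And>w. w \<notin> Y \<Longrightarrow> \<xi> w = 0 \<or> \<eta> w = 0"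
  shows "ell2_inner \<xi> \<eta> = (\<Sum>w\<in>Y. \<xi> w * cnj (\<eta> w))"
proof -
  have "(\<Sum>\<^sub>\<infinity>w. \<xi> w * cnj (\<eta> w)) = (\<Sum>\<^sub>\<infinity>w\<in>Y. \<xi> w * cnj (\<eta> w))"
    using assms by (intro infsum_cong_neutral) auto
  then show ?thesis using assms(1) by (simp add: ell2_inner_def)
qed

lemma ell2_inner_ket: "ell2_inner \<xi> (ket w) = \<xi> w"
  by (subst ell2_inner_finite [of "{w}"]) auto

lemma ell2_inner_cnj: "ell2_inner \<eta> \<xi> = cnj (ell2_inner \<xi> \<eta>)"
  by (simp add: ell2_inner_def flip: infsum_cnj) (simp add: mult.commute)

text \<open>Finitely many linear conditions on infinitely many coordinates. Splitting
  \<open>Z\<close> into two infinite halves yields two solutions with disjoint supports, and a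
  combination of them meets one more condition.\<close>

lemma exists_orthogonal_on_infinite_set:
  fixes F :: "('g \<Rightarrow> complex) set"
  assumes "finite F" "infinite Z"
  shows "\<exists>\<xi> Y. finite Y \<and> Y \<subseteq> Z \<and> (\<forall>w. w \<notin> Y \<longrightarrow> \<xi> w = 0) \<and> \<xi> \<noteq> (\<lambda>w. 0) \<and>
    (\<forall>b\<in>F. (\<Sum>w\<in>Y. \<xi> w * cnj (b w)) = 0)"
  using assms
proof (induction F arbitrary: Z)
  case empty
  then obtain z where "z \<in> Z" by fastforce
  then show ?case by (intro exI [of _ "ket z"] exI [of _ "{z}"]) (auto simp: fun_eq_iff intro!: exI [of _ z])
next
  case (insert b F)
  obtain f :: "nat \<Rightarrow> 'g" where f: "inj f" "range f \<subseteq> Z"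
    using infinite_countable_subset insert.prems by blast
  let ?Z1 = "range (\<lambda>n. f (2 * n))" and ?Z2 = "range (\<lambda>n. f (2 * n + 1))"
  have inf: "infinite ?Z1" "infinite ?Z2"
    using injD [OF f(1)] by (auto intro!: range_inj_infinite injI dest!: injD [OF f(1)])
  obtain \<xi>1 Y1 where 1: "finite Y1" "Y1 \<subseteq> ?Z1" "\<And>w. w \<notin> Y1 \<Longrightarrow> \<xi>1 w = 0" "\<xi>1 \<noteq> (\<lambda>w. 0)"
    "\<And>c. c \<in> F \<Longrightarrow> (\<Sum>w\<in>Y1. \<xi>1 w * cnj (c w)) = 0"
    using insert.IH [OF inf(1)] by blast
  obtain \<xi>2 Y2 where 2: "finite Y2" "Y2 \<subseteq> ?Z2" "\<And>w. w \<notin> Y2 \<Longrightarrow> \<xi>2 w = 0" "\<xi>2 \<noteq> (\<lambda>w. 0)"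
    "\<And>c. c \<in> F \<Longrightarrow> (\<Sum>w\<in>Y2. \<xi>2 w * cnj (c w)) = 0"
    using insert.IH [OF inf(2)] by blast
  have disj: "Y1 \<inter> Y2 = {}" 
  proof -
    have "f (2 * i) \<noteq> f (2 * j + 1)" for i j
      by (rule notI, drule injD [OF f(1)], presburger)
    then show ?thesis using 1(2) 2(2) by fast
  qed
  define a1 a2 where "a1 = (\<Sum>w\<in>Y1. \<xi>1 w * cnj (b w))" and "a2 = (\<Sum>w\<in>Y2. \<xi>2 w * cnj (b w))"
  \<comment> \<open>If \<open>a1 = 0\<close>, then \<open>\<xi>1\<close> is already orthogonal to
    \<open>b\<close>. Otherwise \<open>a2 \<xi>1 - a1 \<xi>2\<close> is, and it does not vanish on
    the support of \<open>\<xi>2\<close>.\<close>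
  define c1 c2 where "c1 = (if a1 = 0 then 1 else a2)" and "c2 = (if a1 = 0 then 0 else - a1)"
  let ?\<xi> = "\<lambda>w. c1 * \<xi>1 w + c2 * \<xi>2 w" and ?Y = "Y1 \<union> Y2"
  have sum: "(\<Sum>w\<in>?Y. ?\<xi> w * cnj (c w)) = c1 * (\<Sum>w\<in>Y1. \<xi>1 w * cnj (c w)) + c2 * (\<Sum>w\<in>Y2. \<xi>2 w * cnj (c w))" for c
  proof -
    have "(\<Sum>w\<in>Y1. ?\<xi> w * cnj (c w)) = (\<Sum>w\<in>Y1. c1 * (\<xi>1 w * cnj (c w)))"
      using disj 2(3) by (intro sum.cong) (auto simp: algebra_simps)
    moreover have "(\<Sum>w\<in>Y2. ?\<xi> w * cnj (c w)) = (\<Sum>w\<in>Y2. c2 * (\<xi>2 w * cnj (c w)))"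
      using disj 1(3) by (intro sum.cong) (auto simp: algebra_simps)
    ultimately show ?thesis
      by (simp add: sum.union_disjoint [OF 1(1) 2(1) disj] sum_distrib_left)
  qed
  have "?\<xi> \<noteq> (\<lambda>w. 0)"
  proof (cases "a1 = 0")
    case True
    then show ?thesis using 1(4) by (simp add: c1_def c2_def)
  next
    case False
    obtain w where w: "\<xi>2 w \<noteq> 0" using 2(4) by auto
    then have "\<xi>1 w = 0" using 1(3) 2(3) disj by blast
    then have "?\<xi> w \<noteq> 0" using False w by (simp add: c2_def)
    then show ?thesis by (rule contrapos_nn) (rule fun_cong)
  qed
  moreover have "c1 * a1 + c2 * a2 = 0" by (simp add: c1_def c2_def)
  then have "(\<Sum>w\<in>?Y. ?\<xi> w * cnj (c w)) = 0" if "c \<in> insert b F" for c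
    unfolding sum using that 1(5) 2(5) by (auto simp: a1_def a2_def)
  moreover have "?Y \<subseteq> Z" using 1(2) 2(2) f(2) by blast
  moreover have "?\<xi> w = 0" if "w \<notin> ?Y" for w using that 1(3) 2(3) by simp
  ultimately show ?case
    using 1(1) 2(1) by (intro exI [of _ ?\<xi>] exI [of _ ?Y]) (intro conjI finite_UnI allI impI ballI)
qed

lemma finite_superlevel_if_summable:
  fixes f :: "'b \<Rightarrow> real"
  assumes "f summable_on B" "\<And>b. b \<in> B \<Longrightarrow> 0 \<le> f b" "0 < c"
  shows "finite {b \<in> B. f b = c}"
proof (rule ccontr)
  assume inf: "infinite {b \<in> B. f b = c}"
  obtain n :: nat where n: "infsum f B / c < real n" using reals_Archimedean2 by blast
  obtain A where A: "A \<subseteq> {b \<in> B. f b = c}" "finite A" "card A = n"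
    using infinite_arbitrarily_large [OF inf] by blast
  have "sum f A = (\<Sum>b\<in>A. c)" using A(1) by (intro sum.cong) auto
  moreover have "sum f A \<le> infsum f B"
    using A assms by (intro finite_sum_le_infsum) auto
  ultimately show False using n A(3) assms(3) by (simp add: field_simps)
qed

text \<open>The images of distinct unit vectors \<open>ket (f n)\<close> have norm 2 but tend to
  zero at every point, so a norm limit would be zero and of norm 2 at once.\<close>

lemma not_compact_if_infinite_eigen:
  assumes inf: "infinite Z" and Z: "Z \<subseteq> X"
    and T: "\<And>w. w \<in> Z \<Longrightarrow> T (ket w) = (\<lambda>v. c w * ket w v)" and c: "\<And>w. w \<in> Z \<Longrightarrow> cmod (c w) = 2"
  shows "\<not> compact_op X T"
proof
  assume cpt: "compact_op X T"
  obtain f :: "nat \<Rightarrow> 'a" where f: "inj f" "range f \<subseteq> Z"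
    using infinite_countable_subset inf by blast
  have fZ: "f n \<in> Z" for n using f by auto
  then have fX: "f n \<in> X" for n using Z by blast
  have bd: "\<forall>n. ket (f n) \<in> ell2 X \<and> ell2_norm (ket (f n)) \<le> 1"
  proof
    fix n
    have "ell2_norm (ket (f n)) = 1" by (subst ell2_norm_finite [of "{f n}"]) auto
    then show "ket (f n) \<in> ell2 X \<and> ell2_norm (ket (f n)) \<le> 1" using fX by simp
  qed
  have "\<exists>r \<eta>. strict_mono r \<and> \<eta> \<in> ell2 X \<and> (\<lambda>n. ell2_norm (\<lambda>w. T (ket (f (r n))) w - \<eta> w)) \<longlonglongrightarrow> 0"
    using spec [OF conjunct2 [OF cpt [unfolded compact_op_def]], of "\<lambda>n. ket (f n)"] bd by (rule mp)
  then obtain r \<eta> where r: "strict_mono r" "\<eta> \<in> ell2 X"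
    and lim: "(\<lambda>n. ell2_norm (\<lambda>w. T (ket (f (r n))) w - \<eta> w)) \<longlonglongrightarrow> 0"
    by blast
  have Tf: "T (ket (f n)) \<in> ell2 X" for n
    unfolding T [OF fZ] using fX by (rule scaled_ket_in_ell2)
  have "\<eta> v = 0" for v
  proof -
    have "(\<lambda>n. cmod (T (ket (f (r n))) v - \<eta> v)) \<longlonglongrightarrow> 0"
      by (rule tendsto_sandwich [OF _ _ tendsto_const lim])
        (auto intro!: always_eventually cmod_le_ell2_norm [OF ell2_diff [OF Tf r(2)]])
    moreover have "eventually (\<lambda>n. f (r n) \<noteq> v) sequentially"
    proof -
      have "inj (f \<circ> r)"
        by (rule inj_compose [OF f(1) strict_mono_imp_inj_on [OF r(1)]])
      then have "finite ((f \<circ> r) -` {v})" by (intro finite_vimageI) auto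
      then show ?thesis
        by (simp add: cofinite_eq_sequentially [symmetric] eventually_cofinite vimage_def)
    qed
    then have "eventually (\<lambda>n. cmod (T (ket (f (r n))) v - \<eta> v) = cmod (\<eta> v)) sequentially"
      unfolding T [OF fZ] by eventually_elim simp
    ultimately have "(\<lambda>n::nat. cmod (\<eta> v)) \<longlonglongrightarrow> 0"
      by (rule Lim_transform_eventually)
    then show ?thesis by (simp add: LIMSEQ_const_iff)
  qed
  then have \<eta>: "\<eta> = (\<lambda>v. 0)" by (rule ext)
  have "ell2_norm (T (ket (f n))) = 2" for n
    unfolding T [OF fZ] using c [OF fZ] by (subst ell2_norm_finite [of "{f n}"]) auto
  then show False using lim unfolding \<eta> by (simp add: LIMSEQ_const_iff)
qed

text \<open>
  For \<open>p < \<infinity>\<close> the identity \<open>P\<^sup>2 (ket w) = 4 ket w\<close> forces \<open>\<sigma> b = 2\<close> for all basis vectors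
  \<open>b\<close> with \<open>b w \<noteq> 0\<close>.  There are only finitely many such \<open>b\<close>, so that some nonzero vector
  supported on \<open>Z\<close> is orthogonal to the whole basis.
\<close>

lemma not_schatten_if_infinite_eigen:
  assumes inf: "infinite Z" and Z: "Z \<subseteq> X"
    and T: "\<And>w. w \<in> Z \<Longrightarrow> T (ket w) = (\<lambda>v. c w * ket w v)" and c: "\<And>w. w \<in> Z \<Longrightarrow> cmod (c w) = 2"
    and T': "\<And>w v. w \<in> Z \<Longrightarrow> v \<in> X \<Longrightarrow> v \<noteq> w \<Longrightarrow> T (ket v) w = 0"
  shows "T \<notin> schatten_class X p"
proof
  assume "T \<in> schatten_class X p"
  then obtain P B \<sigma> where P: "is_abs_op X T P" and B: "orthonormal_basis X B"
    and \<sigma>: "\<And>b. b \<in> B \<Longrightarrow> 0 \<le> \<sigma> b" "\<And>b. b \<in> B \<Longrightarrow> P b = (\<lambda>w. complex_of_real (\<sigma> b) * b w)"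
    and sum: "(\<lambda>b. \<sigma> b powr real_of_ereal p) summable_on B"
    using not_compact_if_infinite_eigen [OF inf Z T c] unfolding schatten_class_def
    by (auto split: if_splits)
  have PP: "ell2_inner (P (P \<xi>)) \<eta> = ell2_inner (T \<xi>) (T \<eta>)"
    if "\<xi> \<in> ell2 X" "\<eta> \<in> ell2 X" for \<xi> \<eta> using P that unfolding is_abs_op_def by auto
  have BX: "b \<in> ell2 X" if "b \<in> B" for b using B that unfolding orthonormal_basis_def by blast
  \<comment> \<open>The value at \<open>v\<close> is the inner product of \<open>T (ket w)\<close>
    with \<open>T (ket v)\<close>, and \<open>T'\<close> makes it vanish for
    \<open>v \<noteq> w\<close>; this takes the place of computing with the adjoint.\<close>
  have PPw: "P (P (ket w)) = (\<lambda>v. 4 * ket w v)" if w: "w \<in> Z" for w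
  proof
    fix v
    have wX: "w \<in> X" using w Z by blast
    have "P (P (ket w)) \<in> ell2 X"
      using P wX unfolding is_abs_op_def bounded_op_def by (meson ket_in_ell2)
    then have 0: "P (P (ket w)) v = 0" if "v \<notin> X" using that by (simp add: ell2_def)
    have 1: "P (P (ket w)) v = c w * cnj (T (ket v) w)" if "v \<in> X"
    proof -
      have "P (P (ket w)) v = ell2_inner (T (ket w)) (T (ket v))"
        using PP [of "ket w" "ket v"] that wX by (simp add: ell2_inner_ket)
      also have "\<dots> = c w * cnj (T (ket v) w)"
        unfolding T [OF w] by (subst ell2_inner_finite [of "{w}"]) auto
      finally show ?thesis .
    qed
    have 2: "c w * cnj (c w) = 4"
      using c [OF w] by (simp add: complex_norm_square [symmetric])
    show "P (P (ket w)) v = 4 * ket w v"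
    proof (cases "v \<in> X")
      case True
      then show ?thesis using 1 2 T [OF w] T' [OF w True] by (cases "v = w") auto
    next
      case False
      then show ?thesis using 0 wX by (cases "v = w") auto
    qed
  qed
  have eigen: "\<sigma> b = 2" if b: "b \<in> B" and w: "w \<in> Z" "b w \<noteq> 0" for b w
  proof -
    have wX: "w \<in> X" using w Z by blast
    have "P (P b) = P (\<lambda>v. complex_of_real (\<sigma> b) * b v)" using \<sigma>(2) [OF b] by simp
    also have "\<dots> = (\<lambda>v. complex_of_real (\<sigma> b) * P b v)"
      using P BX [OF b] unfolding is_abs_op_def bounded_op_def by blast
    finally have "ell2_inner (P (P b)) (ket w) = complex_of_real (\<sigma> b) * (complex_of_real (\<sigma> b) * b w)"
      using \<sigma>(2) [OF b] by (simp add: ell2_inner_ket)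
    moreover have "ell2_inner (P (P b)) (ket w) = cnj (ell2_inner (P (P (ket w))) b)"
      using PP [of b "ket w"] PP [of "ket w" b] wX BX [OF b] ell2_inner_cnj by simp
    moreover have "ell2_inner (P (P (ket w))) b = 4 * cnj (b w)"
      unfolding PPw [OF w(1)] by (subst ell2_inner_finite [of "{w}"]) auto
    ultimately have "complex_of_real (\<sigma> b * \<sigma> b) = complex_of_real 4"
      using w(2) by simp
    then have "\<sigma> b * \<sigma> b = 4" by (simp only: of_real_eq_iff)
    then have "(\<sigma> b)\<^sup>2 = 2\<^sup>2" by (simp add: power2_eq_square)
    then show ?thesis by (rule power2_eq_imp_eq) (use \<sigma>(1) [OF b] in auto)
  qed
  have "finite {b \<in> B. \<sigma> b powr real_of_ereal p = 2 powr real_of_ereal p}"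
    by (rule finite_superlevel_if_summable [OF sum]) auto
  then have fin: "finite {b \<in> B. \<sigma> b = 2}" by (rule rev_finite_subset) auto
  obtain \<xi> Y where Y: "finite Y" "Y \<subseteq> Z" "\<And>w. w \<notin> Y \<Longrightarrow> \<xi> w = 0" "\<xi> \<noteq> (\<lambda>w. 0)"
    "\<And>b. b \<in> {b \<in> B. \<sigma> b = 2} \<Longrightarrow> (\<Sum>w\<in>Y. \<xi> w * cnj (b w)) = 0"
    using exists_orthogonal_on_infinite_set [OF fin inf] by blast
  have "ell2_inner \<xi> b = 0" if b: "b \<in> B" for b
  proof -
    have "ell2_inner \<xi> b = (\<Sum>w\<in>Y. \<xi> w * cnj (b w))"
      using Y by (intro ell2_inner_finite) auto
    also have "\<dots> = 0"
    proof (cases "\<sigma> b = 2")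
      case False
      then have "b w = 0" if "w \<in> Y" for w using eigen [OF b] that Y(2) by blast
      then show ?thesis by simp
    qed (use Y(5) b in simp)
    finally show ?thesis .
  qed
  moreover have "\<xi> \<in> ell2 X" using finite_support_in_ell2 [of Y X \<xi>] Y Z by auto
  ultimately show False using B Y(4) unfolding orthonormal_basis_def by blast
qed


section \<open>Operators with a finite kernel\<close>

definition kernel_op :: "'g set \<Rightarrow> ('g \<Rightarrow> 'g \<Rightarrow> complex) \<Rightarrow> ('g \<Rightarrow> complex) \<Rightarrow> 'g \<Rightarrow> complex"
  where "kernel_op Y K \<xi> = (\<lambda>w. \<Sum>y\<in>Y. K w y * \<xi> y)"

lemma kernel_op_add: "kernel_op Y K (\<lambda>w. \<xi> w + \<eta> w) = (\<lambda>w. kernel_op Y K \<xi> w + kernel_op Y K \<eta> w)"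
  by (simp add: kernel_op_def distrib_left sum.distrib)

lemma kernel_op_scale: "kernel_op Y K (\<lambda>w. c * \<xi> w) = (\<lambda>w. c * kernel_op Y K \<xi> w)"
  by (simp add: kernel_op_def sum_distrib_left algebra_simps)

lemma kernel_op_cong: "(\<And>y. y \<in> Y \<Longrightarrow> \<xi> y = \<eta> y) \<Longrightarrow> kernel_op Y K \<xi> = kernel_op Y K \<eta>"
  by (simp add: kernel_op_def cong: sum.cong)

lemma kernel_op_in_ell2:
  assumes "finite Y" "Y \<subseteq> X" "\<And>w y. w \<notin> Y \<Longrightarrow> K w y = 0"
  shows "kernel_op Y K \<xi> \<in> ell2 X"
  by (rule finite_support_in_ell2 [OF assms(1,2)]) (simp add: kernel_op_def assms(3))

lemma kernel_op_bounded:
  assumes "finite Y" "Y \<subseteq> X" "\<And>w y. w \<notin> Y \<Longrightarrow> K w y = 0"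
  shows "bounded_op X (kernel_op Y K)"
  unfolding bounded_op_def
proof (intro conjI ballI allI)
  show "\<exists>C. \<forall>\<xi>\<in>ell2 X. ell2_norm (kernel_op Y K \<xi>) \<le> C * ell2_norm \<xi>"
  proof (intro exI ballI)
    fix \<xi> assume \<xi>: "\<xi> \<in> ell2 X"
    have "ell2_norm (kernel_op Y K \<xi>) = L2_set (\<lambda>w. cmod (kernel_op Y K \<xi> w)) Y"
      unfolding L2_set_def using assms by (intro ell2_norm_finite) (auto simp: kernel_op_def)
    also have "\<dots> \<le> (\<Sum>w\<in>Y. cmod (kernel_op Y K \<xi> w))"
      by (rule L2_set_le_sum) simp
    also have "\<dots> \<le> (\<Sum>w\<in>Y. \<Sum>y\<in>Y. cmod (K w y) * ell2_norm \<xi>)"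
      unfolding kernel_op_def
      by (intro sum_mono order_trans [OF norm_sum]) (simp add: norm_mult mult_left_mono cmod_le_ell2_norm [OF \<xi>])
    also have "\<dots> = (\<Sum>w\<in>Y. \<Sum>y\<in>Y. cmod (K w y)) * ell2_norm \<xi>"
      by (simp add: sum_distrib_right)
    finally show "ell2_norm (kernel_op Y K \<xi>) \<le> (\<Sum>w\<in>Y. \<Sum>y\<in>Y. cmod (K w y)) * ell2_norm \<xi>" .
  qed
qed (simp_all add: kernel_op_in_ell2 [of Y X K, OF assms] kernel_op_add kernel_op_scale)

lemma convergent_subsequence_finite:
  fixes \<xi> :: "nat \<Rightarrow> 'g \<Rightarrow> complex"
  assumes "finite Y" "\<And>y. y \<in> Y \<Longrightarrow> bounded (range (\<lambda>n. \<xi> n y))"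
  shows "\<exists>r l. strict_mono (r :: nat \<Rightarrow> nat) \<and> (\<forall>y\<in>Y. (\<lambda>n. \<xi> (r n) y) \<longlonglongrightarrow> l y)"
  using assms
proof (induction Y)
  case empty
  show ?case by (intro exI [of _ "\<lambda>n. n"]) (simp add: strict_mono_def)
next
  case (insert a Y)
  have "\<exists>r l. strict_mono (r :: nat \<Rightarrow> nat) \<and> (\<forall>y\<in>Y. (\<lambda>n. \<xi> (r n) y) \<longlonglongrightarrow> l y)"
    by (rule insert.IH) (simp add: insert.prems)
  then obtain r l where r: "strict_mono (r :: nat \<Rightarrow> nat)" "\<And>y. y \<in> Y \<Longrightarrow> (\<lambda>n. \<xi> (r n) y) \<longlonglongrightarrow> l y"
    by blast
  have "bounded (range (\<lambda>n. \<xi> (r n) a))"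
    by (rule bounded_subset [OF insert.prems [of a]]) auto
  then obtain c r' where r': "strict_mono (r' :: nat \<Rightarrow> nat)" "((\<lambda>n. \<xi> (r n) a) \<circ> r') \<longlonglongrightarrow> c"
    using bounded_imp_convergent_subsequence by blast
  have lim: "(\<lambda>n. \<xi> ((r \<circ> r') n) y) \<longlonglongrightarrow> (if y = a then c else l y)" if "y \<in> insert a Y" for y
    using that r' LIMSEQ_subseq_LIMSEQ [OF r(2) r'(1), of y] by (auto simp: comp_def)
  show ?case
    by (intro exI conjI ballI) (rule strict_mono_o [OF r(1) r'(1)], erule lim)
qed

text \<open>Only the coordinates in \<open>Y\<close> enter the operator, so their convergence along
  a subsequence gives convergence of the images in norm.\<close>

lemma kernel_op_compact:
  assumes "finite Y" "Y \<subseteq> X" "\<And>w y. w \<notin> Y \<Longrightarrow> K w y = 0"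
  shows "compact_op X (kernel_op Y K)"
  unfolding compact_op_def
proof (intro conjI allI impI kernel_op_bounded [OF assms])
  fix \<xi> :: "nat \<Rightarrow> 'a \<Rightarrow> complex"
  assume \<xi>: "\<forall>n. \<xi> n \<in> ell2 X \<and> ell2_norm (\<xi> n) \<le> 1"
  have "cmod (\<xi> n y) \<le> 1" for n y
    using \<xi> cmod_le_ell2_norm [of "\<xi> n" X y] by (meson order_trans)
  then have "bounded (range (\<lambda>n. \<xi> n y))" for y
    by (auto simp: bounded_iff)
  then obtain r l where r: "strict_mono (r :: nat \<Rightarrow> nat)" "\<And>y. y \<in> Y \<Longrightarrow> (\<lambda>n. \<xi> (r n) y) \<longlonglongrightarrow> l y"
    using convergent_subsequence_finite [OF assms(1)] by blast
  let ?\<eta> = "kernel_op Y K l"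
  have lim: "(\<lambda>n. kernel_op Y K (\<xi> (r n)) w) \<longlonglongrightarrow> ?\<eta> w" for w
    unfolding kernel_op_def by (intro tendsto_intros r(2))
  have "(\<lambda>n. sqrt (\<Sum>w\<in>Y. (cmod (kernel_op Y K (\<xi> (r n)) w - ?\<eta> w))\<^sup>2)) \<longlonglongrightarrow> sqrt (\<Sum>w\<in>Y. (cmod (?\<eta> w - ?\<eta> w))\<^sup>2)"
    by (intro tendsto_intros lim)
  moreover have "ell2_norm (\<lambda>w. kernel_op Y K (\<xi> (r n)) w - ?\<eta> w) =
      sqrt (\<Sum>w\<in>Y. (cmod (kernel_op Y K (\<xi> (r n)) w - ?\<eta> w))\<^sup>2)" for n
    using assms by (intro ell2_norm_finite) (auto simp: kernel_op_def)
  ultimately have "(\<lambda>n. ell2_norm (\<lambda>w. kernel_op Y K (\<xi> (r n)) w - ?\<eta> w)) \<longlonglongrightarrow> 0"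
    by simp
  then show "\<exists>r \<eta>. strict_mono r \<and> \<eta> \<in> ell2 X \<and>
      (\<lambda>n. ell2_norm (\<lambda>w. kernel_op Y K (\<xi> (r n)) w - \<eta> w)) \<longlonglongrightarrow> 0"
    using r(1) kernel_op_in_ell2 [of Y X K l, OF assms] by blast
qed

section \<open>Singular value decomposition in finitely many coordinates\<close>

definition fin_inner :: "'g set \<Rightarrow> ('g \<Rightarrow> complex) \<Rightarrow> ('g \<Rightarrow> complex) \<Rightarrow> complex"
  where "fin_inner Y \<xi> \<eta> = (\<Sum>w\<in>Y. \<xi> w * cnj (\<eta> w))"

definition fin_norm2 :: "'g set \<Rightarrow> ('g \<Rightarrow> complex) \<Rightarrow> real"
  where "fin_norm2 Y \<xi> = (\<Sum>w\<in>Y. (cmod (\<xi> w))\<^sup>2)"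

lemma fin_inner_self: "fin_inner Y \<xi> \<xi> = complex_of_real (fin_norm2 Y \<xi>)"
  by (simp add: fin_inner_def fin_norm2_def complex_norm_square del: of_real_power)

lemma fin_inner_cnj: "fin_inner Y \<eta> \<xi> = cnj (fin_inner Y \<xi> \<eta>)"
  by (simp add: fin_inner_def mult.commute)

lemma fin_inner_zero_commute: "fin_inner Y \<eta> \<xi> = 0 \<longleftrightarrow> fin_inner Y \<xi> \<eta> = 0"
  by (simp add: fin_inner_cnj [of Y \<eta> \<xi>])

lemma fin_inner_add_left: "fin_inner Y (\<lambda>w. \<xi> w + \<eta> w) \<zeta> = fin_inner Y \<xi> \<zeta> + fin_inner Y \<eta> \<zeta>"
  by (simp add: fin_inner_def distrib_right sum.distrib)

lemma fin_inner_diff_left: "fin_inner Y (\<lambda>w. \<xi> w - \<eta> w) \<zeta> = fin_inner Y \<xi> \<zeta> - fin_inner Y \<eta> \<zeta>"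
  by (simp add: fin_inner_def left_diff_distrib sum_subtractf)

lemma fin_inner_scale_left: "fin_inner Y (\<lambda>w. c * \<xi> w) \<zeta> = c * fin_inner Y \<xi> \<zeta>"
  by (simp add: fin_inner_def sum_distrib_left mult.assoc)

lemma fin_inner_scale_right: "fin_inner Y \<zeta> (\<lambda>w. c * \<xi> w) = cnj c * fin_inner Y \<zeta> \<xi>"
  by (simp add: fin_inner_def sum_distrib_left mult_ac)

lemma fin_inner_sum_left:
  "fin_inner Y (\<lambda>w. \<Sum>f\<in>F. a f * h f w) \<zeta> = (\<Sum>f\<in>F. a f * fin_inner Y (h f) \<zeta>)"
  unfolding fin_inner_def sum_distrib_right sum_distrib_left
  by (subst sum.swap) (simp add: mult.assoc)

lemma fin_inner_sum_right:
  "fin_inner Y \<zeta> (\<lambda>w. \<Sum>f\<in>F. a f * h f w) = (\<Sum>f\<in>F. cnj (a f) * fin_inner Y \<zeta> (h f))"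
  by (subst fin_inner_cnj) (simp add: fin_inner_sum_left fin_inner_cnj [of Y \<zeta>])

lemma fin_inner_cong:
  "(\<And>w. w \<in> Y \<Longrightarrow> \<xi> w = \<xi>' w) \<Longrightarrow> fin_inner Y \<xi> \<eta> = fin_inner Y \<xi>' \<eta>"
  by (simp add: fin_inner_def cong: sum.cong)

lemma fin_norm2_nonneg [simp]: "0 \<le> fin_norm2 Y \<xi>"
  by (simp add: fin_norm2_def sum_nonneg)

lemma fin_norm2_scale: "fin_norm2 Y (\<lambda>w. c * \<xi> w) = (cmod c)\<^sup>2 * fin_norm2 Y \<xi>"
  by (simp add: fin_norm2_def norm_mult power_mult_distrib sum_distrib_left)

lemma fin_norm2_add:
  "fin_norm2 Y (\<lambda>w. \<xi> w + \<eta> w) = fin_norm2 Y \<xi> + 2 * Re (fin_inner Y \<xi> \<eta>) + fin_norm2 Y \<eta>"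
proof -
  have "(cmod (a + b))\<^sup>2 = (cmod a)\<^sup>2 + 2 * Re (a * cnj b) + (cmod b)\<^sup>2" for a b
    by (simp add: cmod_power2) (simp add: power2_eq_square algebra_simps)
  then show ?thesis
    by (simp add: fin_norm2_def fin_inner_def sum.distrib sum_distrib_left)
qed

lemma fin_norm2_eq_0: "finite Y \<Longrightarrow> fin_norm2 Y \<xi> = 0 \<longleftrightarrow> (\<forall>w\<in>Y. \<xi> w = 0)"
  by (simp add: fin_norm2_def sum_nonneg_eq_0_iff)

lemma cmod_le_fin_norm2: "finite Y \<Longrightarrow> w \<in> Y \<Longrightarrow> (cmod (\<xi> w))\<^sup>2 \<le> fin_norm2 Y \<xi>"
  unfolding fin_norm2_def by (rule member_le_sum) auto

definition fin_sphere :: "'g set \<Rightarrow> ('g \<Rightarrow> complex) set \<Rightarrow> ('g \<Rightarrow> complex) set"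
  where "fin_sphere Y F = {\<xi>. (\<forall>w. w \<notin> Y \<longrightarrow> \<xi> w = 0) \<and> (\<forall>f\<in>F. fin_inner Y \<xi> f = 0) \<and> fin_norm2 Y \<xi> = 1}"

text \<open>Compactness of a unit sphere in finitely many coordinates: a maximising sequence has a
  subsequence that converges at every coordinate, and the finite sums involved are
  continuous.\<close>

lemma kernel_op_attains_max:
  assumes fin: "finite Y" and ne: "fin_sphere Y F \<noteq> {}"
  shows "\<exists>\<xi>0 \<in> fin_sphere Y F. \<forall>\<xi> \<in> fin_sphere Y F.
    fin_norm2 Y (kernel_op Y K \<xi>) \<le> fin_norm2 Y (kernel_op Y K \<xi>0)"
proof -
  let ?D = "fin_sphere Y F" and ?q = "\<lambda>\<xi>. fin_norm2 Y (kernel_op Y K \<xi>)"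
  have le1: "cmod (\<xi> w) \<le> 1" if "\<xi> \<in> ?D" for \<xi> w
  proof (cases "w \<in> Y")
    case True
    then have "(cmod (\<xi> w))\<^sup>2 \<le> 1\<^sup>2"
      using cmod_le_fin_norm2 [OF fin True, of \<xi>] that by (simp add: fin_sphere_def)
    then show ?thesis by (rule power2_le_imp_le) simp
  qed (use that in \<open>simp add: fin_sphere_def\<close>)
  have "?q \<xi> \<le> (\<Sum>w\<in>Y. (\<Sum>y\<in>Y. cmod (K w y))\<^sup>2)" if "\<xi> \<in> ?D" for \<xi>
    unfolding fin_norm2_def kernel_op_def
    by (intro sum_mono power_mono order_trans [OF norm_sum])
       (auto simp: norm_mult intro!: mult_left_le le1 [OF that])
  then have bdd: "bdd_above (?q ` ?D)" by (auto simp: bdd_above_def)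
  define s where "s = Sup (?q ` ?D)"
  have "\<exists>\<xi>\<in>?D. s - 1 / real (Suc n) < ?q \<xi>" for n
  proof -
    have "s - 1 / real (Suc n) < Sup (?q ` ?D)" by (simp add: s_def)
    then show ?thesis using ne bdd by (subst (asm) less_cSup_iff) auto
  qed
  then obtain \<xi> where \<xi>: "\<And>n. \<xi> n \<in> ?D" "\<And>n. s - 1 / real (Suc n) < ?q (\<xi> n)" by metis
  have "bounded (range (\<lambda>n. \<xi> n y))" for y
    unfolding bounded_iff using le1 [OF \<xi>(1)] by blast
  then obtain r l where r: "strict_mono (r :: nat \<Rightarrow> nat)" "\<And>y. y \<in> Y \<Longrightarrow> (\<lambda>n. \<xi> (r n) y) \<longlonglongrightarrow> l y"
    using convergent_subsequence_finite [OF fin] by blast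
  \<comment> \<open>The limits \<open>l\<close> are determined only on \<open>Y\<close>, so zero is
    prescribed elsewhere.\<close>
  define \<xi>0 where "\<xi>0 w = (if w \<in> Y then l w else 0)" for w
  have lim: "(\<lambda>n. \<xi> (r n) y) \<longlonglongrightarrow> \<xi>0 y" for y
    using r(2) \<xi>(1) by (cases "y \<in> Y") (auto simp: \<xi>0_def fin_sphere_def)
  have "\<xi>0 \<in> ?D"
  proof -
    have "(\<lambda>n. fin_inner Y (\<xi> (r n)) f) \<longlonglongrightarrow> fin_inner Y \<xi>0 f" for f
      unfolding fin_inner_def by (intro tendsto_intros lim)
    note lim_inner = this
    have zero: "fin_inner Y (\<xi> n) f = 0" if "f \<in> F" for f n
      using \<xi>(1) [of n] that by (simp add: fin_sphere_def)
    have orth: "fin_inner Y \<xi>0 f = 0" if "f \<in> F" for f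
      using lim_inner [of f] unfolding zero [OF that] LIMSEQ_const_iff by (rule HOL.sym)
    have "(\<lambda>n. fin_norm2 Y (\<xi> (r n))) \<longlonglongrightarrow> fin_norm2 Y \<xi>0"
      unfolding fin_norm2_def by (intro tendsto_intros lim)
    moreover have "fin_norm2 Y (\<xi> n) = 1" for n
      using \<xi>(1) [of n] by (simp add: fin_sphere_def)
    ultimately have "fin_norm2 Y \<xi>0 = 1"
      by (simp add: LIMSEQ_const_iff)
    then show ?thesis using orth by (auto simp: fin_sphere_def \<xi>0_def)
  qed
  moreover have "?q \<eta> \<le> ?q \<xi>0" if \<eta>: "\<eta> \<in> ?D" for \<eta>
  proof -
    have "?q \<eta> \<le> s" unfolding s_def using \<eta> bdd by (rule cSUP_upper)
    also have "s \<le> ?q \<xi>0"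
    proof (rule LIMSEQ_le)
      show "(\<lambda>n. ?q (\<xi> (r n))) \<longlonglongrightarrow> ?q \<xi>0"
        unfolding fin_norm2_def kernel_op_def by (intro tendsto_intros lim)
      have "(\<lambda>n. s - 1 / real (Suc n)) \<longlonglongrightarrow> s - 0"
        by (intro tendsto_intros LIMSEQ_inverse_real_of_nat [unfolded inverse_eq_divide])
      from LIMSEQ_subseq_LIMSEQ [OF this r(1)]
      show "(\<lambda>n. s - 1 / real (Suc (r n))) \<longlonglongrightarrow> s" by (simp add: comp_def)
      show "\<exists>N. \<forall>n\<ge>N. s - 1 / real (Suc (r n)) \<le> ?q (\<xi> (r n))"
        using \<xi>(2) less_imp_le by blast
    qed
    finally show ?thesis .
  qed
  ultimately show ?thesis by blast
qed

text \<open>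
  The last clause is what makes an incomplete system extensible: a unit vector \<open>\<xi>\<close> orthogonal to
  \<open>F\<close> that maximises the norm of its image can be added to \<open>F\<close>.
\<close>

definition partial_svd :: "'g set \<Rightarrow> ('g \<Rightarrow> 'g \<Rightarrow> complex) \<Rightarrow> ('g \<Rightarrow> complex) set \<Rightarrow> bool"
  where "partial_svd Y K F \<longleftrightarrow> finite F \<and>
    (\<forall>f\<in>F. \<forall>w. w \<notin> Y \<longrightarrow> f w = 0) \<and>
    (\<forall>f\<in>F. \<forall>g\<in>F. fin_inner Y f g = (if f = g then 1 else 0)) \<and>
    (\<forall>f\<in>F. \<forall>g\<in>F. f \<noteq> g \<longrightarrow> fin_inner Y (kernel_op Y K f) (kernel_op Y K g) = 0) \<and>
    (\<forall>f\<in>F. \<forall>\<eta>. (\<forall>w. w \<notin> Y \<longrightarrow> \<eta> w = 0) \<longrightarrow> (\<forall>g\<in>F. fin_inner Y \<eta> g = 0) \<longrightarrow>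
      fin_inner Y (kernel_op Y K f) (kernel_op Y K \<eta>) = 0)"

lemma maximizer_image_orthogonal:
  assumes fin: "finite Y" and \<xi>0: "\<xi>0 \<in> fin_sphere Y F"
    and max: "\<And>\<xi>. \<xi> \<in> fin_sphere Y F \<Longrightarrow> fin_norm2 Y (kernel_op Y K \<xi>) \<le> fin_norm2 Y (kernel_op Y K \<xi>0)"
    and \<eta>: "\<And>w. w \<notin> Y \<Longrightarrow> \<eta> w = 0" "\<And>g. g \<in> F \<Longrightarrow> fin_inner Y \<eta> g = 0" "fin_inner Y \<eta> \<xi>0 = 0"
  shows "fin_inner Y (kernel_op Y K \<xi>0) (kernel_op Y K \<eta>) = 0"
proof (rule ccontr)
  let ?T = "kernel_op Y K"
  define mu where "mu = fin_norm2 Y (?T \<xi>0)"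
  \<comment> \<open>Homogeneity extends the maximum on the sphere to all vectors orthogonal to
    \<open>F\<close>.\<close>
  have bound: "fin_norm2 Y (?T \<zeta>) \<le> mu * fin_norm2 Y \<zeta>"
    if \<zeta>: "\<And>w. w \<notin> Y \<Longrightarrow> \<zeta> w = 0" "\<And>g. g \<in> F \<Longrightarrow> fin_inner Y \<zeta> g = 0" for \<zeta>
  proof (cases "fin_norm2 Y \<zeta> = 0")
    case True
    then have "?T \<zeta> = (\<lambda>w. 0)" using fin by (simp add: fin_norm2_eq_0 kernel_op_def)
    then show ?thesis using True by (simp add: fin_norm2_def)
  next
    case False
    then have pos: "fin_norm2 Y \<zeta> > 0" using fin_norm2_nonneg [of Y \<zeta>] by linarith
    define c where "c = complex_of_real (1 / sqrt (fin_norm2 Y \<zeta>))"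
    have c: "(cmod c)\<^sup>2 = 1 / fin_norm2 Y \<zeta>"
      using pos by (simp add: c_def norm_divide power_divide)
    have "(\<lambda>w. c * \<zeta> w) \<in> fin_sphere Y F"
      using \<zeta> pos c by (simp add: fin_sphere_def fin_norm2_scale fin_inner_scale_left)
    then have "fin_norm2 Y (?T \<zeta>) / fin_norm2 Y \<zeta> \<le> mu"
      using max [of "\<lambda>w. c * \<zeta> w"] c by (simp add: kernel_op_scale fin_norm2_scale mu_def)
    then show ?thesis using pos by (simp add: field_simps)
  qed
  define z where "z = fin_inner Y (?T \<xi>0) (?T \<eta>)"
  assume "fin_inner Y (?T \<xi>0) (?T \<eta>) \<noteq> 0"
  then have z: "(cmod z)\<^sup>2 > 0" by (simp add: z_def)
  define M where "M = mu * fin_norm2 Y \<eta>"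
  have M: "0 \<le> M" by (simp add: M_def mu_def)
  \<comment> \<open>The maximiser is perturbed to \<open>\<xi>0 + c \<eta>\<close> with
    \<open>c = e z\<close>. The factor \<open>z\<close> makes the first-order gain
    \<open>2 * e * |z|^2\<close> real and positive, whereas \<open>bound\<close> allows a gain of at
    most \<open>e^2 * |z|^2 * M\<close>, which is smaller as \<open>e * M < 1\<close>.\<close>
  define e where "e = 1 / (M + 1)"
  have e: "0 < e" "e * M < 1" using M by (auto simp: e_def)
  define c where "c = complex_of_real e * z"
  have cz: "(cmod c)\<^sup>2 = e * e * (cmod z)\<^sup>2"
    using e by (simp add: c_def norm_mult power_mult_distrib power2_eq_square)
  have "cnj c * z = complex_of_real (e * (cmod z)\<^sup>2)"
    by (simp add: c_def complex_norm_square mult_ac del: of_real_power)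
  then have Re: "Re (cnj c * z) = e * (cmod z)\<^sup>2" by (simp only: Re_complex_of_real)
  let ?\<zeta> = "\<lambda>w. \<xi>0 w + c * \<eta> w"
  have "fin_norm2 Y (?T ?\<zeta>) \<le> mu * fin_norm2 Y ?\<zeta>"
    using \<xi>0 \<eta> by (intro bound) (auto simp: fin_sphere_def fin_inner_add_left fin_inner_scale_left)
  moreover have "fin_norm2 Y ?\<zeta> = 1 + (cmod c)\<^sup>2 * fin_norm2 Y \<eta>"
    using \<xi>0 \<eta>(3) fin_inner_zero_commute [of Y \<eta> \<xi>0]
    by (simp add: fin_norm2_add fin_norm2_scale fin_inner_scale_right fin_sphere_def)
  moreover have "fin_norm2 Y (?T ?\<zeta>) = mu + 2 * Re (cnj c * z) + (cmod c)\<^sup>2 * fin_norm2 Y (?T \<eta>)"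
    unfolding kernel_op_add kernel_op_scale fin_norm2_add fin_norm2_scale fin_inner_scale_right
    by (simp add: z_def mu_def)
  ultimately have "mu + 2 * (e * (cmod z)\<^sup>2) + (cmod c)\<^sup>2 * fin_norm2 Y (?T \<eta>) \<le> mu + (cmod c)\<^sup>2 * M"
    unfolding Re by (simp add: M_def algebra_simps)
  moreover have "0 \<le> (cmod c)\<^sup>2 * fin_norm2 Y (?T \<eta>)" by simp
  ultimately have "2 * (e * (cmod z)\<^sup>2) \<le> (cmod c)\<^sup>2 * M" by linarith
  then have "(e * (cmod z)\<^sup>2) * 2 \<le> (e * (cmod z)\<^sup>2) * (e * M)"
    unfolding cz by (simp add: algebra_simps)
  then have "2 \<le> e * M" using e z by simp
  then show False using e by simp
qed

lemma partial_svd_extend: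
  assumes fin: "finite Y" and F: "partial_svd Y K F" and ne: "fin_sphere Y F \<noteq> {}"
  shows "\<exists>\<xi>. \<xi> \<notin> F \<and> partial_svd Y K (insert \<xi> F)"
proof -
  obtain \<xi>0 where \<xi>0: "\<xi>0 \<in> fin_sphere Y F"
    and max: "\<And>\<xi>. \<xi> \<in> fin_sphere Y F \<Longrightarrow> fin_norm2 Y (kernel_op Y K \<xi>) \<le> fin_norm2 Y (kernel_op Y K \<xi>0)"
    using kernel_op_attains_max [OF fin ne] by blast
  have s: "\<And>w. w \<notin> Y \<Longrightarrow> \<xi>0 w = 0" "\<And>f. f \<in> F \<Longrightarrow> fin_inner Y \<xi>0 f = 0" "fin_inner Y \<xi>0 \<xi>0 = 1"
    using \<xi>0 by (auto simp: fin_sphere_def fin_inner_self)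
  have s': "fin_inner Y f \<xi>0 = 0" if "f \<in> F" for f
    using s(2) [OF that] fin_inner_zero_commute by blast
  have nin: "\<xi>0 \<notin> F" using s(2,3) by force
  have T: "fin_inner Y (kernel_op Y K f) (kernel_op Y K \<xi>0) = 0" if "f \<in> F" for f
    using F that s unfolding partial_svd_def by blast
  then have T': "fin_inner Y (kernel_op Y K \<xi>0) (kernel_op Y K f) = 0" if "f \<in> F" for f
    using that fin_inner_zero_commute by blast
  have "partial_svd Y K (insert \<xi>0 F)"
    unfolding partial_svd_def
  proof (intro conjI ballI allI impI)
    fix f g assume "f \<in> insert \<xi>0 F" "g \<in> insert \<xi>0 F"
    then show "fin_inner Y f g = (if f = g then 1 else 0)"
      using s s' nin F unfolding partial_svd_def by auto
  next
    fix f \<eta>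
    assume f: "f \<in> insert \<xi>0 F" and \<eta>: "\<forall>w. w \<notin> Y \<longrightarrow> \<eta> w = 0" "\<forall>g\<in>insert \<xi>0 F. fin_inner Y \<eta> g = 0"
    show "fin_inner Y (kernel_op Y K f) (kernel_op Y K \<eta>) = 0"
    proof (cases "f = \<xi>0")
      case True
      then show ?thesis using maximizer_image_orthogonal [OF fin \<xi>0 max] \<eta> by blast
    next
      case False
      then show ?thesis using F f \<eta> unfolding partial_svd_def by blast
    qed
  qed (use F s(1) T T' in \<open>auto simp: partial_svd_def\<close>)
  with nin show ?thesis by blast
qed

text \<open>Bessel's inequality for each \<open>ket v\<close>, summed over
  \<open>v \<in> Y\<close>.\<close>

lemma orthonormal_card_le:
  assumes fin: "finite Y" and F: "finite F"
    and on: "\<And>f g. f \<in> F \<Longrightarrow> g \<in> F \<Longrightarrow> fin_inner Y f g = (if f = g then 1 else 0)"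
  shows "card F \<le> card Y"
proof -
  have bessel: "(\<Sum>f\<in>F. (cmod (f v))\<^sup>2) \<le> 1" if v: "v \<in> Y" for v
  proof -
    \<comment> \<open>Minus the projection of \<open>ket v\<close> onto the span of
      \<open>F\<close>, so that \<open>ket v + s\<close> is the residual, whose squared norm is
      nonnegative.\<close>
    define s where "s w = (\<Sum>f\<in>F. - cnj (f v) * f w)" for w
    have "fin_inner Y f (ket v) = f v" for f
      using v fin by (simp add: fin_inner_def ket_def if_distrib cong: if_cong)
    then have ket: "fin_inner Y (ket v) f = cnj (f v)" for f
      by (subst fin_inner_cnj) simp
    have 1: "fin_norm2 Y (ket v) = 1"
      using ket [of "ket v"] by (simp add: fin_inner_self)
    have 2: "fin_inner Y (ket v) s = - complex_of_real (\<Sum>f\<in>F. (cmod (f v))\<^sup>2)"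
      unfolding s_def fin_inner_sum_right ket by (simp add: complex_norm_square sum_negf del: of_real_power)
    have "fin_inner Y s s = (\<Sum>f\<in>F. - cnj (f v) * (\<Sum>g\<in>F. cnj (- cnj (g v)) * fin_inner Y f g))"
      unfolding s_def fin_inner_sum_left fin_inner_sum_right ..
    also have "\<dots> = (\<Sum>f\<in>F. cnj (f v) * f v)"
      using F by (intro sum.cong) (simp_all add: on if_distrib cong: if_cong)
    also have "\<dots> = complex_of_real (\<Sum>f\<in>F. (cmod (f v))\<^sup>2)"
      by (simp add: complex_norm_square mult.commute del: of_real_power)
    finally have 3: "fin_norm2 Y s = (\<Sum>f\<in>F. (cmod (f v))\<^sup>2)"
      unfolding fin_inner_self of_real_eq_iff .
    have "0 \<le> fin_norm2 Y (\<lambda>w. ket v w + s w)" by simp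
    also have "\<dots> = 1 - (\<Sum>f\<in>F. (cmod (f v))\<^sup>2)"
      unfolding fin_norm2_add 1 2 3 by simp
    finally show ?thesis by simp
  qed
  have "fin_norm2 Y f = 1" if "f \<in> F" for f
    using on [OF that that] by (simp add: fin_inner_self)
  then have "real (card F) = (\<Sum>f\<in>F. fin_norm2 Y f)" by simp
  also have "\<dots> = (\<Sum>v\<in>Y. \<Sum>f\<in>F. (cmod (f v))\<^sup>2)"
    unfolding fin_norm2_def by (rule sum.swap)
  also have "\<dots> \<le> (\<Sum>v\<in>Y. 1)" by (intro sum_mono bessel)
  finally show ?thesis by simp
qed

text \<open>A system of greatest size exists because the sizes are at most \<open>card Y\<close>,
  and it is complete because a nonzero vector orthogonal to it could be normalised, making an
  extension possible.\<close>

lemma svd_exists: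
  assumes fin: "finite Y"
  obtains F where "partial_svd Y K F"
    "\<And>\<xi>. (\<And>w. w \<notin> Y \<Longrightarrow> \<xi> w = 0) \<Longrightarrow> (\<And>f. f \<in> F \<Longrightarrow> fin_inner Y \<xi> f = 0) \<Longrightarrow> \<xi> = (\<lambda>w. 0)"
proof -
  have "partial_svd Y K {}" by (simp add: partial_svd_def)
  moreover have "\<forall>F. partial_svd Y K F \<longrightarrow> card F < Suc (card Y)"
    using orthonormal_card_le [OF fin] unfolding partial_svd_def by (meson le_imp_less_Suc)
  ultimately obtain F where F: "partial_svd Y K F" and max: "\<And>F'. partial_svd Y K F' \<Longrightarrow> card F' \<le> card F"
    using ex_has_greatest_nat [of "partial_svd Y K" "{}" card] by blast
  have "\<xi> = (\<lambda>w. 0)" if \<xi>: "\<And>w. w \<notin> Y \<Longrightarrow> \<xi> w = 0" "\<And>f. f \<in> F \<Longrightarrow> fin_inner Y \<xi> f = 0" for \<xi>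
  proof (rule ccontr)
    assume "\<xi> \<noteq> (\<lambda>w. 0)"
    then have "fin_norm2 Y \<xi> \<noteq> 0" using \<xi>(1) fin by (auto simp: fin_norm2_eq_0 fun_eq_iff)
    then have pos: "fin_norm2 Y \<xi> > 0" using fin_norm2_nonneg [of Y \<xi>] by linarith
    define c where "c = complex_of_real (1 / sqrt (fin_norm2 Y \<xi>))"
    have "(cmod c)\<^sup>2 = 1 / fin_norm2 Y \<xi>"
      using pos by (simp add: c_def norm_divide power_divide)
    then have "(\<lambda>w. c * \<xi> w) \<in> fin_sphere Y F"
      using \<xi> pos by (simp add: fin_sphere_def fin_norm2_scale fin_inner_scale_left)
    then obtain \<eta> where "\<eta> \<notin> F" "partial_svd Y K (insert \<eta> F)"
      using partial_svd_extend [OF fin F] by blast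
    then show False using max [of "insert \<eta> F"] F by (simp add: partial_svd_def)
  qed
  with F show ?thesis using that by blast
qed

text \<open>With the right singular vectors \<open>F\<close> and the norms \<open>\<sigma>\<close>
  of their images, \<open>P\<close> is the diagonal operator with eigenvalues
  \<open>\<sigma>\<close> on \<open>F\<close>. Expanding both arguments in \<open>F\<close> gives
  \<open>P\<^sup>2 = T\<^sup>* T\<close>, since the images of different singular vectors are
  orthogonal.\<close>

lemma kernel_op_schatten:
  fixes K :: "'g \<Rightarrow> 'g \<Rightarrow> complex"
  assumes fin: "finite Y" and YX: "Y \<subseteq> X" and K: "\<And>w y. w \<notin> Y \<Longrightarrow> K w y = 0"
  shows "kernel_op Y K \<in> schatten_class X p"
proof (cases "p = \<infinity>")
  case True
  then show ?thesis using kernel_op_compact [OF assms] by (simp add: schatten_class_def)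
next
  case False
  let ?T = "kernel_op Y K"
  obtain F where F: "partial_svd Y K F"
    and complete: "\<And>\<xi>. (\<And>w. w \<notin> Y \<Longrightarrow> \<xi> w = 0) \<Longrightarrow> (\<And>f. f \<in> F \<Longrightarrow> fin_inner Y \<xi> f = 0) \<Longrightarrow> \<xi> = (\<lambda>w. 0)"
    using svd_exists [OF fin] by blast
  have finF: "finite F" and supp: "\<And>f w. f \<in> F \<Longrightarrow> w \<notin> Y \<Longrightarrow> f w = 0"
    and on: "\<And>f g. f \<in> F \<Longrightarrow> g \<in> F \<Longrightarrow> fin_inner Y f g = (if f = g then 1 else 0)"
    and orth: "\<And>f g. f \<in> F \<Longrightarrow> g \<in> F \<Longrightarrow> f \<noteq> g \<Longrightarrow> fin_inner Y (?T f) (?T g) = 0"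
    using F unfolding partial_svd_def by auto
  \<comment> \<open>The basis is completed by the vectors \<open>ket v\<close> with \<open>v\<close>
    outside \<open>Y\<close>, which have eigenvalue 0. As \<open>0 powr x = 0\<close>, they
    contribute nothing to the sum.\<close>
  define \<sigma> where "\<sigma> f = (if f \<in> F then sqrt (fin_norm2 Y (?T f)) else 0)" for f
  define L where "L w y = (\<Sum>f\<in>F. complex_of_real (\<sigma> f) * cnj (f y) * f w)" for w y
  define B where "B = F \<union> ket ` (X - Y)"
  let ?P = "kernel_op Y L"
  have \<sigma>0: "0 \<le> \<sigma> f" for f by (simp add: \<sigma>_def)
  have TT: "fin_inner Y (?T f) (?T g) = (if f = g then complex_of_real (\<sigma> f * \<sigma> f) else 0)"
    if "f \<in> F" "g \<in> F" for f g
    using that orth by (auto simp: fin_inner_self \<sigma>_def)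
  have L: "L w y = 0" if "w \<notin> Y" for w y
    unfolding L_def using that supp by (intro sum.neutral) simp
  have P: "?P \<xi> = (\<lambda>w. \<Sum>f\<in>F. (complex_of_real (\<sigma> f) * fin_inner Y \<xi> f) * f w)" for \<xi>
    unfolding kernel_op_def L_def fin_inner_def sum_distrib_left sum_distrib_right
    by (subst sum.swap) (simp add: mult_ac)
  have inner_left: "ell2_inner \<xi> \<eta> = fin_inner Y \<xi> \<eta>" if "\<And>w. w \<notin> Y \<Longrightarrow> \<xi> w = 0" for \<xi> \<eta>
    unfolding fin_inner_def using fin that by (intro ell2_inner_finite) auto
  have inner_right: "ell2_inner \<eta> \<xi> = fin_inner Y \<eta> \<xi>" if "\<And>w. w \<notin> Y \<Longrightarrow> \<xi> w = 0" for \<xi> \<eta>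
    unfolding fin_inner_def using fin that by (intro ell2_inner_finite) auto
  have P_supp: "?P \<xi> w = 0" if "w \<notin> Y" for \<xi> w
    unfolding P using that supp by (intro sum.neutral) simp
  have inner_P: "ell2_inner (?P \<xi>) \<eta> = fin_inner Y (?P \<xi>) \<eta>" for \<xi> \<eta>
    by (rule inner_left) (rule P_supp)
  have T_supp: "?T \<xi> w = 0" if "w \<notin> Y" for \<xi> w using that K by (simp add: kernel_op_def)
  have P_coeff: "fin_inner Y (?P \<xi>) g = complex_of_real (\<sigma> g) * fin_inner Y \<xi> g" if "g \<in> F" for \<xi> g
    unfolding P fin_inner_sum_left using that finF by (simp add: on if_distrib cong: if_cong)
  have expand: "\<xi> w = (\<Sum>f\<in>F. fin_inner Y \<xi> f * f w)" if "w \<in> Y" for \<xi> w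
  proof -
    let ?d = "\<lambda>w. (if w \<in> Y then \<xi> w else 0) - (\<Sum>f\<in>F. fin_inner Y \<xi> f * f w)"
    have "?d = (\<lambda>w. 0)"
    proof (rule complete)
      fix g assume g: "g \<in> F"
      have "fin_inner Y (\<lambda>w. if w \<in> Y then \<xi> w else 0) g = fin_inner Y \<xi> g"
        by (rule fin_inner_cong) simp
      then show "fin_inner Y ?d g = 0"
        unfolding fin_inner_diff_left fin_inner_sum_left using g finF
        by (simp add: on if_distrib cong: if_cong)
    qed (simp add: supp)
    from fun_cong [OF this, of w] show ?thesis using that by simp
  qed
  have T_expand: "?T \<xi> = (\<lambda>w. \<Sum>f\<in>F. fin_inner Y \<xi> f * ?T f w)" for \<xi>
  proof -
    have "?T \<xi> = ?T (\<lambda>w. \<Sum>f\<in>F. fin_inner Y \<xi> f * f w)"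
      by (rule kernel_op_cong) (rule expand)
    also have "\<dots> = (\<lambda>w. \<Sum>f\<in>F. fin_inner Y \<xi> f * ?T f w)"
      unfolding kernel_op_def sum_distrib_left
      by (subst sum.swap) (simp add: mult_ac)
    finally show ?thesis .
  qed
  have abs_op: "is_abs_op X ?T ?P"
    unfolding is_abs_op_def
  proof (intro conjI ballI)
    show "bounded_op X ?P" by (rule kernel_op_bounded [OF fin YX L])
    fix \<xi>
    have "ell2_inner (?P \<xi>) \<xi> = (\<Sum>f\<in>F. (complex_of_real (\<sigma> f) * fin_inner Y \<xi> f) * cnj (fin_inner Y \<xi> f))"
      unfolding inner_P unfolding P fin_inner_sum_left
      by (simp add: fin_inner_cnj [of Y _ \<xi>])
    also have "\<dots> = complex_of_real (\<Sum>f\<in>F. \<sigma> f * (cmod (fin_inner Y \<xi> f))\<^sup>2)"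
      by (simp add: complex_norm_square mult.assoc del: of_real_power)
    finally have *: "ell2_inner (?P \<xi>) \<xi> = complex_of_real (\<Sum>f\<in>F. \<sigma> f * (cmod (fin_inner Y \<xi> f))\<^sup>2)" .
    show "ell2_inner (?P \<xi>) \<xi> \<in> \<real>" unfolding * by simp
    show "0 \<le> Re (ell2_inner (?P \<xi>) \<xi>)" unfolding * Re_complex_of_real
      by (intro sum_nonneg mult_nonneg_nonneg \<sigma>0) simp
    fix \<eta>
    have "ell2_inner (?P (?P \<xi>)) \<eta> =
        (\<Sum>f\<in>F. (complex_of_real (\<sigma> f) * (complex_of_real (\<sigma> f) * fin_inner Y \<xi> f)) * fin_inner Y f \<eta>)"
      unfolding inner_P unfolding P [of "?P \<xi>"] fin_inner_sum_left
      by (intro sum.cong) (simp_all add: P_coeff)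
    also have "\<dots> = (\<Sum>f\<in>F. fin_inner Y \<xi> f * (cnj (fin_inner Y \<eta> f) * complex_of_real (\<sigma> f * \<sigma> f)))"
      by (simp add: fin_inner_cnj [of Y _ \<eta>] mult_ac)
    also have "\<dots> = (\<Sum>f\<in>F. fin_inner Y \<xi> f * (\<Sum>g\<in>F. cnj (fin_inner Y \<eta> g) * fin_inner Y (?T f) (?T g)))"
      using finF by (intro sum.cong) (simp_all add: TT if_distrib cong: if_cong)
    also have "\<dots> = fin_inner Y (?T \<xi>) (?T \<eta>)"
      by (subst T_expand [of \<xi>], subst T_expand [of \<eta>]) (simp add: fin_inner_sum_left fin_inner_sum_right)
    also have "\<dots> = ell2_inner (?T \<xi>) (?T \<eta>)"
      by (rule inner_left [symmetric]) (rule T_supp)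
    finally show "ell2_inner (?P (?P \<xi>)) \<eta> = ell2_inner (?T \<xi>) (?T \<eta>)" .
  qed
  have ket_F: "fin_inner Y (ket v) f = 0" if "v \<notin> Y" for v f
    unfolding fin_inner_def using that by (intro sum.neutral) (auto simp: ket_def)
  have ket_notin: "ket v \<notin> F" if "v \<notin> Y" for v
    using supp [of "ket v" v] that by auto
  have basis: "orthonormal_basis X B"
    unfolding orthonormal_basis_def
  proof (intro conjI ballI impI)
    show "B \<subseteq> ell2 X"
      using finite_support_in_ell2 [OF fin YX] supp by (auto simp: B_def)
    fix b c assume "b \<in> B" "c \<in> B"
    moreover have "ell2_inner f (ket v) = 0 \<and> ell2_inner (ket v) f = 0 \<and> f \<noteq> ket v" if "f \<in> F" "v \<notin> Y" for f v
      using that supp ket_F inner_right [of f "ket v"] ket_notin by (auto simp: ell2_inner_ket)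
    moreover have "ell2_inner f g = (if f = g then 1 else 0)" if "f \<in> F" "g \<in> F" for f g
      using that on inner_left [of f g] supp by simp
    moreover have "ell2_inner (ket v) (ket u) = (if ket v = ket u then 1 else 0)" for u v :: 'g
      by (simp add: ell2_inner_ket) (metis ket_simps)
    ultimately show "ell2_inner b c = (if b = c then 1 else 0)"
      unfolding B_def by fastforce
  next
    fix \<xi> assume \<xi>: "\<xi> \<in> ell2 X" "\<forall>b\<in>B. ell2_inner \<xi> b = 0"
    have out: "\<xi> w = 0" if "w \<notin> Y" for w
      using \<xi> that ell2_inner_ket [of \<xi> w] by (cases "w \<in> X") (auto simp: B_def ell2_def)
    show "\<xi> = (\<lambda>w. 0)"
      by (rule complete) (use \<xi>(2) out inner_left [of \<xi>] in \<open>auto simp: B_def\<close>)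
  qed
  have eigen: "?P b = (\<lambda>w. complex_of_real (\<sigma> b) * b w)" if b: "b \<in> B" for b
  proof (cases "b \<in> F")
    case True
    then show ?thesis unfolding P using finF
      by (intro ext) (simp add: on if_distrib [of "\<lambda>x. _ * x"] if_distrib [of "\<lambda>x. x * _"] cong: if_cong)
  next
    case False
    then obtain v where "b = ket v" "v \<notin> Y" using b by (auto simp: B_def)
    then show ?thesis using False unfolding P by (simp add: ket_F \<sigma>_def)
  qed
  have "(\<lambda>b. \<sigma> b powr real_of_ereal p) summable_on B"
    by (rule finite_nonzero_values_imp_summable_on)
       (rule finite_subset [OF _ finF], auto simp: \<sigma>_def split: if_splits)
  then have "\<exists>P B \<sigma>. is_abs_op X ?T P \<and> orthonormal_basis X B \<and>
      (\<forall>b\<in>B. 0 \<le> \<sigma> b \<and> P b = (\<lambda>w. complex_of_real (\<sigma> b) * b w)) \<and>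
      (\<lambda>b. \<sigma> b powr real_of_ereal p) summable_on B"
    using abs_op basis eigen \<sigma>0 by (intro exI [of _ ?P] exI [of _ B] exI [of _ \<sigma>]) blast
  then show ?thesis
    unfolding schatten_class_def using False kernel_op_bounded [of Y X K, OF assms] by simp
qed


section \<open>The gradient form\<close>

text \<open>Index sets independent of \<open>w\<close> and of the supports allow the four terms of
  the gradient form to be written over the same triples.\<close>

lemma convolution_finite:
  assumes fin: "finite A" "finite B" and a: "\<And>u. u \<notin> A \<Longrightarrow> a u = 0" and b: "\<And>v. v \<notin> B \<Longrightarrow> b v = 0"
  shows "convolution G a b w = (\<Sum>u\<in>A. \<Sum>v\<in>B. if u \<otimes>\<^bsub>G\<^esub> v = w then a u * b v else 0)"
proof -
  have "(\<Sum>u\<in>A. \<Sum>v\<in>B. if u \<otimes>\<^bsub>G\<^esub> v = w then a u * b v else 0) =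
      (\<Sum>(u, v)\<in>A \<times> B. if u \<otimes>\<^bsub>G\<^esub> v = w then a u * b v else 0)"
    by (rule sum.cartesian_product)
  also have "\<dots> = (\<Sum>(u, v)\<in>{(u, v). a u \<noteq> 0 \<and> b v \<noteq> 0 \<and> u \<otimes>\<^bsub>G\<^esub> v = w}. a u * b v)"
    by (rule sum.mono_neutral_cong_right) (use fin a b in \<open>auto split: if_splits\<close>)
  finally show ?thesis by (simp add: convolution_def)
qed

lemma sum_swap3:
  "(\<Sum>z\<in>Z. \<Sum>u\<in>A. \<Sum>y\<in>Y. f z u y) = (\<Sum>u\<in>A. \<Sum>y\<in>Y. \<Sum>z\<in>Z. f z u y)"
  by (subst sum.swap) (intro sum.cong [OF HOL.refl] sum.swap)

text \<open>The weight \<open>h\<close> is the length where the generator acts on the inner product,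
  and 1 where it does not.\<close>

lemma convolution_left:
  fixes h :: "'g \<Rightarrow> complex"
  assumes fin: "finite A" "finite Y" "finite B"
    and a: "\<And>u. u \<notin> A \<Longrightarrow> a u = 0" and x: "\<And>y. y \<notin> Y \<Longrightarrow> x y = 0" and b: "\<And>v. v \<notin> B \<Longrightarrow> b v = 0"
  shows "convolution G (\<lambda>z. h z * convolution G a x z) b w =
    (\<Sum>u\<in>A. \<Sum>y\<in>Y. \<Sum>v\<in>B. if u \<otimes>\<^bsub>G\<^esub> y \<otimes>\<^bsub>G\<^esub> v = w then h (u \<otimes>\<^bsub>G\<^esub> y) * (a u * x y * b v) else 0)"
proof -
  define Z where "Z = (\<lambda>(u, y). u \<otimes>\<^bsub>G\<^esub> y) ` (A \<times> Y)"
  have finZ: "finite Z" using fin by (simp add: Z_def)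
  have ax: "convolution G a x z = (\<Sum>u\<in>A. \<Sum>y\<in>Y. if u \<otimes>\<^bsub>G\<^esub> y = z then a u * x y else 0)" for z
    by (rule convolution_finite [OF fin(1,2) a x])
  have "convolution G (\<lambda>z. h z * convolution G a x z) b w =
      (\<Sum>z\<in>Z. \<Sum>v\<in>B. if z \<otimes>\<^bsub>G\<^esub> v = w then h z * convolution G a x z * b v else 0)"
  proof (rule convolution_finite [OF finZ fin(3) _ b])
    fix z assume "z \<notin> Z"
    then show "h z * convolution G a x z = 0"
      unfolding ax by (auto simp: Z_def intro!: sum.neutral)
  qed
  also have "\<dots> = (\<Sum>z\<in>Z. \<Sum>v\<in>B. \<Sum>u\<in>A. \<Sum>y\<in>Y. if z = u \<otimes>\<^bsub>G\<^esub> y then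
      (if z \<otimes>\<^bsub>G\<^esub> v = w then h z * (a u * x y * b v) else 0) else 0)"
  proof (intro sum.cong [OF HOL.refl])
    fix z v
    show "(if z \<otimes>\<^bsub>G\<^esub> v = w then h z * convolution G a x z * b v else 0) = (\<Sum>u\<in>A. \<Sum>y\<in>Y. if z = u \<otimes>\<^bsub>G\<^esub> y then
      (if z \<otimes>\<^bsub>G\<^esub> v = w then h z * (a u * x y * b v) else 0) else 0)"
    proof (cases "z \<otimes>\<^bsub>G\<^esub> v = w")
      case True
      then show ?thesis unfolding ax
        by (auto simp: sum_distrib_left sum_distrib_right mult_ac intro!: sum.cong)
    qed (auto intro!: sum.neutral)
  qed
  also have "\<dots> = (\<Sum>u\<in>A. \<Sum>y\<in>Y. \<Sum>v\<in>B. \<Sum>z\<in>Z. if z = u \<otimes>\<^bsub>G\<^esub> y then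
      (if z \<otimes>\<^bsub>G\<^esub> v = w then h z * (a u * x y * b v) else 0) else 0)"
    by (subst sum.swap, subst sum_swap3, rule sum_swap3)
  also have "\<dots> = (\<Sum>u\<in>A. \<Sum>y\<in>Y. \<Sum>v\<in>B. if u \<otimes>\<^bsub>G\<^esub> y \<otimes>\<^bsub>G\<^esub> v = w then h (u \<otimes>\<^bsub>G\<^esub> y) * (a u * x y * b v) else 0)"
    using finZ by (intro sum.cong HOL.refl) (auto simp: Z_def)
  finally show ?thesis .
qed

lemma convolution_right:
  fixes h :: "'g \<Rightarrow> complex"
  assumes fin: "finite A" "finite Y" "finite B"
    and a: "\<And>u. u \<notin> A \<Longrightarrow> a u = 0" and x: "\<And>y. y \<notin> Y \<Longrightarrow> x y = 0" and b: "\<And>v. v \<notin> B \<Longrightarrow> b v = 0"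
  shows "convolution G a (\<lambda>z. h z * convolution G x b z) w =
    (\<Sum>u\<in>A. \<Sum>y\<in>Y. \<Sum>v\<in>B. if u \<otimes>\<^bsub>G\<^esub> (y \<otimes>\<^bsub>G\<^esub> v) = w then h (y \<otimes>\<^bsub>G\<^esub> v) * (a u * x y * b v) else 0)"
proof -
  define Z where "Z = (\<lambda>(y, v). y \<otimes>\<^bsub>G\<^esub> v) ` (Y \<times> B)"
  have finZ: "finite Z" using fin by (simp add: Z_def)
  have xb: "convolution G x b z = (\<Sum>y\<in>Y. \<Sum>v\<in>B. if y \<otimes>\<^bsub>G\<^esub> v = z then x y * b v else 0)" for z
    by (rule convolution_finite [OF fin(2,3) x b])
  have "convolution G a (\<lambda>z. h z * convolution G x b z) w =
      (\<Sum>u\<in>A. \<Sum>z\<in>Z. if u \<otimes>\<^bsub>G\<^esub> z = w then a u * (h z * convolution G x b z) else 0)"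
  proof (rule convolution_finite [OF fin(1) finZ a])
    fix z assume "z \<notin> Z"
    then show "h z * convolution G x b z = 0"
      unfolding xb by (auto simp: Z_def intro!: sum.neutral)
  qed
  also have "\<dots> = (\<Sum>u\<in>A. \<Sum>z\<in>Z. \<Sum>y\<in>Y. \<Sum>v\<in>B. if z = y \<otimes>\<^bsub>G\<^esub> v then
      (if u \<otimes>\<^bsub>G\<^esub> z = w then h z * (a u * x y * b v) else 0) else 0)"
  proof (intro sum.cong [OF HOL.refl])
    fix u z
    show "(if u \<otimes>\<^bsub>G\<^esub> z = w then a u * (h z * convolution G x b z) else 0) = (\<Sum>y\<in>Y. \<Sum>v\<in>B. if z = y \<otimes>\<^bsub>G\<^esub> v then
      (if u \<otimes>\<^bsub>G\<^esub> z = w then h z * (a u * x y * b v) else 0) else 0)"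
    proof (cases "u \<otimes>\<^bsub>G\<^esub> z = w")
      case True
      then show ?thesis unfolding xb
        by (auto simp: sum_distrib_left sum_distrib_right mult_ac intro!: sum.cong)
    qed (auto intro!: sum.neutral)
  qed
  also have "\<dots> = (\<Sum>u\<in>A. \<Sum>y\<in>Y. \<Sum>v\<in>B. \<Sum>z\<in>Z. if z = y \<otimes>\<^bsub>G\<^esub> v then
      (if u \<otimes>\<^bsub>G\<^esub> z = w then h z * (a u * x y * b v) else 0) else 0)"
    by (rule sum.cong [OF HOL.refl]) (rule sum_swap3)
  also have "\<dots> = (\<Sum>u\<in>A. \<Sum>y\<in>Y. \<Sum>v\<in>B. if u \<otimes>\<^bsub>G\<^esub> (y \<otimes>\<^bsub>G\<^esub> v) = w then h (y \<otimes>\<^bsub>G\<^esub> v) * (a u * x y * b v) else 0)"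
    using finZ by (intro sum.cong HOL.refl) (auto simp: Z_def)
  finally show ?thesis .
qed

lemma gradient_form_finite:
  assumes G: "monoid G" and sub: "A \<subseteq> carrier G" "Y \<subseteq> carrier G" "B \<subseteq> carrier G"
    and fin: "finite A" "finite Y" "finite B"
    and a: "\<And>u. u \<notin> A \<Longrightarrow> a u = 0" and x: "\<And>y. y \<notin> Y \<Longrightarrow> x y = 0" and b: "\<And>v. v \<notin> B \<Longrightarrow> b v = 0"
  shows "gradient_form G \<psi> a b x w =
    (\<Sum>u\<in>A. \<Sum>y\<in>Y. \<Sum>v\<in>B. if u \<otimes>\<^bsub>G\<^esub> y \<otimes>\<^bsub>G\<^esub> v = w
      then of_int (int (\<psi> (u \<otimes>\<^bsub>G\<^esub> y \<otimes>\<^bsub>G\<^esub> v)) + int (\<psi> y) - int (\<psi> (u \<otimes>\<^bsub>G\<^esub> y)) - int (\<psi> (y \<otimes>\<^bsub>G\<^esub> v))) *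
        (a u * x y * b v) else 0)"
proof -
  have x': "of_nat (\<psi> y) * x y = 0" if "y \<notin> Y" for y using x [OF that] by simp
  have 1: "convolution G (convolution G a x) b w =
      (\<Sum>u\<in>A. \<Sum>y\<in>Y. \<Sum>v\<in>B. if u \<otimes>\<^bsub>G\<^esub> y \<otimes>\<^bsub>G\<^esub> v = w then 1 * (a u * x y * b v) else 0)"
    using convolution_left [OF fin, of a x b G "\<lambda>_. 1" w] a x b by simp
  have 2: "convolution G (convolution G a (\<lambda>y. of_nat (\<psi> y) * x y)) b w =
      (\<Sum>u\<in>A. \<Sum>y\<in>Y. \<Sum>v\<in>B. if u \<otimes>\<^bsub>G\<^esub> y \<otimes>\<^bsub>G\<^esub> v = w then 1 * (a u * (of_nat (\<psi> y) * x y) * b v) else 0)"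
    using convolution_left [OF fin, of a "\<lambda>y. of_nat (\<psi> y) * x y" b G "\<lambda>_. 1" w] a x' b by simp
  have 3: "convolution G (\<lambda>z. of_nat (\<psi> z) * convolution G a x z) b w =
      (\<Sum>u\<in>A. \<Sum>y\<in>Y. \<Sum>v\<in>B. if u \<otimes>\<^bsub>G\<^esub> y \<otimes>\<^bsub>G\<^esub> v = w then of_nat (\<psi> (u \<otimes>\<^bsub>G\<^esub> y)) * (a u * x y * b v) else 0)"
    by (rule convolution_left [OF fin a x b])
  have 4: "convolution G a (\<lambda>z. of_nat (\<psi> z) * convolution G x b z) w =
      (\<Sum>u\<in>A. \<Sum>y\<in>Y. \<Sum>v\<in>B. if u \<otimes>\<^bsub>G\<^esub> (y \<otimes>\<^bsub>G\<^esub> v) = w then of_nat (\<psi> (y \<otimes>\<^bsub>G\<^esub> v)) * (a u * x y * b v) else 0)"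
    by (rule convolution_right [OF fin a x b])
  show ?thesis
    unfolding gradient_form_def Let_def generator_def 1 2 3 4
    unfolding sum_distrib_left sum.distrib [symmetric] sum_subtractf [symmetric]
  proof (intro sum.cong [OF HOL.refl])
    fix u y v assume "u \<in> A" "y \<in> Y" "v \<in> B"
    then have "u \<otimes>\<^bsub>G\<^esub> (y \<otimes>\<^bsub>G\<^esub> v) = u \<otimes>\<^bsub>G\<^esub> y \<otimes>\<^bsub>G\<^esub> v"
      using sub monoid.m_assoc [OF G] by (metis subsetD)
    then show "of_nat (\<psi> w) * (if u \<otimes>\<^bsub>G\<^esub> y \<otimes>\<^bsub>G\<^esub> v = w then 1 * (a u * x y * b v) else 0) +
        (if u \<otimes>\<^bsub>G\<^esub> y \<otimes>\<^bsub>G\<^esub> v = w then 1 * (a u * (of_nat (\<psi> y) * x y) * b v) else 0) -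
        (if u \<otimes>\<^bsub>G\<^esub> y \<otimes>\<^bsub>G\<^esub> v = w then of_nat (\<psi> (u \<otimes>\<^bsub>G\<^esub> y)) * (a u * x y * b v) else 0) -
        (if u \<otimes>\<^bsub>G\<^esub> (y \<otimes>\<^bsub>G\<^esub> v) = w then of_nat (\<psi> (y \<otimes>\<^bsub>G\<^esub> v)) * (a u * x y * b v) else 0) =
        (if u \<otimes>\<^bsub>G\<^esub> y \<otimes>\<^bsub>G\<^esub> v = w
         then of_int (int (\<psi> (u \<otimes>\<^bsub>G\<^esub> y \<otimes>\<^bsub>G\<^esub> v)) + int (\<psi> y) - int (\<psi> (u \<otimes>\<^bsub>G\<^esub> y)) - int (\<psi> (y \<otimes>\<^bsub>G\<^esub> v))) *
           (a u * x y * b v) else 0)"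
      by (simp add: algebra_simps)
  qed
qed

section \<open>The Schatten condition for Coxeter groups\<close>

context coxeter
begin

lemma gradient_schatten_if_finite:
  assumes fin: "\<And>u v. u \<in> carrier W \<Longrightarrow> v \<in> carrier W \<Longrightarrow> finite {w \<in> carrier W. gamma u v w \<noteq> 0}"
  shows "gradient_schatten W len p"
  unfolding gradient_schatten_def
proof (intro ballI)
  fix a b assume ab: "a \<in> group_algebra W" "b \<in> group_algebra W"
  define A where "A = {u. a u \<noteq> 0}"
  define B where "B = {v. b v \<noteq> 0}"
  have A: "finite A" "A \<subseteq> carrier W" "\<And>u. u \<notin> A \<Longrightarrow> a u = 0"
    and B: "finite B" "B \<subseteq> carrier W" "\<And>v. v \<notin> B \<Longrightarrow> b v = 0"
    using ab by (auto simp: group_algebra_def A_def B_def)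
  define N where "N u v = {w \<in> carrier W. gamma u v w \<noteq> 0}" for u v
  \<comment> \<open>Both the arguments \<open>y\<close> with a nonzero coefficient and their images
    \<open>u y v\<close>, so that the kernel is a square matrix on \<open>Y\<close>.\<close>
  define Y where "Y = (\<Union>u\<in>A. \<Union>v\<in>B. N u v \<union> (\<lambda>y. u \<otimes>\<^bsub>W\<^esub> y \<otimes>\<^bsub>W\<^esub> v) ` N u v)"
  have "finite (N u v)" if "u \<in> A" "v \<in> B" for u v
    unfolding N_def using that A B by (intro fin) auto
  then have Y: "finite Y" using A(1) B(1) by (simp add: Y_def)
  have Yc: "Y \<subseteq> carrier W"
  proof -
    have "u \<otimes>\<^bsub>W\<^esub> y \<otimes>\<^bsub>W\<^esub> v \<in> carrier W" if "u \<in> A" "v \<in> B" "y \<in> N u v" for u v y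
      using that A(2) B(2) by (auto simp: N_def subset_iff)
    then show ?thesis by (auto simp: Y_def N_def)
  qed
  \<comment> \<open>For \<open>y\<close> outside the carrier the product \<open>u y v\<close> is
    meaningless and might hit any \<open>w\<close>; the guard keeps the kernel supported on
    \<open>Y\<close>.\<close>
  define K where "K w y = (\<Sum>u\<in>A. \<Sum>v\<in>B. if u \<otimes>\<^bsub>W\<^esub> y \<otimes>\<^bsub>W\<^esub> v = w \<and> y \<in> carrier W
    then of_int (gamma u v y) * (a u * b v) else 0)" for w y
  have K: "K w y = 0" if "w \<notin> Y" for w y
  proof -
    have "gamma u v y = 0" if "u \<in> A" "v \<in> B" "u \<otimes>\<^bsub>W\<^esub> y \<otimes>\<^bsub>W\<^esub> v = w" "y \<in> carrier W" for u v
      using that \<open>w \<notin> Y\<close> by (auto simp: Y_def N_def)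
    then show ?thesis unfolding K_def by (intro sum.neutral ballI) auto
  qed
  have "kernel_op Y K x = gradient_form W len a b x" if x: "x \<in> group_algebra W" for x
  proof
    fix w
    define Z where "Z = Y \<union> {y. x y \<noteq> 0}"
    have Z: "finite Z" "Z \<subseteq> carrier W" "Y \<subseteq> Z" "\<And>y. y \<notin> Z \<Longrightarrow> x y = 0"
      using x Y Yc by (auto simp: group_algebra_def Z_def)
    have "gradient_form W len a b x w = (\<Sum>u\<in>A. \<Sum>y\<in>Z. \<Sum>v\<in>B. if u \<otimes>\<^bsub>W\<^esub> y \<otimes>\<^bsub>W\<^esub> v = w
        then of_int (gamma u v y) * (a u * x y * b v) else 0)"
      unfolding gamma_def by (rule gradient_form_finite [OF monoid_axioms A(2) Z(2) B(2) A(1) Z(1) B(1) A(3) Z(4) B(3)])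
    also have "\<dots> = (\<Sum>y\<in>Z. \<Sum>u\<in>A. \<Sum>v\<in>B. if u \<otimes>\<^bsub>W\<^esub> y \<otimes>\<^bsub>W\<^esub> v = w
        then of_int (gamma u v y) * (a u * x y * b v) else 0)"
      by (rule sum.swap)
    also have "\<dots> = (\<Sum>y\<in>Z. K w y * x y)"
    proof (rule sum.cong [OF HOL.refl])
      fix y assume "y \<in> Z"
      then have "y \<in> carrier W" using Z by blast
      then show "(\<Sum>u\<in>A. \<Sum>v\<in>B. if u \<otimes>\<^bsub>W\<^esub> y \<otimes>\<^bsub>W\<^esub> v = w
        then of_int (gamma u v y) * (a u * x y * b v) else 0) = K w y * x y"
        unfolding K_def sum_distrib_right by (intro sum.cong HOL.refl) simp
    qed
    also have "\<dots> = (\<Sum>y\<in>Y. K w y * x y)"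
    proof (rule sum.mono_neutral_right [OF Z(1,3)], intro ballI)
      fix y assume y: "y \<in> Z - Y"
      have "gamma u v y = 0" if "u \<in> A" "v \<in> B" for u v
        using y Z(2) that by (auto simp: Y_def N_def)
      then have "K w y = 0" unfolding K_def by (intro sum.neutral ballI) auto
      then show "K w y * x y = 0" by simp
    qed
    finally show "kernel_op Y K x w = gradient_form W len a b x w" by (simp add: kernel_op_def)
  qed
  then show "\<exists>T\<in>schatten_class (carrier W) p. \<forall>x\<in>group_algebra W. T x = gradient_form W len a b x"
    using kernel_op_schatten [of Y "carrier W" K p, OF Y Yc K] by blast
qed

lemma finite_centralizer_if_gradient_schatten:
  assumes grad: "gradient_schatten W len p" and s: "s \<in> S"
  shows "finite {w \<in> carrier W. gen s \<otimes>\<^bsub>W\<^esub> w = w \<otimes>\<^bsub>W\<^esub> gen s}"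
proof (rule ccontr)
  let ?Z = "{w \<in> carrier W. gen s \<otimes>\<^bsub>W\<^esub> w = w \<otimes>\<^bsub>W\<^esub> gen s}"
  assume inf: "infinite ?Z"
  have ket_alg: "ket g \<in> group_algebra W" if "g \<in> carrier W" for g
  proof -
    have "{w. ket g w \<noteq> 0} = {g}" by (auto simp: ket_def)
    then show ?thesis using that by (simp add: group_algebra_def)
  qed
  obtain T where T: "T \<in> schatten_class (carrier W) p"
    "\<And>x. x \<in> group_algebra W \<Longrightarrow> T x = gradient_form W len (ket (gen s)) (ket (gen s)) x"
    using grad ket_alg [of "gen s"] s unfolding gradient_schatten_def by blast
  have T_ket: "T (ket w) = (\<lambda>v. of_int (gamma (gen s) (gen s) w) * ket (gen s \<otimes>\<^bsub>W\<^esub> w \<otimes>\<^bsub>W\<^esub> gen s) v)"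
    if w: "w \<in> carrier W" for w
  proof
    fix v
    have "T (ket w) v = (\<Sum>u\<in>{gen s}. \<Sum>y\<in>{w}. \<Sum>v'\<in>{gen s}. if u \<otimes>\<^bsub>W\<^esub> y \<otimes>\<^bsub>W\<^esub> v' = v
        then of_int (gamma u v' y) * (ket (gen s) u * ket w y * ket (gen s) v') else 0)"
      unfolding T(2) [OF ket_alg [OF w]] gamma_def
      by (rule gradient_form_finite [OF monoid_axioms]) (use s w in auto)
    then show "T (ket w) v = of_int (gamma (gen s) (gen s) w) * ket (gen s \<otimes>\<^bsub>W\<^esub> w \<otimes>\<^bsub>W\<^esub> gen s) v"
      by (auto simp: ket_def)
  qed
  have fix_Z: "gen s \<otimes>\<^bsub>W\<^esub> w \<otimes>\<^bsub>W\<^esub> gen s = w" if "w \<in> ?Z" for w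
  proof -
    have "gen s \<otimes>\<^bsub>W\<^esub> w \<otimes>\<^bsub>W\<^esub> gen s = w \<otimes>\<^bsub>W\<^esub> gen s \<otimes>\<^bsub>W\<^esub> gen s" using that by simp
    then show ?thesis using that s by simp
  qed
  have "T \<notin> schatten_class (carrier W) p"
  proof (rule not_schatten_if_infinite_eigen [OF inf])
    fix w assume w: "w \<in> ?Z"
    show "T (ket w) = (\<lambda>v. of_int (gamma (gen s) (gen s) w) * ket w v)"
      using T_ket [of w] fix_Z [OF w] w by simp
    have "cmod (of_int (gamma (gen s) (gen s) w)) = of_int \<bar>gamma (gen s) (gen s) w\<bar>"
      by simp
    also have "\<dots> = 2" using gamma_conj [of s w] s w by simp
    finally show "cmod (of_int (gamma (gen s) (gen s) w)) = 2" .
    fix v assume v: "v \<in> carrier W" "v \<noteq> w"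
    \<comment> \<open>Conjugation by \<open>gen s\<close> is injective and fixes \<open>w\<close>,
      so no other \<open>ket v\<close> is sent to a multiple of \<open>ket w\<close>.\<close>
    have "gen s \<otimes>\<^bsub>W\<^esub> v \<otimes>\<^bsub>W\<^esub> gen s \<noteq> w"
    proof
      assume "gen s \<otimes>\<^bsub>W\<^esub> v \<otimes>\<^bsub>W\<^esub> gen s = w"
      then have "v = gen s \<otimes>\<^bsub>W\<^esub> w \<otimes>\<^bsub>W\<^esub> gen s"
        using v(1) s by (auto simp: m_assoc)
      then show False using fix_Z [OF w] v(2) by simp
    qed
    then show "T (ket v) w = 0" using T_ket [OF v(1)] by simp
  qed auto
  then show False using T(1) by blast
qed

end

theorem corollary5p12:
  fixes S :: "'a set" and m :: "'a \<Rightarrow> 'a \<Rightarrow> enat" and p :: ereal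
  assumes "finite S"
    and "coxeter_matrix S m"
    and "\<forall>s\<in>S. \<forall>t\<in>S. m s t \<noteq> 2"
    and "1 \<le> p"
  shows "gradient_schatten (coxeter_group S m) (coxeter_length S m) p \<longleftrightarrow>
    graph_forest S (odd_edges S m) \<and>
    (\<forall>C \<in> graph_components S (odd_edges S m).
       (\<exists>\<^sub>\<le>\<^sub>1 e. e \<in> even_edges S m \<and> (\<exists>t r. e = {t, r} \<and> t \<in> C \<and> r \<notin> C)) \<and>
       \<not> (\<exists>t t'. {t, t'} \<in> even_edges S m \<and> t \<in> C \<and> t' \<in> C))"
proof -
  interpret coxeter S m by unfold_locales (rule assms(2))
  have "gradient_schatten W len p \<longleftrightarrow> acyclic move"
  proof
    assume grad: "gradient_schatten W len p"
    show "acyclic move"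
      unfolding acyclic_def
    proof (intro allI notI)
      fix x assume "(x, x) \<in> move\<^sup>+"
      then show False
        using infinite_centralizer [OF _ assms(3)] finite_centralizer_if_gradient_schatten [OF grad] by blast
    qed
  next
    assume "acyclic move"
    then show "gradient_schatten W len p"
      using gradient_schatten_if_finite finite_gamma_support finite_conjugators [OF assms(1)] by blast
  qed
  then show ?thesis unfolding acyclic_move_iff .
qed

end
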